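(* Let $\mathcal T$ be an $n$-angulated category, $\mathcal A$ a full subcategory of $\mathcal T$ closed under extensions, and $\mathfrak E$ an almost $n$-exact structure for $\mathcal A$ such that there are enough $\mathfrak E$-injective morphisms and enough $\mathfrak E$-projective morphisms. Let $(\mathcal I,\mathcal J)$ be an ideal cotorsion pair in $\mathcal A$ (with respect to $\mathfrak E$). Then the following statements are equivalent. (a) $\mathcal I$ is precovering. (b) $\mathcal I$ is special precovering. (c) $\mathcal J$ is preenveloping. (d) $\mathcal J$ is special preenveloping. (e) There exists an almost $n$-exact structure $\mathfrak H\subseteq\mathfrak E$ for $\mathcal A$ with enough special $\mathfrak H$-injective morphisms such that $\mathcal I=\Phi_{\mathfrak E}(\mathfrak H)$. (f) There exists an almost $n$-exact structure $\mathfrak F\subseteq\mathfrak E$ for $\mathcal A$ with enough $\mathfrak F$-injective morphisms such that $\mathcal I=\Phi_{\mathfrak E}(\mathfrak F)$. (g) There exists an almost $n$-exact structure $\mathfrak H\subseteq\mathfrak E$ for $\mathcal A$ with enough special $\mathfrak H$-injective morphisms such that $\mathcal J=\mathfrak H\text{-inj}$. (h) There exists an almost $n$-exact structure $\mathfrak G\subseteq\mathfrak E$ for $\mathcal A$ with enough special $\mathfrak G$-projective morphisms such that $\mathcal J=\Phi^{\mathfrak E}(\mathfrak G)$. (i) There exists an almost $n$-exact structure $\mathfrak F\subseteq\mathfrak E$ for $\mathcal A$ with enough $\mathfrak F$-projective morphisms such that $\mathcal J=\Phi^{\mathfrak E}(\mathfrak F)$. (j) There exists an almost $n$-exact structure $\mathfrak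 G\subseteq\mathfrak E$ for $\mathcal A$ with enough special $\mathfrak G$-projective morphisms such that $\mathcal I=\mathfrak G\text{-proj}$.
   Context: Let $n\geq 3$ be an integer. An $n$-angulated category is an additive category $\mathcal T$ with an automorphism $\Sigma$ and a collection of sequences $A_1\xrightarrow{\alpha_1}A_2\xrightarrow{\alpha_2}\cdots\xrightarrow{\alpha_{n-1}}A_n\xrightarrow{\alpha_n}\Sigma A_1$, called $n$-angles, satisfying the following (a morphism of such sequences is a tuple $(\varphi_1,\dots,\varphi_n)$ commuting with all maps, with $\Sigma\varphi_1$ on the last term). (F1) The collection is closed under direct sums and direct summands, contains $A\xrightarrow{1}A\to0\to\cdots\to0\to\Sigma A$ for all $A$, and every morphism $\alpha_1:A_1\to A_2$ is the first morphism of some $n$-angle. (F2) A sequence is an $n$-angle iff its left rotation $A_2\xrightarrow{\alpha_2}\cdots\xrightarrow{\alpha_n}\Sigma A_1\xrightarrow{(-1)^n\Sigma\alpha_1}\Sigma A_2$ is. (F3) Given two $n$-angles $(A_i,\alpha_i)$, $(B_i,\beta_i)$ and $\varphi_1,\varphi_2$ with $\varphi_2\alpha_1=\beta_1\varphi_1$, there are $\varphi_3,\dots,\varphi_n$ making $(\varphi_1,\dots,\varphi_n)$ a morphism. (F4) In (F3) these can be chosen so that the cone $A_2\oplus B_1\to A_3\oplus B_2\to\cdots\to\Sigma A_1\oplus B_n\to\Sigma A_2\oplus\Sigma B_1$, with maps $\begin{pmatrix}-\alpha_{i+1}&0\\ \varphi_{i+1}&\beta_i\end{pmatrix}$ ($1\le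 i\le n-1$) and finally $\begin{pmatrix}-\Sigma\alpha_1&0\\ \Sigma\varphi_1&\beta_n\end{pmatrix}$, is an $n$-angle. An $n$-angle is split if $\alpha_n=0$. $\mathcal A\subseteq\mathcal T$ is a full subcategory, closed under isomorphisms and closed under extensions: for every $n$-angle with $A_1,A_n\in\mathcal A$ also $A_2,\dots,A_{n-1}\in\mathcal A$. $\mathfrak D_{\mathcal A}$ is the class of all $n$-angles with $A_1,\dots,A_n\in\mathcal A$. A class $\mathfrak E\subseteq\mathfrak D_{\mathcal A}$ is an almost $n$-exact structure for $\mathcal A$ if: (N1) $\mathfrak E$ is closed under direct sums and contains all split $n$-angles (in $\mathfrak D_{\mathcal A}$); (N2) if $\mathfrak d\in\mathfrak E$ has last morphism $\alpha_n:A_n\to\Sigma A_1$ and $f:B_n\to A_n$ is in $\mathcal A$, then every $n$-angle $A_1\to B_2\to\cdots\to B_n\xrightarrow{\alpha_nf}\Sigma A_1$ admitting a morphism of $n$-angles $(1_{A_1},*,\dots,*,f)$ to $\mathfrak d$ is in $\mathfrak E$; (N3) if $\mathfrak d\in\mathfrak E$ is as before and $g:A_1\to C_1$ is in $\mathcal A$, then every $n$-angle $C_1\to C_2\to\cdots\to A_n\xrightarrow{(\Sigma g)\alpha_n}\Sigma C_1$ receiving a morphism of $n$-angles $(g,*,\dots,*,1_{A_n})$ from $\mathfrak d$ is in $\mathfrak E$. For an $n$-angle in $\mathfrak E$, $\alpha_1$ is called an $\mathfrak E$-inflation, $\alpha_{n-1}$ an $\mathfrak E$-deflation and $\alpha_n$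 an $\mathfrak E$-phantom; $\Phi(\mathfrak E)$ is the class of all $\mathfrak E$-phantoms. The same terminology is used for any almost $n$-exact structure for $\mathcal A$. A morphism $f:X\to A$ in $\mathcal A$ is $\mathfrak E$-projective if it factors through every $\mathfrak E$-deflation $A_{n-1}\to A$; $g:A\to Y$ in $\mathcal A$ is $\mathfrak E$-injective if it factors through every $\mathfrak E$-inflation $A\to A_2$. The classes of these morphisms are $\mathfrak E\text{-proj}$ and $\mathfrak E\text{-inj}$. There are enough $\mathfrak E$-injective morphisms if for every $A\in\mathcal A$ there is an $\mathfrak E$-inflation $A\to E$ which is $\mathfrak E$-injective; enough $\mathfrak E$-projective morphisms if for every $C\in\mathcal A$ there is an $\mathfrak E$-deflation $P\to C$ which is $\mathfrak E$-projective. An ideal in $\mathcal A$ is a class of morphisms of $\mathcal A$ forming a subfunctor of the (additive) bifunctor $\mathrm{Hom}_{\mathcal A}(-,-)$. An $\mathcal I$-precover of $A$ is a morphism $i:X\to A$ in $\mathcal I$ through which every morphism $X'\to A$ in $\mathcal I$ factors; $\mathcal I$-preenvelopes are dual. $\mathcal I$ is precovering (preenveloping) if every object of $\mathcal A$ has an $\mathcal I$-precover ($\mathcal I$-preenvelope). For morphisms $f:X\to A$, $g:B\to Y$ in $\mathcal A$, $f\perp g$ means $(\Sigma g)\phi f=0$ for all $\phi:A\to\Sigma B$ in $\Phi(\mathfrak E)$. For a class $\mathcal M$ of morphisms of $\mathcal A$, $\mathcal M^\perp=\{g: m\perp g\ \forall m\in\mathcal M\}$ and ${}^\perp\mathcal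 M=\{g: g\perp m\ \forall m\in\mathcal M\}$ (classes of morphisms of $\mathcal A$). An ideal cotorsion pair is a pair of ideals with $\mathcal J=\mathcal I^\perp$ and $\mathcal I={}^\perp\mathcal J$. A morphism $i:X\to A$ in $\mathcal I$ is a special $\mathcal I$-precover of $A$ if in the corresponding $n$-angle $A_1\to\cdots\to A_{n-2}\to X\xrightarrow{i}A\xrightarrow{\psi}\Sigma A_1$ one has $\psi=(\Sigma j)\phi$ with $j\in\mathcal I^\perp$, $\phi\in\Phi(\mathfrak E)$. A morphism $j:B\to Y$ in $\mathcal J$ is a special $\mathcal J$-preenvelope of $B$ if in the corresponding $n$-angle $B\xrightarrow{j}Y\to B_3\to\cdots\to B_n\xrightarrow{\psi}\Sigma B$ one has $\psi=\phi i$ with $i\in{}^\perp\mathcal J$, $\phi\in\Phi(\mathfrak E)$. An ideal is special precovering (special preenveloping) if every object of $\mathcal A$ has a special precover (special preenvelope) with respect to it. For an almost $n$-exact structure $\mathfrak F\subseteq\mathfrak E$: $\Phi_{\mathfrak E}(\mathfrak F)$ is the class of morphisms $\phi$ in $\mathcal A$ with $h\phi\in\Phi(\mathfrak F)$ for all (composable) $h\in\Phi(\mathfrak E)$, and $\Phi^{\mathfrak E}(\mathfrak F)$ is the class of morphisms $\psi$ in $\mathcal A$ with $\psi h\in\Sigma^{-1}\Phi(\mathfrak F)$ for all (composable) $h\in\Sigma^{-1}\Phi(\mathfrak E)$. For $\mathfrak H\subseteq\mathfrak E$, an $\mathfrak H$-injective morphism $e:A\to E$ is special (with respect to $\mathfrak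 E$) if there is a morphism of $n$-angles $(1_A,*,\dots,*,\phi)$ from an $n$-angle $A\xrightarrow{e}E\to B_3\to\cdots\to B_{n-1}\to X\to\Sigma A$ to an $n$-angle $A\to A_2\to\cdots\to A_n\to\Sigma A$ in $\mathfrak E$ with $\phi:X\to A_n$ in $\Phi_{\mathfrak E}(\mathfrak H)$. Dually, an $\mathfrak H$-projective morphism $p:P\to A$ is special if there is a morphism of $n$-angles $(\psi,*,\dots,*,1_A)$ from an $n$-angle $B_1\to\cdots\to B_{n-1}\to A\to\Sigma B_1$ in $\mathfrak E$ to an $n$-angle $A_1\to\cdots\to A_{n-2}\to P\xrightarrow{p}A\to\Sigma A_1$ with $\psi:B_1\to A_1$ in $\Phi^{\mathfrak E}(\mathfrak H)$. There are enough special $\mathfrak H$-injective (special $\mathfrak H$-projective) morphisms if for every $A\in\mathcal A$ there is an $\mathfrak H$-inflation $A\to E$ which is special $\mathfrak H$-injective (an $\mathfrak H$-deflation $P\to A$ which is special $\mathfrak H$-projective). *)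

theory Defs
  imports "HOL-Algebra.Group"
begin

section \<open>Additive categories with an automorphism\<close>

text \<open>
  Every arrow carries its domain and codomain, so distinct Hom sets are disjoint and a class of
  morphisms is a plain set of arrows. The fields \<open>ShOb\<close> and \<open>Sh\<close> are the action of \<open>\<Sigma>\<close> on objects
  and arrows; \<open>Ang\<close> is the class of \<open>n\<close>-angles.

  A sequence \<open>A\<^sub>1 \<rightarrow> A\<^sub>2 \<rightarrow> \<dots> \<rightarrow> A\<^sub>n \<rightarrow> \<Sigma> A\<^sub>1\<close> is the list \<open>[\<alpha>\<^sub>1, \<dots>, \<alpha>\<^sub>n]\<close> of its arrows, with objects
  \<open>A\<^sub>i = Dom \<alpha>\<^sub>i\<close>; list positions start at \<open>0\<close>, so \<open>\<alpha>\<^sub>i\<close> is \<open>\<alpha>s ! (i - 1)\<close>.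
\<close>

record ('o, 'm) ncat =
  Ob :: "'o set"
  Ar :: "'m set"
  Dom :: "'m \<Rightarrow> 'o"
  Cod :: "'m \<Rightarrow> 'o"
  Id :: "'o \<Rightarrow> 'm"
  Comp :: "'m \<Rightarrow> 'm \<Rightarrow> 'm"  (infixl \<open>\<cdot>\<index>\<close> 75)
  Plus :: "'m \<Rightarrow> 'm \<Rightarrow> 'm"  (infixl \<open>\<oplus>\<index>\<close> 65)
  Zero :: "'o \<Rightarrow> 'o \<Rightarrow> 'm"
  ShOb :: "'o \<Rightarrow> 'o"
  Sh :: "'m \<Rightarrow> 'm"
  Ang :: "'m list set"

definition Hom :: "('o, 'm, 'z) ncat_scheme \<Rightarrow> 'o \<Rightarrow> 'o \<Rightarrow> 'm set" where
  "Hom T X Y = {f \<in> Ar T. Dom T f = X \<and> Cod T f = Y}"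

definition hom_group :: "('o, 'm, 'z) ncat_scheme \<Rightarrow> 'o \<Rightarrow> 'o \<Rightarrow> 'm monoid" where
  "hom_group T X Y = \<lparr>carrier = Hom T X Y, mult = Plus T, one = Zero T X Y\<rparr>"

definition Neg :: "('o, 'm, 'z) ncat_scheme \<Rightarrow> 'm \<Rightarrow> 'm" where
  "Neg T f = m_inv (hom_group T (Dom T f) (Cod T f)) f"

definition isomorphic_objects :: "('o, 'm, 'z) ncat_scheme \<Rightarrow> 'o \<Rightarrow> 'o \<Rightarrow> bool" where
  "isomorphic_objects T X Y \<longleftrightarrow>
     (\<exists>f\<in>Hom T X Y. \<exists>g\<in>Hom T Y X. Comp T g f = Id T X \<and> Comp T f g = Id T Y)"

definition zero_object :: "('o, 'm, 'z) ncat_scheme \<Rightarrow> 'o \<Rightarrow> bool" where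
  "zero_object T Z \<longleftrightarrow> Z \<in> Ob T \<and>
     (\<forall>X\<in>Ob T. (\<exists>!f. f \<in> Hom T X Z) \<and> (\<exists>!f. f \<in> Hom T Z X))"

definition biproduct ::
    "('o, 'm, 'z) ncat_scheme \<Rightarrow> 'o \<Rightarrow> 'o \<Rightarrow> 'o \<Rightarrow> 'm \<Rightarrow> 'm \<Rightarrow> 'm \<Rightarrow> 'm \<Rightarrow> bool" where
  "biproduct T X Y W i\<^sub>1 i\<^sub>2 p\<^sub>1 p\<^sub>2 \<longleftrightarrow>
     W \<in> Ob T \<and> i\<^sub>1 \<in> Hom T X W \<and> i\<^sub>2 \<in> Hom T Y W \<and> p\<^sub>1 \<in> Hom T W X \<and> p\<^sub>2 \<in> Hom T W Y \<and>
     Comp T p\<^sub>1 i\<^sub>1 = Id T X \<and> Comp T p\<^sub>2 i\<^sub>2 = Id T Y \<and>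
     Comp T p\<^sub>1 i\<^sub>2 = Zero T Y X \<and> Comp T p\<^sub>2 i\<^sub>1 = Zero T X Y \<and>
     Plus T (Comp T i\<^sub>1 p\<^sub>1) (Comp T i\<^sub>2 p\<^sub>2) = Id T W"

locale additive_category =
  fixes T :: "('o, 'm, 'z) ncat_scheme" (structure)
  assumes dom_cod: "f \<in> Ar T \<Longrightarrow> Dom T f \<in> Ob T \<and> Cod T f \<in> Ob T"
    and id_hom: "X \<in> Ob T \<Longrightarrow> Id T X \<in> Hom T X X"
    and comp_hom: "f \<in> Hom T X Y \<Longrightarrow> g \<in> Hom T Y Z \<Longrightarrow> g \<cdot> f \<in> Hom T X Z"
    and comp_assoc: "f \<in> Hom T W X \<Longrightarrow> g \<in> Hom T X Y \<Longrightarrow> h \<in> Hom T Y Z \<Longrightarrow>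
          (h \<cdot> g) \<cdot> f = h \<cdot> (g \<cdot> f)"
    and id_left: "f \<in> Hom T X Y \<Longrightarrow> Id T Y \<cdot> f = f"
    and id_right: "f \<in> Hom T X Y \<Longrightarrow> f \<cdot> Id T X = f"
    and hom_comm_group: "X \<in> Ob T \<Longrightarrow> Y \<in> Ob T \<Longrightarrow> comm_group (hom_group T X Y)"
    and comp_plus_right: "f \<in> Hom T X Y \<Longrightarrow> g \<in> Hom T X Y \<Longrightarrow> h \<in> Hom T Y Z \<Longrightarrow>
          h \<cdot> (f \<oplus> g) = h \<cdot> f \<oplus> h \<cdot> g"
    and comp_plus_left: "f \<in> Hom T X Y \<Longrightarrow> g \<in> Hom T Y Z \<Longrightarrow> h \<in> Hom T Y Z \<Longrightarrow>
          (g \<oplus> h) \<cdot> f = g \<cdot> f \<oplus> h \<cdot> f"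
    and ex_zero_object: "\<exists>Z. zero_object T Z"
    and ex_biproduct: "X \<in> Ob T \<Longrightarrow> Y \<in> Ob T \<Longrightarrow> \<exists>W i\<^sub>1 i\<^sub>2 p\<^sub>1 p\<^sub>2. biproduct T X Y W i\<^sub>1 i\<^sub>2 p\<^sub>1 p\<^sub>2"

locale additive_category_with_automorphism = additive_category +
  assumes sh_ob_bij: "bij_betw (ShOb T) (Ob T) (Ob T)"
    and sh_bij: "bij_betw (Sh T) (Ar T) (Ar T)"
    and sh_hom: "f \<in> Hom T X Y \<Longrightarrow> Sh T f \<in> Hom T (ShOb T X) (ShOb T Y)"
    and sh_id: "X \<in> Ob T \<Longrightarrow> Sh T (Id T X) = Id T (ShOb T X)"
    and sh_comp: "f \<in> Hom T X Y \<Longrightarrow> g \<in> Hom T Y Z \<Longrightarrow> Sh T (g \<cdot> f) = Sh T g \<cdot> Sh T f"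
    and sh_plus: "f \<in> Hom T X Y \<Longrightarrow> g \<in> Hom T X Y \<Longrightarrow> Sh T (f \<oplus> g) = Sh T f \<oplus> Sh T g"

section \<open>Sequences and $n$-angulated categories\<close>

text \<open>
  Appends the \<open>(n + 1)\<close>-st term that a list of arrows acquires by \<open>\<Sigma>\<close>-periodicity: \<open>\<Sigma> \<alpha>\<^sub>1\<close> follows
  \<open>\<alpha>\<^sub>n\<close> in a sequence, and \<open>\<Sigma> \<phi>\<^sub>1\<close> is the last component of a morphism of sequences.
\<close>

definition ext :: "('o, 'm, 'z) ncat_scheme \<Rightarrow> 'm list \<Rightarrow> 'm list" where
  "ext T \<alpha>s = \<alpha>s @ [Sh T (hd \<alpha>s)]"

definition sigma_seq :: "nat \<Rightarrow> ('o, 'm, 'z) ncat_scheme \<Rightarrow> 'm list \<Rightarrow> bool" where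
  "sigma_seq n T \<alpha>s \<longleftrightarrow> length \<alpha>s = n \<and> set \<alpha>s \<subseteq> Ar T \<and>
     (\<forall>k<n. Cod T (\<alpha>s ! k) = Dom T (ext T \<alpha>s ! Suc k))"

definition seq_morphism ::
    "('o, 'm, 'z) ncat_scheme \<Rightarrow> 'm list \<Rightarrow> 'm list \<Rightarrow> 'm list \<Rightarrow> bool" where
  "seq_morphism T \<phi>s \<alpha>s \<beta>s \<longleftrightarrow>
     length \<phi>s = length \<alpha>s \<and> length \<beta>s = length \<alpha>s \<and>
     (\<forall>k<length \<alpha>s. \<phi>s ! k \<in> Hom T (Dom T (\<alpha>s ! k)) (Dom T (\<beta>s ! k)) \<and>
        Comp T (ext T \<phi>s ! Suc k) (\<alpha>s ! k) = Comp T (\<beta>s ! k) (\<phi>s ! k))"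

text \<open>
  \<open>\<gamma>s\<close> is a direct sum of \<open>\<alpha>s\<close> and \<open>\<beta>s\<close>. Since biproducts are only determined up to isomorphism, so
  are direct sums; closure under direct sums refers to all of them.
\<close>

definition seq_direct_sum ::
    "('o, 'm, 'z) ncat_scheme \<Rightarrow> 'm list \<Rightarrow> 'm list \<Rightarrow> 'm list \<Rightarrow> bool" where
  "seq_direct_sum T \<alpha>s \<beta>s \<gamma>s \<longleftrightarrow>
     (\<exists>i\<^sub>1 i\<^sub>2 p\<^sub>1 p\<^sub>2.
        seq_morphism T i\<^sub>1 \<alpha>s \<gamma>s \<and> seq_morphism T i\<^sub>2 \<beta>s \<gamma>s \<and>
        seq_morphism T p\<^sub>1 \<gamma>s \<alpha>s \<and> seq_morphism T p\<^sub>2 \<gamma>s \<beta>s \<and>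
        (\<forall>k<length \<gamma>s. biproduct T (Dom T (\<alpha>s ! k)) (Dom T (\<beta>s ! k)) (Dom T (\<gamma>s ! k))
           (i\<^sub>1 ! k) (i\<^sub>2 ! k) (p\<^sub>1 ! k) (p\<^sub>2 ! k)))"

definition rotate_left :: "('o, 'm, 'z) ncat_scheme \<Rightarrow> 'm list \<Rightarrow> 'm list" where
  "rotate_left T \<alpha>s = tl \<alpha>s @
     [if even (length \<alpha>s) then Sh T (hd \<alpha>s) else Neg T (Sh T (hd \<alpha>s))]"

text \<open>
  \<open>\<gamma>s\<close> is a cone of \<open>\<phi>s : \<alpha>s \<rightarrow> \<beta>s\<close>: its \<open>i\<close>-th object is a biproduct of \<open>A\<^bsub>i+1\<^esub>\<close> (with
  \<open>A\<^bsub>n+1\<^esub> = \<Sigma> A\<^sub>1\<close>) and \<open>B\<^sub>i\<close>, and its \<open>i\<close>-th map has the entries \<open>-\<alpha>\<^bsub>i+1\<^esub>\<close>, \<open>\<phi>\<^bsub>i+1\<^esub>\<close> and \<open>\<beta>\<^sub>i\<close>, where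
  \<open>\<alpha>\<^bsub>n+1\<^esub> = \<Sigma> \<alpha>\<^sub>1\<close> and \<open>\<phi>\<^bsub>n+1\<^esub> = \<Sigma> \<phi>\<^sub>1\<close>.
\<close>

definition seq_cone ::
    "('o, 'm, 'z) ncat_scheme \<Rightarrow> 'm list \<Rightarrow> 'm list \<Rightarrow> 'm list \<Rightarrow> 'm list \<Rightarrow> bool" where
  "seq_cone T \<alpha>s \<beta>s \<phi>s \<gamma>s \<longleftrightarrow>
     (\<exists>i\<^sub>1 i\<^sub>2 p\<^sub>1 p\<^sub>2.
        length i\<^sub>1 = length \<gamma>s \<and> length i\<^sub>2 = length \<gamma>s \<and>
        length p\<^sub>1 = length \<gamma>s \<and> length p\<^sub>2 = length \<gamma>s \<and>
        (\<forall>k<length \<gamma>s.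
           biproduct T (Dom T (ext T \<alpha>s ! Suc k)) (Dom T (\<beta>s ! k)) (Dom T (\<gamma>s ! k))
             (i\<^sub>1 ! k) (i\<^sub>2 ! k) (p\<^sub>1 ! k) (p\<^sub>2 ! k) \<and>
           \<gamma>s ! k =
             Plus T
               (Plus T
                 (Comp T (ext T i\<^sub>1 ! Suc k) (Comp T (Neg T (ext T \<alpha>s ! Suc k)) (p\<^sub>1 ! k)))
                 (Comp T (ext T i\<^sub>2 ! Suc k) (Comp T (ext T \<phi>s ! Suc k) (p\<^sub>1 ! k))))
               (Comp T (ext T i\<^sub>2 ! Suc k) (Comp T (\<beta>s ! k) (p\<^sub>2 ! k)))))"

locale n_angulated_category = additive_category_with_automorphism T
  for n :: nat and T :: "('o, 'm, 'z) ncat_scheme" (structure) +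
  assumes n_ge_3: "n \<ge> 3"
    and ang_seq: "\<alpha>s \<in> Ang T \<Longrightarrow> sigma_seq n T \<alpha>s"
    and F1_sum: "\<alpha>s \<in> Ang T \<Longrightarrow> \<beta>s \<in> Ang T \<Longrightarrow> sigma_seq n T \<gamma>s \<Longrightarrow>
          seq_direct_sum T \<alpha>s \<beta>s \<gamma>s \<Longrightarrow> \<gamma>s \<in> Ang T"
    and F1_summand: "\<gamma>s \<in> Ang T \<Longrightarrow> sigma_seq n T \<alpha>s \<Longrightarrow> sigma_seq n T \<beta>s \<Longrightarrow>
          seq_direct_sum T \<alpha>s \<beta>s \<gamma>s \<Longrightarrow> \<alpha>s \<in> Ang T \<and> \<beta>s \<in> Ang T"
    and F1_trivial: "X \<in> Ob T \<Longrightarrow> sigma_seq n T \<alpha>s \<Longrightarrow> hd \<alpha>s = Id T X \<Longrightarrow>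
          (\<And>k. 2 \<le> k \<Longrightarrow> k < n \<Longrightarrow> zero_object T (Dom T (\<alpha>s ! k))) \<Longrightarrow> \<alpha>s \<in> Ang T"
    and F1_complete: "f \<in> Ar T \<Longrightarrow> \<exists>\<alpha>s\<in>Ang T. hd \<alpha>s = f"
    and F2: "sigma_seq n T \<alpha>s \<Longrightarrow> \<alpha>s \<in> Ang T \<longleftrightarrow> rotate_left T \<alpha>s \<in> Ang T"
    and F3: "\<alpha>s \<in> Ang T \<Longrightarrow> \<beta>s \<in> Ang T \<Longrightarrow>
          \<phi>\<^sub>1 \<in> Hom T (Dom T (\<alpha>s ! 0)) (Dom T (\<beta>s ! 0)) \<Longrightarrow>
          \<phi>\<^sub>2 \<in> Hom T (Dom T (\<alpha>s ! 1)) (Dom T (\<beta>s ! 1)) \<Longrightarrow>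
          \<phi>\<^sub>2 \<cdot> (\<alpha>s ! 0) = (\<beta>s ! 0) \<cdot> \<phi>\<^sub>1 \<Longrightarrow>
          \<exists>\<phi>s. seq_morphism T \<phi>s \<alpha>s \<beta>s \<and> \<phi>s ! 0 = \<phi>\<^sub>1 \<and> \<phi>s ! 1 = \<phi>\<^sub>2"
    and F4: "\<alpha>s \<in> Ang T \<Longrightarrow> \<beta>s \<in> Ang T \<Longrightarrow>
          \<phi>\<^sub>1 \<in> Hom T (Dom T (\<alpha>s ! 0)) (Dom T (\<beta>s ! 0)) \<Longrightarrow>
          \<phi>\<^sub>2 \<in> Hom T (Dom T (\<alpha>s ! 1)) (Dom T (\<beta>s ! 1)) \<Longrightarrow>
          \<phi>\<^sub>2 \<cdot> (\<alpha>s ! 0) = (\<beta>s ! 0) \<cdot> \<phi>\<^sub>1 \<Longrightarrow>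
          \<exists>\<phi>s. seq_morphism T \<phi>s \<alpha>s \<beta>s \<and> \<phi>s ! 0 = \<phi>\<^sub>1 \<and> \<phi>s ! 1 = \<phi>\<^sub>2 \<and>
            (\<exists>\<gamma>s\<in>Ang T. seq_cone T \<alpha>s \<beta>s \<phi>s \<gamma>s)"

section \<open>Almost $n$-exact structures\<close>

text \<open>A full subcategory is given by its set \<open>A\<close> of objects.\<close>

definition extension_closed_subcategory :: "('o, 'm, 'z) ncat_scheme \<Rightarrow> 'o set \<Rightarrow> bool" where
  "extension_closed_subcategory T A \<longleftrightarrow>
     A \<subseteq> Ob T \<and>
     (\<forall>X\<in>A. \<forall>Y\<in>Ob T. isomorphic_objects T X Y \<longrightarrow> Y \<in> A) \<and>
     (\<forall>\<alpha>s\<in>Ang T. Dom T (hd \<alpha>s) \<in> A \<and> Dom T (last \<alpha>s) \<in> A \<longrightarrow> (\<forall>a\<in>set \<alpha>s. Dom T a \<in> A))"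

definition Mor :: "('o, 'm, 'z) ncat_scheme \<Rightarrow> 'o set \<Rightarrow> 'm set" where
  "Mor T A = {f \<in> Ar T. Dom T f \<in> A \<and> Cod T f \<in> A}"

definition angles_in :: "('o, 'm, 'z) ncat_scheme \<Rightarrow> 'o set \<Rightarrow> 'm list set" where
  "angles_in T A = {\<alpha>s \<in> Ang T. \<forall>a\<in>set \<alpha>s. Dom T a \<in> A}"

definition split_angle :: "('o, 'm, 'z) ncat_scheme \<Rightarrow> 'm list \<Rightarrow> bool" where
  "split_angle T \<alpha>s \<longleftrightarrow> \<alpha>s \<in> Ang T \<and>
     last \<alpha>s = Zero T (Dom T (last \<alpha>s)) (Cod T (last \<alpha>s))"

definition almost_exact_structure ::
    "('o, 'm, 'z) ncat_scheme \<Rightarrow> 'o set \<Rightarrow> 'm list set \<Rightarrow> bool" where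
  "almost_exact_structure T A E \<longleftrightarrow>
     E \<subseteq> angles_in T A \<and>
     (\<forall>\<alpha>s\<in>E. \<forall>\<beta>s\<in>E. \<forall>\<gamma>s\<in>Ang T. seq_direct_sum T \<alpha>s \<beta>s \<gamma>s \<longrightarrow> \<gamma>s \<in> E) \<and>
     (\<forall>\<alpha>s\<in>angles_in T A. split_angle T \<alpha>s \<longrightarrow> \<alpha>s \<in> E) \<and>
     (\<forall>\<alpha>s\<in>E. \<forall>f\<in>Mor T A. \<forall>\<beta>s\<in>Ang T. \<forall>\<phi>s.
        Cod T f = Dom T (last \<alpha>s) \<and> Dom T (hd \<beta>s) = Dom T (hd \<alpha>s) \<and>
        last \<beta>s = Comp T (last \<alpha>s) f \<and> seq_morphism T \<phi>s \<beta>s \<alpha>s \<and>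
        hd \<phi>s = Id T (Dom T (hd \<alpha>s)) \<and> last \<phi>s = f \<longrightarrow> \<beta>s \<in> E) \<and>
     (\<forall>\<alpha>s\<in>E. \<forall>g\<in>Mor T A. \<forall>\<gamma>s\<in>Ang T. \<forall>\<phi>s.
        Dom T g = Dom T (hd \<alpha>s) \<and> Dom T (last \<gamma>s) = Dom T (last \<alpha>s) \<and>
        last \<gamma>s = Comp T (Sh T g) (last \<alpha>s) \<and> seq_morphism T \<phi>s \<alpha>s \<gamma>s \<and>
        hd \<phi>s = g \<and> last \<phi>s = Id T (Dom T (last \<alpha>s)) \<longrightarrow> \<gamma>s \<in> E)"

text \<open>The maps \<open>\<alpha>\<^sub>1\<close>, \<open>\<alpha>\<^bsub>n-1\<^esub>\<close> and \<open>\<alpha>\<^sub>n\<close> of the \<open>n\<close>-angles in \<open>E\<close>.\<close>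

definition inflations :: "'m list set \<Rightarrow> 'm set" where
  "inflations E = hd ` E"

definition deflations :: "'m list set \<Rightarrow> 'm set" where
  "deflations E = (\<lambda>\<alpha>s. \<alpha>s ! (length \<alpha>s - 2)) ` E"

definition phantoms :: "'m list set \<Rightarrow> 'm set" where
  "phantoms E = last ` E"

definition projectives :: "('o, 'm, 'z) ncat_scheme \<Rightarrow> 'o set \<Rightarrow> 'm list set \<Rightarrow> 'm set" where
  "projectives T A E = {f \<in> Mor T A. \<forall>p\<in>deflations E. Cod T p = Cod T f \<longrightarrow>
     (\<exists>h\<in>Hom T (Dom T f) (Dom T p). f = Comp T p h)}"

definition injectives :: "('o, 'm, 'z) ncat_scheme \<Rightarrow> 'o set \<Rightarrow> 'm list set \<Rightarrow> 'm set" where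
  "injectives T A E = {g \<in> Mor T A. \<forall>e\<in>inflations E. Dom T e = Dom T g \<longrightarrow>
     (\<exists>h\<in>Hom T (Cod T e) (Cod T g). g = Comp T h e)}"

definition enough_injectives ::
    "('o, 'm, 'z) ncat_scheme \<Rightarrow> 'o set \<Rightarrow> 'm list set \<Rightarrow> bool" where
  "enough_injectives T A E \<longleftrightarrow>
     (\<forall>X\<in>A. \<exists>e\<in>inflations E. Dom T e = X \<and> e \<in> injectives T A E)"

definition enough_projectives ::
    "('o, 'm, 'z) ncat_scheme \<Rightarrow> 'o set \<Rightarrow> 'm list set \<Rightarrow> bool" where
  "enough_projectives T A E \<longleftrightarrow>
     (\<forall>X\<in>A. \<exists>p\<in>deflations E. Cod T p = X \<and> p \<in> projectives T A E)"

section \<open>Ideals, precovers and ideal cotorsion pairs\<close>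

definition ideal_in :: "('o, 'm, 'z) ncat_scheme \<Rightarrow> 'o set \<Rightarrow> 'm set \<Rightarrow> bool" where
  "ideal_in T A I \<longleftrightarrow> I \<subseteq> Mor T A \<and>
     (\<forall>X\<in>A. \<forall>Y\<in>A. subgroup (I \<inter> Hom T X Y) (hom_group T X Y)) \<and>
     (\<forall>f\<in>I. \<forall>g\<in>Mor T A. Dom T g = Cod T f \<longrightarrow> Comp T g f \<in> I) \<and>
     (\<forall>f\<in>I. \<forall>g\<in>Mor T A. Cod T g = Dom T f \<longrightarrow> Comp T f g \<in> I)"

definition precover :: "('o, 'm, 'z) ncat_scheme \<Rightarrow> 'm set \<Rightarrow> 'o \<Rightarrow> 'm \<Rightarrow> bool" where
  "precover T I X i \<longleftrightarrow> i \<in> I \<and> Cod T i = X \<and>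
     (\<forall>f\<in>I. Cod T f = X \<longrightarrow> (\<exists>h\<in>Hom T (Dom T f) (Dom T i). f = Comp T i h))"

definition preenvelope :: "('o, 'm, 'z) ncat_scheme \<Rightarrow> 'm set \<Rightarrow> 'o \<Rightarrow> 'm \<Rightarrow> bool" where
  "preenvelope T J X j \<longleftrightarrow> j \<in> J \<and> Dom T j = X \<and>
     (\<forall>g\<in>J. Dom T g = X \<longrightarrow> (\<exists>h\<in>Hom T (Cod T j) (Cod T g). g = Comp T h j))"

definition precovering :: "('o, 'm, 'z) ncat_scheme \<Rightarrow> 'o set \<Rightarrow> 'm set \<Rightarrow> bool" where
  "precovering T A I \<longleftrightarrow> (\<forall>X\<in>A. \<exists>i. precover T I X i)"

definition preenveloping :: "('o, 'm, 'z) ncat_scheme \<Rightarrow> 'o set \<Rightarrow> 'm set \<Rightarrow> bool" where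
  "preenveloping T A J \<longleftrightarrow> (\<forall>X\<in>A. \<exists>j. preenvelope T J X j)"

definition orthogonal :: "('o, 'm, 'z) ncat_scheme \<Rightarrow> 'm list set \<Rightarrow> 'm \<Rightarrow> 'm \<Rightarrow> bool" where
  "orthogonal T E f g \<longleftrightarrow>
     (\<forall>\<phi>\<in>phantoms E \<inter> Hom T (Cod T f) (ShOb T (Dom T g)).
        Comp T (Comp T (Sh T g) \<phi>) f = Zero T (Dom T f) (ShOb T (Cod T g)))"

definition right_perp ::
    "('o, 'm, 'z) ncat_scheme \<Rightarrow> 'o set \<Rightarrow> 'm list set \<Rightarrow> 'm set \<Rightarrow> 'm set" where
  "right_perp T A E M = {g \<in> Mor T A. \<forall>m\<in>M. orthogonal T E m g}"

definition left_perp ::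
    "('o, 'm, 'z) ncat_scheme \<Rightarrow> 'o set \<Rightarrow> 'm list set \<Rightarrow> 'm set \<Rightarrow> 'm set" where
  "left_perp T A E M = {g \<in> Mor T A. \<forall>m\<in>M. orthogonal T E g m}"

definition ideal_cotorsion_pair ::
    "('o, 'm, 'z) ncat_scheme \<Rightarrow> 'o set \<Rightarrow> 'm list set \<Rightarrow> 'm set \<Rightarrow> 'm set \<Rightarrow> bool" where
  "ideal_cotorsion_pair T A E I J \<longleftrightarrow> ideal_in T A I \<and> ideal_in T A J \<and>
     J = right_perp T A E I \<and> I = left_perp T A E J"

text \<open>
  The \<open>n\<close>-angle corresponding to \<open>i\<close> (ending in \<open>i\<close> followed by the phantom) is not unique up to
  isomorphism for \<open>n > 3\<close>; the definition asks for one with the required factorisation. Any other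
  one whose first object lies in \<open>A\<close> then has such a factorisation too, because by F2 and F3 it
  receives a morphism that is the identity at the last two objects. The same applies to \<open>j\<close>.
\<close>

definition special_precover ::
    "('o, 'm, 'z) ncat_scheme \<Rightarrow> 'o set \<Rightarrow> 'm list set \<Rightarrow> 'm set \<Rightarrow> 'o \<Rightarrow> 'm \<Rightarrow> bool" where
  "special_precover T A E I X i \<longleftrightarrow> i \<in> I \<and> Cod T i = X \<and>
     (\<exists>\<alpha>s\<in>Ang T. \<alpha>s ! (length \<alpha>s - 2) = i \<and>
        (\<exists>j\<in>right_perp T A E I. \<exists>\<phi>\<in>phantoms E.
           Cod T j = Dom T (hd \<alpha>s) \<and> \<phi> \<in> Hom T X (ShOb T (Dom T j)) \<and>
           last \<alpha>s = Comp T (Sh T j) \<phi>))"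

definition special_preenvelope ::
    "('o, 'm, 'z) ncat_scheme \<Rightarrow> 'o set \<Rightarrow> 'm list set \<Rightarrow> 'm set \<Rightarrow> 'o \<Rightarrow> 'm \<Rightarrow> bool" where
  "special_preenvelope T A E J X j \<longleftrightarrow> j \<in> J \<and> Dom T j = X \<and>
     (\<exists>\<alpha>s\<in>Ang T. hd \<alpha>s = j \<and>
        (\<exists>i\<in>left_perp T A E J. \<exists>\<phi>\<in>phantoms E.
           Dom T i = Dom T (last \<alpha>s) \<and> \<phi> \<in> Hom T (Cod T i) (ShOb T X) \<and>
           last \<alpha>s = Comp T \<phi> i))"

definition special_precovering ::
    "('o, 'm, 'z) ncat_scheme \<Rightarrow> 'o set \<Rightarrow> 'm list set \<Rightarrow> 'm set \<Rightarrow> bool" where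
  "special_precovering T A E I \<longleftrightarrow> (\<forall>X\<in>A. \<exists>i. special_precover T A E I X i)"

definition special_preenveloping ::
    "('o, 'm, 'z) ncat_scheme \<Rightarrow> 'o set \<Rightarrow> 'm list set \<Rightarrow> 'm set \<Rightarrow> bool" where
  "special_preenveloping T A E J \<longleftrightarrow> (\<forall>X\<in>A. \<exists>j. special_preenvelope T A E J X j)"

section \<open>Relative phantoms and special injective and projective morphisms\<close>

text \<open>
  \<open>Phi_lower T A E F\<close> is \<open>\<Phi>\<^sub>E(F)\<close> and \<open>Phi_upper T A E F\<close> is \<open>\<Phi>\<^sup>E(F)\<close>; \<open>unshift T M\<close> is the class \<open>\<Sigma>\<^sup>-\<^sup>1 M\<close>,
  taken as a preimage since \<open>Sh T\<close> is a bijection only on \<open>Ar T\<close>.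
\<close>

definition Phi_lower ::
    "('o, 'm, 'z) ncat_scheme \<Rightarrow> 'o set \<Rightarrow> 'm list set \<Rightarrow> 'm list set \<Rightarrow> 'm set" where
  "Phi_lower T A E F = {\<phi> \<in> Mor T A. \<forall>h\<in>phantoms E. Dom T h = Cod T \<phi> \<longrightarrow>
     Comp T h \<phi> \<in> phantoms F}"

definition unshift :: "('o, 'm, 'z) ncat_scheme \<Rightarrow> 'm set \<Rightarrow> 'm set" where
  "unshift T M = {f \<in> Ar T. Sh T f \<in> M}"

definition Phi_upper ::
    "('o, 'm, 'z) ncat_scheme \<Rightarrow> 'o set \<Rightarrow> 'm list set \<Rightarrow> 'm list set \<Rightarrow> 'm set" where
  "Phi_upper T A E F = {\<psi> \<in> Mor T A. \<forall>h\<in>unshift T (phantoms E). Cod T h = Dom T \<psi> \<longrightarrow>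
     Comp T \<psi> h \<in> unshift T (phantoms F)}"

definition special_injectives ::
    "('o, 'm, 'z) ncat_scheme \<Rightarrow> 'o set \<Rightarrow> 'm list set \<Rightarrow> 'm list set \<Rightarrow> 'm set" where
  "special_injectives T A E H = {e \<in> injectives T A H.
     \<exists>\<alpha>s\<in>Ang T. \<exists>\<beta>s\<in>E. \<exists>\<phi>s. hd \<alpha>s = e \<and> Dom T (hd \<beta>s) = Dom T e \<and>
       seq_morphism T \<phi>s \<alpha>s \<beta>s \<and> hd \<phi>s = Id T (Dom T e) \<and> last \<phi>s \<in> Phi_lower T A E H}"

definition special_projectives ::
    "('o, 'm, 'z) ncat_scheme \<Rightarrow> 'o set \<Rightarrow> 'm list set \<Rightarrow> 'm list set \<Rightarrow> 'm set" where
  "special_projectives T A E H = {p \<in> projectives T A H.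
     \<exists>\<beta>s\<in>E. \<exists>\<alpha>s\<in>Ang T. \<exists>\<phi>s. \<alpha>s ! (length \<alpha>s - 2) = p \<and> Dom T (last \<beta>s) = Cod T p \<and>
       seq_morphism T \<phi>s \<beta>s \<alpha>s \<and> hd \<phi>s \<in> Phi_upper T A E H \<and> last \<phi>s = Id T (Cod T p)}"

definition enough_special_injectives ::
    "('o, 'm, 'z) ncat_scheme \<Rightarrow> 'o set \<Rightarrow> 'm list set \<Rightarrow> 'm list set \<Rightarrow> bool" where
  "enough_special_injectives T A E H \<longleftrightarrow>
     (\<forall>X\<in>A. \<exists>e\<in>inflations H. Dom T e = X \<and> e \<in> special_injectives T A E H)"

definition enough_special_projectives ::
    "('o, 'm, 'z) ncat_scheme \<Rightarrow> 'o set \<Rightarrow> 'm list set \<Rightarrow> 'm list set \<Rightarrow> bool" where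
  "enough_special_projectives T A E H \<longleftrightarrow>
     (\<forall>X\<in>A. \<exists>p\<in>deflations H. Cod T p = X \<and> p \<in> special_projectives T A E H)"

definition all_equivalent :: "bool list \<Rightarrow> bool" where
  "all_equivalent Ps \<longleftrightarrow> (\<forall>P\<in>set Ps. \<forall>Q\<in>set Ps. P \<longleftrightarrow> Q)"

end

theory Submission
  imports Defs
begin

text \<open>
  An almost exact structure is the same thing as its class of phantoms, which is a sub-bifunctor of
  \<open>Hom(-, \<Sigma> -)\<close> on \<open>A\<close>. By rotation and F3, a morphism is injective (projective) if and only if it
  kills all phantoms on the left (right), and enough injectives (projectives) means that every object
  receives (emits) a phantom through which all others factor.

  If \<open>\<phi> : C \<rightarrow> \<Sigma> X\<close> is such a universal phantom and \<open>i\<close> is an \<open>I\<close>-precover of \<open>C\<close>, then \<open>\<phi> i\<close> is the last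
  morphism of an \<open>n\<close>-angle that starts with a special \<open>J\<close>-preenvelope of \<open>X\<close>. This and its dual link
  the four approximation properties in a cycle. Next, let the phantoms of \<open>H\<close> be those phantoms of
  \<open>E\<close> that are killed by \<open>J\<close>. Then \<open>\<Phi>\<^sub>E(H) = I\<close> and the \<open>H\<close>-injectives are \<open>J\<close> for any ideal cotorsion
  pair, and special preenvelopes are special \<open>H\<close>-injective inflations. Conversely, let
  \<open>I = \<Phi>\<^sub>E(F)\<close>, let \<open>\<phi> : C \<rightarrow> \<Sigma> K\<close> be universal among the phantoms of \<open>E\<close> from \<open>C\<close> and
  \<open>\<psi> : D \<rightarrow> \<Sigma> K\<close> universal among those of \<open>F\<close> to \<open>\<Sigma> K\<close>. The first component of a weak kernel of
  \<open>(\<phi>, \<psi>) : C \<oplus> D \<rightarrow> \<Sigma> K\<close> is an \<open>I\<close>-precover of \<open>C\<close>.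
\<close>

section \<open>Arithmetic of arrows\<close>

lemma Hom_iff: "f \<in> Hom T X Y \<longleftrightarrow> f \<in> Ar T \<and> Dom T f = X \<and> Cod T f = Y"
  by (simp add: Hom_def)

section \<open>Abelian groups of arrows with bilinear composition\<close>

context additive_category
begin

lemma dom_ob [simp]: "f \<in> Ar T \<Longrightarrow> Dom T f \<in> Ob T"
  and cod_ob [simp]: "f \<in> Ar T \<Longrightarrow> Cod T f \<in> Ob T"
  using dom_cod by auto

lemma ar_hom: "f \<in> Ar T \<Longrightarrow> f \<in> Hom T (Dom T f) (Cod T f)"
  by (simp add: Hom_def)

lemma id_simps [simp]:
  assumes "X \<in> Ob T"
  shows "Id T X \<in> Ar T" "Dom T (Id T X) = X" "Cod T (Id T X) = X"
  using id_hom[OF assms] by (auto simp: Hom_def)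

lemma comp_simps [simp]:
  assumes "f \<in> Ar T" "g \<in> Ar T" "Cod T f = Dom T g"
  shows "g \<cdot> f \<in> Ar T" "Dom T (g \<cdot> f) = Dom T f" "Cod T (g \<cdot> f) = Cod T g"
  using comp_hom[of f "Dom T f" "Dom T g" g "Cod T g"] assms by (auto simp: Hom_def)

lemma comp_assoc_ar [simp]:
  assumes "f \<in> Ar T" "g \<in> Ar T" "h \<in> Ar T" "Cod T f = Dom T g" "Cod T g = Dom T h"
  shows "(h \<cdot> g) \<cdot> f = h \<cdot> (g \<cdot> f)"
  using comp_assoc[of f "Dom T f" "Dom T g" g "Dom T h" h "Cod T h"] assms by (simp add: Hom_def)

lemma id_comp [simp]: "f \<in> Ar T \<Longrightarrow> Cod T f = Y \<Longrightarrow> Id T Y \<cdot> f = f"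
  using id_left by (auto simp: Hom_def)

lemma comp_id [simp]: "f \<in> Ar T \<Longrightarrow> Dom T f = X \<Longrightarrow> f \<cdot> Id T X = f"
  using id_right by (auto simp: Hom_def)

lemma hom_group_simps [simp]:
  "carrier (hom_group T X Y) = Hom T X Y"
  "mult (hom_group T X Y) = Plus T"
  "one (hom_group T X Y) = Zero T X Y"
  by (auto simp: hom_group_def)

lemma zero_simps [simp]:
  assumes "X \<in> Ob T" "Y \<in> Ob T"
  shows "Zero T X Y \<in> Ar T" "Dom T (Zero T X Y) = X" "Cod T (Zero T X Y) = Y"
proof -
  interpret comm_group "hom_group T X Y" using hom_comm_group assms by blast
  show "Zero T X Y \<in> Ar T" "Dom T (Zero T X Y) = X" "Cod T (Zero T X Y) = Y"
    using one_closed by (auto simp: Hom_def)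
qed

lemma plus_simps [simp]:
  assumes "f \<in> Ar T" "g \<in> Ar T" "Dom T f = Dom T g" "Cod T f = Cod T g"
  shows "f \<oplus> g \<in> Ar T" "Dom T (f \<oplus> g) = Dom T g" "Cod T (f \<oplus> g) = Cod T g"
proof -
  interpret comm_group "hom_group T (Dom T g) (Cod T g)"
    using hom_comm_group assms by simp
  show "f \<oplus> g \<in> Ar T" "Dom T (f \<oplus> g) = Dom T g" "Cod T (f \<oplus> g) = Cod T g"
    using m_closed[of f g] assms by (auto simp: Hom_def)
qed

lemma neg_simps [simp]:
  assumes "f \<in> Ar T"
  shows "Neg T f \<in> Ar T" "Dom T (Neg T f) = Dom T f" "Cod T (Neg T f) = Cod T f"
proof -
  interpret comm_group "hom_group T (Dom T f) (Cod T f)"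
    using hom_comm_group assms by simp
  show "Neg T f \<in> Ar T" "Dom T (Neg T f) = Dom T f" "Cod T (Neg T f) = Cod T f"
    using inv_closed[of f] assms by (auto simp: Hom_def Neg_def)
qed

lemma plus_zero [simp]:
  assumes "f \<in> Ar T" "X = Dom T f" "Y = Cod T f"
  shows "f \<oplus> Zero T X Y = f" "Zero T X Y \<oplus> f = f"
proof -
  interpret comm_group "hom_group T (Dom T f) (Cod T f)"
    using hom_comm_group assms by simp
  show "f \<oplus> Zero T X Y = f" "Zero T X Y \<oplus> f = f"
    using r_one[of f] l_one[of f] assms by (auto simp: Hom_def)
qed

lemma plus_neg [simp]:
  assumes "f \<in> Ar T"
  shows "f \<oplus> Neg T f = Zero T (Dom T f) (Cod T f)" "Neg T f \<oplus> f = Zero T (Dom T f) (Cod T f)"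
proof -
  interpret comm_group "hom_group T (Dom T f) (Cod T f)"
    using hom_comm_group assms by simp
  show "f \<oplus> Neg T f = Zero T (Dom T f) (Cod T f)" "Neg T f \<oplus> f = Zero T (Dom T f) (Cod T f)"
    using r_inv[of f] l_inv[of f] assms by (auto simp: Hom_def Neg_def)
qed

lemma neg_unique:
  assumes "f \<in> Ar T" "g \<in> Ar T" "Dom T f = Dom T g" "Cod T f = Cod T g"
    and "f \<oplus> g = Zero T (Dom T g) (Cod T g)"
  shows "f = Neg T g"
proof -
  interpret comm_group "hom_group T (Dom T g) (Cod T g)"
    using hom_comm_group assms by simp
  show ?thesis
    using inv_equality[of f g] assms by (auto simp: Hom_def Neg_def)
qed

text \<open>Cancellation in the Hom group. It turns additivity into preservation of zero, for
  composition on either side and for \<open>Sh T\<close>.\<close>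

lemma plus_self_zero:
  assumes "f \<in> Ar T" "f \<oplus> f = f"
  shows "f = Zero T (Dom T f) (Cod T f)"
proof -
  interpret comm_group "hom_group T (Dom T f) (Cod T f)"
    using hom_comm_group assms by simp
  show ?thesis
    using l_cancel_one[of f f] assms by (auto simp: Hom_def)
qed

lemma comp_plus [simp]:
  assumes "f \<in> Ar T" "g \<in> Ar T" "h \<in> Ar T" "Dom T f = Dom T g" "Cod T f = Dom T h" "Cod T g = Dom T h"
  shows "h \<cdot> (f \<oplus> g) = h \<cdot> f \<oplus> h \<cdot> g"
  using comp_plus_right[of f "Dom T g" "Dom T h" g h "Cod T h"] assms by (simp add: Hom_def)

lemma plus_comp [simp]:
  assumes "f \<in> Ar T" "g \<in> Ar T" "h \<in> Ar T" "Dom T g = Cod T f" "Dom T h = Cod T f" "Cod T g = Cod T h"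
  shows "(g \<oplus> h) \<cdot> f = g \<cdot> f \<oplus> h \<cdot> f"
  using comp_plus_left[of f "Dom T f" "Cod T f" g "Cod T h" h] assms by (simp add: Hom_def)

lemma comp_zero [simp]:
  assumes "f \<in> Ar T" "Dom T f = Y" "X \<in> Ob T"
  shows "f \<cdot> Zero T X Y = Zero T X (Cod T f)"
proof -
  have "f \<cdot> Zero T X Y \<oplus> f \<cdot> Zero T X Y = f \<cdot> (Zero T X Y \<oplus> Zero T X Y)"
    using assms by (subst comp_plus) auto
  then have "f \<cdot> Zero T X Y \<oplus> f \<cdot> Zero T X Y = f \<cdot> Zero T X Y"
    using assms by auto
  then show ?thesis
    using plus_self_zero[of "f \<cdot> Zero T X Y"] assms by auto
qed

lemma zero_comp [simp]:
  assumes "f \<in> Ar T" "Cod T f = Y" "Z \<in> Ob T"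
  shows "Zero T Y Z \<cdot> f = Zero T (Dom T f) Z"
proof -
  have "Zero T Y Z \<cdot> f \<oplus> Zero T Y Z \<cdot> f = (Zero T Y Z \<oplus> Zero T Y Z) \<cdot> f"
    using assms by (subst plus_comp) auto
  then have "Zero T Y Z \<cdot> f \<oplus> Zero T Y Z \<cdot> f = Zero T Y Z \<cdot> f"
    using assms by auto
  then show ?thesis
    using plus_self_zero[of "Zero T Y Z \<cdot> f"] assms by auto
qed

lemma neg_zero [simp]: "X \<in> Ob T \<Longrightarrow> Y \<in> Ob T \<Longrightarrow> Neg T (Zero T X Y) = Zero T X Y"
  using neg_unique[of "Zero T X Y" "Zero T X Y"] by simp

lemma neg_neg [simp]: "f \<in> Ar T \<Longrightarrow> Neg T (Neg T f) = f"
  using neg_unique[of f "Neg T f"] by simp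

lemma comp_neg [simp]:
  assumes "f \<in> Ar T" "g \<in> Ar T" "Cod T f = Dom T g"
  shows "g \<cdot> Neg T f = Neg T (g \<cdot> f)"
proof -
  have "g \<cdot> Neg T f \<oplus> g \<cdot> f = g \<cdot> (Neg T f \<oplus> f)"
    using assms by (simp del: plus_neg)
  then show ?thesis
    using assms by (intro neg_unique) auto
qed

lemma neg_comp [simp]:
  assumes "f \<in> Ar T" "g \<in> Ar T" "Cod T f = Dom T g"
  shows "Neg T g \<cdot> f = Neg T (g \<cdot> f)"
proof -
  have "Neg T g \<cdot> f \<oplus> g \<cdot> f = (Neg T g \<oplus> g) \<cdot> f"
    using assms by (simp del: plus_neg)
  then show ?thesis
    using assms by (intro neg_unique) auto
qed

lemma zero_object_hom_eq:
  assumes "zero_object T Z" "f \<in> Ar T" "g \<in> Ar T" "Dom T f = Dom T g" "Cod T f = Cod T g"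
    and "Dom T f = Z \<or> Cod T f = Z"
  shows "f = g"
  using assms(6)
proof
  assume "Dom T f = Z"
  moreover have "\<exists>!h. h \<in> Hom T Z (Cod T f)" using assms(1,2) by (simp add: zero_object_def)
  ultimately show ?thesis using assms by (auto simp: Hom_iff)
next
  assume "Cod T f = Z"
  moreover have "\<exists>!h. h \<in> Hom T (Dom T f) Z" using assms(1,2) by (simp add: zero_object_def)
  ultimately show ?thesis using assms by (auto simp: Hom_iff)
qed

end

section \<open>The automorphism as an additive functor, and desuspension\<close>

context additive_category_with_automorphism
begin

lemma sh_simps [simp]:
  assumes "f \<in> Ar T"
  shows "Sh T f \<in> Ar T" "Dom T (Sh T f) = ShOb T (Dom T f)" "Cod T (Sh T f) = ShOb T (Cod T f)"
  using sh_hom[OF ar_hom[OF assms]] by (auto simp: Hom_def)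

lemma shob_ob [simp]: "X \<in> Ob T \<Longrightarrow> ShOb T X \<in> Ob T"
  using sh_ob_bij by (auto simp: bij_betw_def)

lemma shob_eq [simp]: "X \<in> Ob T \<Longrightarrow> Y \<in> Ob T \<Longrightarrow> ShOb T X = ShOb T Y \<longleftrightarrow> X = Y"
  using sh_ob_bij by (auto simp: bij_betw_def inj_on_def)

lemma sh_eq [simp]: "f \<in> Ar T \<Longrightarrow> g \<in> Ar T \<Longrightarrow> Sh T f = Sh T g \<longleftrightarrow> f = g"
  using sh_bij by (auto simp: bij_betw_def inj_on_def)

text \<open>Desuspension: \<open>Sh T\<close> is a bijection only on \<open>Ar T\<close>, so
  preimages are obtained one at a time instead of by an inverse function.\<close>

lemma ex_unshift:
  assumes "f \<in> Ar T" obtains g where "g \<in> Ar T" "Sh T g = f"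
  using assms sh_bij by (metis bij_betw_def imageE)

lemma sh_comp_ar [simp]:
  "f \<in> Ar T \<Longrightarrow> g \<in> Ar T \<Longrightarrow> Cod T f = Dom T g \<Longrightarrow> Sh T (g \<cdot> f) = Sh T g \<cdot> Sh T f"
  using sh_comp[of f "Dom T f" "Dom T g" g "Cod T g"] by (auto simp: Hom_def)

lemma sh_plus_ar [simp]:
  "f \<in> Ar T \<Longrightarrow> g \<in> Ar T \<Longrightarrow> Dom T f = Dom T g \<Longrightarrow> Cod T f = Cod T g \<Longrightarrow>
    Sh T (f \<oplus> g) = Sh T f \<oplus> Sh T g"
  using sh_plus[of f "Dom T f" "Cod T f" g] by (auto simp: Hom_def)

lemmas sh_id_ob [simp] = sh_id

lemma sh_zero [simp]:
  assumes "X \<in> Ob T" "Y \<in> Ob T"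
  shows "Sh T (Zero T X Y) = Zero T (ShOb T X) (ShOb T Y)"
  using plus_self_zero[of "Sh T (Zero T X Y)"] sh_plus_ar[of "Zero T X Y" "Zero T X Y"] assms by simp

lemma sh_neg [simp]:
  assumes "f \<in> Ar T"
  shows "Sh T (Neg T f) = Neg T (Sh T f)"
proof -
  have "Sh T (Neg T f) \<oplus> Sh T f = Sh T (Neg T f \<oplus> f)"
    using assms by (simp del: plus_neg)
  then show ?thesis
    using assms by (intro neg_unique) auto
qed

text \<open>Each defining equation of a biproduct is built from composition, sum, zero and identity,
  all of which \<Sigma> preserves. Needed wherever a biproduct of first objects continues as one of
  their shifts.\<close>

lemma sh_biproduct:
  assumes "biproduct T X Y W i\<^sub>1 i\<^sub>2 p\<^sub>1 p\<^sub>2"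
  shows "biproduct T (ShOb T X) (ShOb T Y) (ShOb T W) (Sh T i\<^sub>1) (Sh T i\<^sub>2) (Sh T p\<^sub>1) (Sh T p\<^sub>2)"
proof -
  note b = assms[unfolded biproduct_def Hom_iff]
  have ob: "X \<in> Ob T" "Y \<in> Ob T" "W \<in> Ob T" using b by auto
  have c: "Sh T (p\<^sub>1 \<cdot> i\<^sub>1) = Sh T p\<^sub>1 \<cdot> Sh T i\<^sub>1" "Sh T (p\<^sub>2 \<cdot> i\<^sub>2) = Sh T p\<^sub>2 \<cdot> Sh T i\<^sub>2"
    "Sh T (p\<^sub>1 \<cdot> i\<^sub>2) = Sh T p\<^sub>1 \<cdot> Sh T i\<^sub>2" "Sh T (p\<^sub>2 \<cdot> i\<^sub>1) = Sh T p\<^sub>2 \<cdot> Sh T i\<^sub>1"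
    by - ((rule sh_comp_ar; use b in simp)+)
  have "Sh T (i\<^sub>1 \<cdot> p\<^sub>1 \<oplus> i\<^sub>2 \<cdot> p\<^sub>2) = Sh T i\<^sub>1 \<cdot> Sh T p\<^sub>1 \<oplus> Sh T i\<^sub>2 \<cdot> Sh T p\<^sub>2"
    by (subst sh_plus_ar) (use b in simp_all)
  with c show ?thesis
    using b ob by (simp add: biproduct_def Hom_iff)
qed

end

section \<open>Rotation and exactness of $n$-angles\<close>

text \<open>The sign (-1)^n of F2 as a single operation. It is its own inverse and commutes with
  composition and \<open>Sh T\<close>, so later proofs need no case split on the parity of
  n.\<close>

definition parity_sign :: "('o, 'm, 'z) ncat_scheme \<Rightarrow> nat \<Rightarrow> 'm \<Rightarrow> 'm" where
  "parity_sign T n f = (if even n then f else Neg T f)"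

context additive_category_with_automorphism
begin

lemma parity_sign_simps [simp]:
  assumes "f \<in> Ar T"
  shows "parity_sign T n f \<in> Ar T" "Dom T (parity_sign T n f) = Dom T f"
    "Cod T (parity_sign T n f) = Cod T f" "parity_sign T n (parity_sign T n f) = f"
    "Sh T (parity_sign T n f) = parity_sign T n (Sh T f)"
  using assms by (auto simp: parity_sign_def)

lemma parity_sign_comp [simp]:
  assumes "f \<in> Ar T" "g \<in> Ar T" "Cod T f = Dom T g"
  shows "parity_sign T n g \<cdot> f = parity_sign T n (g \<cdot> f)" "g \<cdot> parity_sign T n f = parity_sign T n (g \<cdot> f)"
  using assms by (auto simp: parity_sign_def)

lemma parity_sign_zero [simp]:
  "X \<in> Ob T \<Longrightarrow> Y \<in> Ob T \<Longrightarrow> parity_sign T n (Zero T X Y) = Zero T X Y"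
  by (auto simp: parity_sign_def)

lemma parity_sign_eq_iff:
  assumes "f \<in> Ar T" "g \<in> Ar T"
  shows "parity_sign T n f = parity_sign T n g \<longleftrightarrow> f = g"
  using assms by (metis parity_sign_simps(4))

lemma parity_sign_eq_zero_iff [simp]:
  assumes "f \<in> Ar T" "X \<in> Ob T" "Y \<in> Ob T"
  shows "parity_sign T n f = Zero T X Y \<longleftrightarrow> f = Zero T X Y"
  using parity_sign_eq_iff[of f "Zero T X Y" n] assms by simp

end

section \<open>Rotation, and morphisms of angles with prescribed end components\<close>

context n_angulated_category
begin

text \<open>Removes \<open>ext\<close> from the description of an angle: the wrap-around at the last
  position becomes a separate clause about the shifted first object.\<close>

lemma angle_simps:
  assumes "\<alpha>s \<in> Ang T"
  shows angle_length: "length \<alpha>s = n" and angle_nonempty: "\<alpha>s \<noteq> []"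
    and angle_hd: "hd \<alpha>s = \<alpha>s ! 0" and angle_last: "last \<alpha>s = \<alpha>s ! (n - 1)"
    and angle_ar: "\<And>k. k < n \<Longrightarrow> \<alpha>s ! k \<in> Ar T"
    and angle_cod: "\<And>k. Suc k < n \<Longrightarrow> Cod T (\<alpha>s ! k) = Dom T (\<alpha>s ! Suc k)"
    and angle_cod_last: "Cod T (\<alpha>s ! (n - 1)) = ShOb T (Dom T (\<alpha>s ! 0))"
proof -
  note s = ang_seq[OF assms, unfolded sigma_seq_def]
  show l: "length \<alpha>s = n" using s by simp
  then show ne: "\<alpha>s \<noteq> []" using n_ge_3 by auto
  show h: "hd \<alpha>s = \<alpha>s ! 0" "last \<alpha>s = \<alpha>s ! (n - 1)"
    using ne l by (auto simp: hd_conv_nth last_conv_nth)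
  show ar: "\<alpha>s ! k \<in> Ar T" if "k < n" for k using s that l by (metis nth_mem subsetD)
  show "Cod T (\<alpha>s ! k) = Dom T (\<alpha>s ! Suc k)" if "Suc k < n" for k
    using s that l by (auto simp: ext_def nth_append)
  have "Cod T (\<alpha>s ! (n - 1)) = Dom T (ext T \<alpha>s ! Suc (n - 1))" using s n_ge_3 by auto
  also have "ext T \<alpha>s ! Suc (n - 1) = Sh T (\<alpha>s ! 0)"
    using l h n_ge_3 by (simp add: ext_def nth_append)
  finally show "Cod T (\<alpha>s ! (n - 1)) = ShOb T (Dom T (\<alpha>s ! 0))"
    using ar[of 0] n_ge_3 by simp
qed

lemma angle_ends:
  assumes "\<alpha>s \<in> Ang T"
  shows "hd \<alpha>s \<in> Ar T" "last \<alpha>s \<in> Ar T" "\<alpha>s ! (n - 2) \<in> Ar T"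
    "Cod T (last \<alpha>s) = ShOb T (Dom T (hd \<alpha>s))" "Cod T (\<alpha>s ! (n - 2)) = Dom T (last \<alpha>s)"
proof -
  note a = angle_simps[OF assms]
  show "hd \<alpha>s \<in> Ar T" "last \<alpha>s \<in> Ar T" "\<alpha>s ! (n - 2) \<in> Ar T"
    "Cod T (last \<alpha>s) = ShOb T (Dom T (hd \<alpha>s))" using a n_ge_3 by auto
  have "Suc (n - 2) = n - 1" using n_ge_3 by simp
  then show "Cod T (\<alpha>s ! (n - 2)) = Dom T (last \<alpha>s)" using a(4) a(6)[of "n - 2"] n_ge_3 by simp
qed

lemma rotate_left_parity:
  "length \<alpha>s = n \<Longrightarrow> rotate_left T \<alpha>s = tl \<alpha>s @ [parity_sign T n (Sh T (hd \<alpha>s))]"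
  by (simp add: rotate_left_def parity_sign_def)

lemma rotate_left_angle:
  assumes "\<alpha>s \<in> Ang T"
  shows "tl \<alpha>s @ [parity_sign T n (Sh T (hd \<alpha>s))] \<in> Ang T"
  using F2[OF ang_seq[OF assms]] assms rotate_left_parity angle_length by auto

text \<open>F2 only names left rotations, so the candidate for the right rotation is written down
  and its left rotation computed. The new first arrow desuspends the last arrow with the sign
  already included.\<close>

lemma rotate_right_angle:
  assumes "\<alpha>s \<in> Ang T"
  obtains c where "c \<in> Ar T" "Sh T c = parity_sign T n (last \<alpha>s)" "c # butlast \<alpha>s \<in> Ang T"
proof -
  note a = angle_simps[OF assms] and e = angle_ends[OF assms]
  obtain c where c: "c \<in> Ar T" "Sh T c = parity_sign T n (last \<alpha>s)"
    using e by (metis ex_unshift parity_sign_simps(1))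
  have "ShOb T (Cod T c) = ShOb T (Dom T (hd \<alpha>s))"
    using sh_simps(3)[OF c(1)] c(2) e by simp
  then have cod_c: "Cod T c = Dom T (hd \<alpha>s)" using c e by simp
  have nth: "(c # butlast \<alpha>s) ! Suc k = \<alpha>s ! k" if "Suc k < n" for k
    using that a(1) by (simp add: nth_butlast)
  have len: "length (c # butlast \<alpha>s) = n" using a(1) n_ge_3 by simp
  have "sigma_seq n T (c # butlast \<alpha>s)"
    unfolding sigma_seq_def
  proof (intro conjI allI impI)
    show "length (c # butlast \<alpha>s) = n" by (rule len)
    show "set (c # butlast \<alpha>s) \<subseteq> Ar T"
      using c(1) ang_seq[OF assms] by (auto simp: sigma_seq_def dest: in_set_butlastD)
    fix k assume k: "k < n"
    show "Cod T ((c # butlast \<alpha>s) ! k) = Dom T (ext T (c # butlast \<alpha>s) ! Suc k)"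
    proof (cases "Suc k < n")
      case True
      then have "ext T (c # butlast \<alpha>s) ! Suc k = \<alpha>s ! k"
        using nth len by (simp add: ext_def nth_append nth_butlast)
      then show ?thesis using cod_c a True nth by (cases k) auto
    next
      case False
      with k have k': "Suc k = n" by simp
      then have "ext T (c # butlast \<alpha>s) ! Suc k = Sh T c"
        using nth_append_length[of "c # butlast \<alpha>s" "Sh T c" "[]"] unfolding k' len ext_def by simp
      moreover have "(c # butlast \<alpha>s) ! k = \<alpha>s ! (n - 2)"
        using nth[of "k - 1"] k' n_ge_3 by (cases k) auto
      ultimately show ?thesis using c e by simp
    qed
  qed
  \<comment> \<open>Rotating back applies the sign a second time, and twice the sign is the
    identity.\<close>
  moreover have "rotate_left T (c # butlast \<alpha>s) = \<alpha>s"
    using rotate_left_parity[OF len] c e(2) a(2) by simp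
  ultimately have "c # butlast \<alpha>s \<in> Ang T" using F2 assms by metis
  with c that show ?thesis by blast
qed

text \<open>Separates the inner squares from the last one, where the component following the last is
  the shift of the first.\<close>

lemma seq_morphismD:
  assumes "seq_morphism T \<phi>s \<alpha>s \<beta>s" "\<alpha>s \<in> Ang T" "\<beta>s \<in> Ang T"
  shows "length \<phi>s = n" "hd \<phi>s = \<phi>s ! 0" "last \<phi>s = \<phi>s ! (n - 1)"
    "\<And>k. k < n \<Longrightarrow> \<phi>s ! k \<in> Hom T (Dom T (\<alpha>s ! k)) (Dom T (\<beta>s ! k))"
    "\<And>k. Suc k < n \<Longrightarrow> \<phi>s ! Suc k \<cdot> \<alpha>s ! k = \<beta>s ! k \<cdot> \<phi>s ! k"
    "Sh T (hd \<phi>s) \<cdot> last \<alpha>s = last \<beta>s \<cdot> last \<phi>s"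
proof -
  note m = assms(1)[unfolded seq_morphism_def angle_length[OF assms(2)]]
  show l: "length \<phi>s = n" using m by simp
  then have "\<phi>s \<noteq> []" using n_ge_3 by auto
  then show h: "hd \<phi>s = \<phi>s ! 0" "last \<phi>s = \<phi>s ! (n - 1)"
    using l by (auto simp: hd_conv_nth last_conv_nth)
  show "\<And>k. k < n \<Longrightarrow> \<phi>s ! k \<in> Hom T (Dom T (\<alpha>s ! k)) (Dom T (\<beta>s ! k))" using m by simp
  show "\<phi>s ! Suc k \<cdot> \<alpha>s ! k = \<beta>s ! k \<cdot> \<phi>s ! k" if "Suc k < n" for k
  proof -
    have "ext T \<phi>s ! Suc k \<cdot> \<alpha>s ! k = \<beta>s ! k \<cdot> \<phi>s ! k" using m that Suc_lessD by blast
    then show ?thesis using that l by (simp add: ext_def nth_append)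
  qed
  have "ext T \<phi>s ! Suc (n - 1) \<cdot> \<alpha>s ! (n - 1) = \<beta>s ! (n - 1) \<cdot> \<phi>s ! (n - 1)"
  proof -
    have "\<And>k. k < n \<Longrightarrow> ext T \<phi>s ! Suc k \<cdot> \<alpha>s ! k = \<beta>s ! k \<cdot> \<phi>s ! k" using m by blast
    from this[of "n - 1"] show ?thesis using n_ge_3 by linarith
  qed
  then show "Sh T (hd \<phi>s) \<cdot> last \<alpha>s = last \<beta>s \<cdot> last \<phi>s"
    using l h n_ge_3 assms by (simp add: ext_def nth_append angle_last)
qed

text \<open>Rotating once to the right turns the outer components into the first two of F3.\<close>

lemma F3_ends:
  assumes \<alpha>: "\<alpha>s \<in> Ang T" and \<beta>: "\<beta>s \<in> Ang T"
    and u: "u \<in> Hom T (Dom T (hd \<alpha>s)) (Dom T (hd \<beta>s))"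
    and v: "v \<in> Hom T (Dom T (last \<alpha>s)) (Dom T (last \<beta>s))"
    and comm: "Sh T u \<cdot> last \<alpha>s = last \<beta>s \<cdot> v"
  obtains \<phi>s where "seq_morphism T \<phi>s \<alpha>s \<beta>s" "hd \<phi>s = u" "last \<phi>s = v"
proof -
  note a = angle_simps[OF \<alpha>] and e = angle_ends[OF \<alpha>]
  note b = angle_simps[OF \<beta>] and f = angle_ends[OF \<beta>]
  note u' = u[unfolded Hom_iff] and v' = v[unfolded Hom_iff]
  obtain c where c: "c \<in> Ar T" "Sh T c = parity_sign T n (last \<alpha>s)" "c # butlast \<alpha>s \<in> Ang T"
    by (rule rotate_right_angle[OF \<alpha>])
  obtain d where d: "d \<in> Ar T" "Sh T d = parity_sign T n (last \<beta>s)" "d # butlast \<beta>s \<in> Ang T"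
    by (rule rotate_right_angle[OF \<beta>])
  note A = angle_simps[OF c(3)] and B = angle_simps[OF d(3)]
  obtain w where w: "w \<in> Ar T" "Sh T w = v" using v' ex_unshift by blast
  have nth: "(c # butlast \<alpha>s) ! Suc k = \<alpha>s ! k" "(d # butlast \<beta>s) ! Suc k = \<beta>s ! k"
    if "Suc k < n" for k using that a(1) b(1) by (simp_all add: nth_butlast)
  have "ShOb T (Dom T w) = ShOb T (Dom T c)" "ShOb T (Cod T w) = ShOb T (Dom T d)"
    using sh_simps[OF w(1)] sh_simps[OF c(1)] sh_simps[OF d(1)] w c d v' e f by auto
  then have wh: "Dom T w = Dom T c" "Cod T w = Dom T d" using w c d by auto
  have cod: "Cod T c = Dom T (hd \<alpha>s)" "Cod T d = Dom T (hd \<beta>s)"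
    using A(6)[of 0] B(6)[of 0] nth[of 0] n_ge_3 a(3) b(3) by auto
  \<comment> \<open>After the right rotation the outer square \<open>comm\<close> becomes the first
    square. The signs on \<open>c\<close> and \<open>d\<close> agree, and injectivity of
    \<open>Sh T\<close> on arrows removes \<Sigma>.\<close>
  have "Sh T (u \<cdot> c) = Sh T (d \<cdot> w)"
    using u' c d w wh cod e f comm v' by simp
  then have uc: "u \<cdot> c = d \<cdot> w" using u' c(1) d(1) w wh cod by (simp del: sh_comp_ar)
  obtain \<psi>s where \<psi>: "seq_morphism T \<psi>s (c # butlast \<alpha>s) (d # butlast \<beta>s)" "\<psi>s ! 0 = w" "\<psi>s ! 1 = u"
  proof (rule F3[OF c(3) d(3), of w u, THEN exE])
    show "w \<in> Hom T (Dom T ((c # butlast \<alpha>s) ! 0)) (Dom T ((d # butlast \<beta>s) ! 0))"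
      using w wh by (simp add: Hom_iff)
    show "u \<in> Hom T (Dom T ((c # butlast \<alpha>s) ! 1)) (Dom T ((d # butlast \<beta>s) ! 1))"
      using nth[of 0] u n_ge_3 a(3) b(3) by simp
    show "u \<cdot> (c # butlast \<alpha>s) ! 0 = (d # butlast \<beta>s) ! 0 \<cdot> w" using uc by simp
  qed blast
  note p = seq_morphismD[OF \<psi>(1) c(3) d(3)]
  \<comment> \<open>Undoes the rotation on components: \<open>w\<close> is dropped at the front and
    reappears at the end as its shift \<open>v\<close>.\<close>
  define \<phi>s where "\<phi>s = tl \<psi>s @ [v]"
  have len: "length \<phi>s = n" using p(1) n_ge_3 by (simp add: \<phi>s_def)
  have \<phi>_nth: "\<phi>s ! k = \<psi>s ! Suc k" if "Suc k < n" for k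
    using that p(1) by (auto simp: \<phi>s_def nth_append nth_tl)
  have \<phi>_last: "\<phi>s ! (n - 1) = v" using p(1) by (simp add: \<phi>s_def nth_append)
  have hd: "hd \<phi>s = u" using \<phi>_nth[of 0] \<psi> n_ge_3 len by (cases \<phi>s) auto
  have "seq_morphism T \<phi>s \<alpha>s \<beta>s"
    unfolding seq_morphism_def a(1) b(1)
  proof (intro conjI allI impI)
    fix k assume k: "k < n"
    have "k = n - 1 \<or> Suc k < n" using k by auto
    then show "\<phi>s ! k \<in> Hom T (Dom T (\<alpha>s ! k)) (Dom T (\<beta>s ! k))"
    proof
      assume "Suc k < n"
      then show ?thesis using \<phi>_nth p(4)[of "Suc k"] nth[of k] by simp
    next
      assume "k = n - 1"
      then show ?thesis using \<phi>_last v a(4) b(4) by simp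
    qed
    consider "k = n - 1" | "Suc k = n - 1" | "Suc (Suc k) < n" using k by linarith
    then show "ext T \<phi>s ! Suc k \<cdot> \<alpha>s ! k = \<beta>s ! k \<cdot> \<phi>s ! k"
    proof cases
      case 1
      then show ?thesis using comm \<phi>_last hd len a(4) b(4) n_ge_3 by (simp add: ext_def nth_append)
    next
      \<comment> \<open>The square at position n - 2 is the last square of the rotated angles, where
        the component following the last is \<open>Sh T w\<close>, that is \<open>v\<close>.\<close>
      case 2
      then have "ext T \<psi>s ! Suc (Suc k) = v"
        using p(1,2) \<psi>(2) w n_ge_3 by (simp add: ext_def nth_append)
      moreover have "ext T \<psi>s ! Suc (Suc k) \<cdot> (c # butlast \<alpha>s) ! Suc k = (d # butlast \<beta>s) ! Suc k \<cdot> \<psi>s ! Suc k"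
        using \<psi>(1) 2 A(1) n_ge_3 unfolding seq_morphism_def by auto
      moreover have "ext T \<phi>s ! Suc k = v" "\<phi>s ! k = \<psi>s ! Suc k"
        using \<phi>_last \<phi>_nth[of k] 2 len n_ge_3 by (auto simp add: ext_def nth_append)
      ultimately show ?thesis using nth[of k] 2 n_ge_3 by simp
    next
      case 3
      then show ?thesis using p(5)[of "Suc k"] \<phi>_nth[of k] \<phi>_nth[of "Suc k"] nth[of k] len
        by (simp add: ext_def nth_append)
    qed
  qed (use len in auto)
  moreover have "last \<phi>s = v" by (simp add: \<phi>s_def)
  ultimately show ?thesis using that hd by blast
qed

section \<open>Trivial angles and the exactness of angles\<close>

lemma trivial_angle:
  assumes "Y \<in> Ob T"
  obtains \<tau>s Z where "\<tau>s \<in> Ang T" "hd \<tau>s = Id T Y" "zero_object T Z" "\<And>k. 2 \<le> k \<Longrightarrow> k < n \<Longrightarrow> Dom T (\<tau>s ! k) = Z"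
proof -
  obtain Z where Z: "zero_object T Z" using ex_zero_object by blast
  then have ZO: "Z \<in> Ob T" by (simp add: zero_object_def)
  \<comment> \<open>The objects at positions 0 to n. Position n holds the shift of the first object,
    as the codomain of the last arrow; one and the same zero object fills positions 2 to n -
    1.\<close>
  define D where "D k = (if k < 2 then Y else if k < n then Z else ShOb T Y)" for k
  define \<tau> where "\<tau> k = (if k = 0 then Id T Y else Zero T (D k) (D (Suc k)))" for k
  define \<tau>s where "\<tau>s = map \<tau> [0..<n]"
  have DO: "D k \<in> Ob T" for k using ZO assms by (simp add: D_def)
  have \<tau>: "\<tau> k \<in> Ar T" "Dom T (\<tau> k) = D k" "Cod T (\<tau> k) = D (Suc k)" for k
    using DO assms by (auto simp: \<tau>_def) (auto simp: D_def)
  have nth: "\<tau>s ! k = \<tau> k" if "k < n" for k using that by (simp add: \<tau>s_def)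
  have hd: "hd \<tau>s = Id T Y" using n_ge_3 by (simp add: \<tau>s_def hd_map \<tau>_def upt_conv_Cons)
  have len: "length \<tau>s = n" by (simp add: \<tau>s_def)
  have "sigma_seq n T \<tau>s"
    unfolding sigma_seq_def
  proof (intro conjI allI impI)
    show "length \<tau>s = n" by (rule len)
    show "set \<tau>s \<subseteq> Ar T" using \<tau> by (auto simp: \<tau>s_def)
    fix k assume "k < n"
    then show "Cod T (\<tau>s ! k) = Dom T (ext T \<tau>s ! Suc k)"
      using nth len \<tau> hd assms n_ge_3 by (cases "Suc k < n") (auto simp: ext_def nth_append D_def)
  qed
  moreover have D: "Dom T (\<tau>s ! k) = Z" if "2 \<le> k" "k < n" for k
    using that nth \<tau> by (simp add: D_def)
  ultimately have "\<tau>s \<in> Ang T" using F1_trivial[OF assms] hd Z by simp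
  with hd Z D that show ?thesis by blast
qed

text \<open>The identity and the first arrow start a morphism from the trivial angle on the first
  object. Its next square passes through the zero object at position 2.\<close>

lemma angle_comp_zero:
  assumes "\<alpha>s \<in> Ang T"
  shows "\<alpha>s ! 1 \<cdot> \<alpha>s ! 0 = Zero T (Dom T (\<alpha>s ! 0)) (Cod T (\<alpha>s ! 1))"
proof -
  note a = angle_simps[OF assms]
  have X: "Dom T (\<alpha>s ! 0) \<in> Ob T" using a n_ge_3 by simp
  obtain \<tau>s Z where t: "\<tau>s \<in> Ang T" "hd \<tau>s = Id T (Dom T (\<alpha>s ! 0))" "zero_object T Z"
      "\<And>k. 2 \<le> k \<Longrightarrow> k < n \<Longrightarrow> Dom T (\<tau>s ! k) = Z"
    by (rule trivial_angle[OF X]) blast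
  note t' = angle_simps[OF t(1)]
  have d1: "Dom T (\<tau>s ! 1) = Dom T (\<alpha>s ! 0)"
  proof -
    have "Cod T (hd \<tau>s) = Dom T (\<alpha>s ! 0)" using t(2) X by simp
    then show ?thesis using t'(6)[of 0] t'(3) n_ge_3 by simp
  qed
  obtain \<phi>s where \<phi>: "seq_morphism T \<phi>s \<tau>s \<alpha>s" "\<phi>s ! 0 = Id T (Dom T (\<alpha>s ! 0))" "\<phi>s ! 1 = \<alpha>s ! 0"
  proof (rule F3[OF t(1) assms, THEN exE])
    show "Id T (Dom T (\<alpha>s ! 0)) \<in> Hom T (Dom T (\<tau>s ! 0)) (Dom T (\<alpha>s ! 0))"
      using t t' X by (simp add: Hom_iff)
    show "\<alpha>s ! 0 \<in> Hom T (Dom T (\<tau>s ! 1)) (Dom T (\<alpha>s ! 1))"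
      using d1 a(5)[of 0] a(6)[of 0] n_ge_3 by (simp add: Hom_iff)
    show "\<alpha>s ! 0 \<cdot> \<tau>s ! 0 = \<alpha>s ! 0 \<cdot> Id T (Dom T (\<alpha>s ! 0))" using t t' by simp
  qed blast
  note p = seq_morphismD[OF \<phi>(1) t(1) assms]
  have s: "\<phi>s ! 2 \<cdot> \<tau>s ! 1 = \<alpha>s ! 1 \<cdot> \<alpha>s ! 0"
    using p(5)[of 1] \<phi>(3) n_ge_3 by (simp add: numeral_2_eq_2)
  have Z2: "Cod T (\<tau>s ! 1) = Z" "\<tau>s ! 1 \<in> Ar T"
    using t'(6)[of 1] t'(5)[of 1] t(4)[of 2] n_ge_3 by (auto simp: numeral_2_eq_2)
  then have "\<tau>s ! 1 = Zero T (Dom T (\<alpha>s ! 0)) Z"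
    by (intro zero_object_hom_eq[OF t(3)]) (use d1 X t(3) in \<open>auto simp: zero_object_def\<close>)
  moreover have "\<phi>s ! 2 \<in> Hom T Z (Cod T (\<alpha>s ! 1))"
    using p(4)[of 2] t(4)[of 2] a(6)[of 1] n_ge_3 by (simp add: numeral_2_eq_2)
  ultimately show ?thesis using s X by (simp add: Hom_iff)
qed

text \<open>F3 prescribes the first two components, while the factor is sought at position 0. Both
  the trivial angle on \<open>Dom T f\<close> and \<open>\<alpha>s\<close> are therefore rotated to
  the left: then \<open>f\<close> and zero are the prescribed components, and the last component is
  the shift of the factor.\<close>

lemma angle_weak_kernel:
  assumes \<alpha>: "\<alpha>s \<in> Ang T" and f: "f \<in> Ar T" "Cod T f = Dom T (\<alpha>s ! 1)"
    and z: "\<alpha>s ! 1 \<cdot> f = Zero T (Dom T f) (Cod T (\<alpha>s ! 1))"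
  obtains h where "h \<in> Hom T (Dom T f) (Dom T (\<alpha>s ! 0))" "f = \<alpha>s ! 0 \<cdot> h"
proof -
  note a = angle_simps[OF \<alpha>]
  have B: "Dom T f \<in> Ob T" using f by simp
  obtain \<tau>s Z where t: "\<tau>s \<in> Ang T" "hd \<tau>s = Id T (Dom T f)" "zero_object T Z"
      "\<And>k. 2 \<le> k \<Longrightarrow> k < n \<Longrightarrow> Dom T (\<tau>s ! k) = Z"
    by (rule trivial_angle[OF B]) blast
  note t' = angle_simps[OF t(1)]
  have ZO: "Z \<in> Ob T" using t(3) by (simp add: zero_object_def)
  define rt where "rt = tl \<tau>s @ [parity_sign T n (Sh T (hd \<tau>s))]"
  define ra where "ra = tl \<alpha>s @ [parity_sign T n (Sh T (hd \<alpha>s))]"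
  have r: "rt \<in> Ang T" "ra \<in> Ang T" using rotate_left_angle t(1) \<alpha> by (auto simp: rt_def ra_def)
  have nth: "rt ! k = \<tau>s ! Suc k" "ra ! k = \<alpha>s ! Suc k" if "Suc k < n" for k
    using that a(1) t'(1) by (auto simp: rt_def ra_def nth_append nth_tl)
  have last: "last rt = parity_sign T n (Id T (ShOb T (Dom T f)))" "last ra = parity_sign T n (Sh T (hd \<alpha>s))"
    using t(2) B by (auto simp: rt_def ra_def)
  have d1: "Dom T (\<tau>s ! 1) = Dom T f"
  proof -
    have "Cod T (hd \<tau>s) = Dom T f" using t(2) B by simp
    then show ?thesis using t'(6)[of 0] t'(3) n_ge_3 by simp
  qed
  have Z2: "Cod T (\<tau>s ! 1) = Z" "\<tau>s ! 1 \<in> Ar T"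
    using t'(6)[of 1] t'(5)[of 1] t(4)[of 2] n_ge_3 by (auto simp: numeral_2_eq_2)
  then have t1: "\<tau>s ! 1 = Zero T (Dom T f) Z"
    by (intro zero_object_hom_eq[OF t(3)]) (use d1 B ZO in auto)
  have C: "Cod T (\<alpha>s ! 1) = Dom T (\<alpha>s ! 2)" "Cod T (\<alpha>s ! 1) \<in> Ob T" "\<alpha>s ! 2 \<in> Ar T"
    using a(6)[of 1] a(5)[of 1] a(5)[of 2] n_ge_3 by (auto simp: numeral_2_eq_2)
  \<comment> \<open>The second component may be zero because both ways around the first square
    vanish: one by \<open>z\<close>, the other because the component itself is zero.\<close>
  obtain \<phi>s where \<phi>: "seq_morphism T \<phi>s rt ra" "\<phi>s ! 0 = f" "\<phi>s ! 1 = Zero T Z (Cod T (\<alpha>s ! 1))"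
  proof (rule F3[OF r, THEN exE])
    show "f \<in> Hom T (Dom T (rt ! 0)) (Dom T (ra ! 0))"
      using nth[of 0] f d1 n_ge_3 by (simp add: Hom_iff)
    show "Zero T Z (Cod T (\<alpha>s ! 1)) \<in> Hom T (Dom T (rt ! 1)) (Dom T (ra ! 1))"
      using nth[of 1] t(4)[of 2] C ZO n_ge_3 by (simp add: Hom_iff numeral_2_eq_2)
    show "Zero T Z (Cod T (\<alpha>s ! 1)) \<cdot> rt ! 0 = ra ! 0 \<cdot> f"
      using nth[of 0] z t1 C B ZO n_ge_3 by simp
  qed blast
  note p = seq_morphismD[OF \<phi>(1) r]
  have dl: "Dom T (last rt) = ShOb T (Dom T f)" "Dom T (last ra) = ShOb T (Dom T (hd \<alpha>s))"
    using last B angle_ends[OF \<alpha>] by auto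
  have lh: "last \<phi>s \<in> Hom T (ShOb T (Dom T f)) (ShOb T (Dom T (hd \<alpha>s)))"
    using p(3) p(4)[of "n - 1"] n_ge_3 angle_last[OF r(1)] angle_last[OF r(2)] dl by simp
  then obtain h where h: "h \<in> Ar T" "Sh T h = last \<phi>s" using ex_unshift unfolding Hom_iff by metis
  have "ShOb T (Dom T h) = ShOb T (Dom T f)" "ShOb T (Cod T h) = ShOb T (Dom T (hd \<alpha>s))"
    using sh_simps[OF h(1)] h(2) lh by (auto simp: Hom_iff)
  then have hh: "Dom T h = Dom T f" "Cod T h = Dom T (hd \<alpha>s)" using h(1) f angle_ends[OF \<alpha>] by auto
  \<comment> \<open>In the last square \<open>last rt\<close> is the signed identity and
    \<open>last ra\<close> the signed shift of the first arrow, so the same sign stands on both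
    sides and cancels.\<close>
  have "Sh T f \<cdot> last rt = last ra \<cdot> last \<phi>s" using p(6) p(2) \<phi>(2) by simp
  then have sf: "parity_sign T n (Sh T f) = parity_sign T n (Sh T (hd \<alpha>s \<cdot> h))"
    unfolding last using h hh f angle_ends[OF \<alpha>] B lh by (simp add: Hom_iff)
  have "Sh T f = Sh T (hd \<alpha>s \<cdot> h)"
    by (rule iffD1[OF parity_sign_eq_iff sf]) (use h hh f angle_ends[OF \<alpha>] lh in \<open>simp_all add: Hom_iff\<close>)
  then have "f = hd \<alpha>s \<cdot> h"
    using h hh f angle_ends[OF \<alpha>] by (simp del: sh_comp_ar)
  then show ?thesis using that h hh a(3) by (auto simp: Hom_iff)
qed


text \<open>Transport to the other end of an angle: one right rotation brings the last and first
  arrows to positions 0 and 1 and the last but one arrow to the end. Results on the beginning of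
  angles then apply to their ends.\<close>

lemma rotate_right_ends:
  assumes "\<alpha>s \<in> Ang T"
  obtains c \<rho>s where "c \<in> Ar T" "Sh T c = parity_sign T n (last \<alpha>s)" "Cod T c = Dom T (hd \<alpha>s)"
    "ShOb T (Dom T c) = Dom T (last \<alpha>s)" "\<rho>s \<in> Ang T" "hd \<rho>s = c" "\<rho>s ! 0 = c" "\<rho>s ! 1 = hd \<alpha>s"
    "last \<rho>s = \<alpha>s ! (n - 2)"
proof -
  obtain c where c: "c \<in> Ar T" "Sh T c = parity_sign T n (last \<alpha>s)" "c # butlast \<alpha>s \<in> Ang T"
    by (rule rotate_right_angle[OF assms])
  note a = angle_simps[OF assms] and e = angle_ends[OF assms]
  have "ShOb T (Dom T c) = Dom T (last \<alpha>s)" "ShOb T (Cod T c) = ShOb T (Dom T (hd \<alpha>s))"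
    using sh_simps[OF c(1)] c(2) e by auto
  moreover have "(c # butlast \<alpha>s) ! 1 = hd \<alpha>s" using a n_ge_3 by (simp add: nth_butlast)
  moreover have "last (c # butlast \<alpha>s) = \<alpha>s ! (n - 2)"
    using angle_last[OF c(3)] a(1) n_ge_3 by (simp add: nth_Cons' nth_butlast numeral_2_eq_2)
  ultimately show ?thesis using that[OF c(1,2) _ _ c(3)] c(1) e by simp
qed

lemma sh_hd_comp_last:
  assumes "\<alpha>s \<in> Ang T"
  shows "Sh T (hd \<alpha>s) \<cdot> last \<alpha>s = Zero T (Dom T (last \<alpha>s)) (ShOb T (Cod T (hd \<alpha>s)))"
proof -
  obtain c \<rho>s where c: "c \<in> Ar T" "Sh T c = parity_sign T n (last \<alpha>s)" "Cod T c = Dom T (hd \<alpha>s)"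
    "ShOb T (Dom T c) = Dom T (last \<alpha>s)" "\<rho>s \<in> Ang T" "hd \<rho>s = c" "\<rho>s ! 0 = c" "\<rho>s ! 1 = hd \<alpha>s"
    by (rule rotate_right_ends[OF assms])
  note e = angle_ends[OF assms]
  have "hd \<alpha>s \<cdot> c = Zero T (Dom T c) (Cod T (hd \<alpha>s))"
    using angle_comp_zero[OF c(5)] c(7,8) by simp
  then have "Sh T (hd \<alpha>s \<cdot> c) = Sh T (Zero T (Dom T c) (Cod T (hd \<alpha>s)))" by simp
  then have "parity_sign T n (Sh T (hd \<alpha>s) \<cdot> last \<alpha>s) = Zero T (Dom T (last \<alpha>s)) (ShOb T (Cod T (hd \<alpha>s)))"
    using c e by simp
  then show ?thesis using e by simp
qed

text \<open>One more rotation: this is \<open>sh_hd_comp_last\<close> for the right rotation, up to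
  the sign.\<close>

lemma last_comp_penultimate:
  assumes "\<alpha>s \<in> Ang T"
  shows "last \<alpha>s \<cdot> \<alpha>s ! (n - 2) = Zero T (Dom T (\<alpha>s ! (n - 2))) (ShOb T (Dom T (hd \<alpha>s)))"
proof -
  obtain c \<rho>s where c: "c \<in> Ar T" "Sh T c = parity_sign T n (last \<alpha>s)" "Cod T c = Dom T (hd \<alpha>s)"
    "ShOb T (Dom T c) = Dom T (last \<alpha>s)" "\<rho>s \<in> Ang T" "hd \<rho>s = c" "\<rho>s ! 0 = c" "\<rho>s ! 1 = hd \<alpha>s"
    "last \<rho>s = \<alpha>s ! (n - 2)"
    by (rule rotate_right_ends[OF assms])
  note e = angle_ends[OF assms]
  show ?thesis using sh_hd_comp_last[OF c(5)] c e by simp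
qed

text \<open>The bridge between inflations and phantoms. From right to left, map the angle to the
  trivial angle on \<open>Cod T g\<close> with \<open>g\<close> and zero as outer components; the
  component at position 1 is the required factor.\<close>

lemma inflation_factor:
  assumes \<alpha>: "\<alpha>s \<in> Ang T" and g: "g \<in> Ar T" "Dom T g = Dom T (hd \<alpha>s)"
  shows "(\<exists>h\<in>Hom T (Cod T (hd \<alpha>s)) (Cod T g). g = h \<cdot> hd \<alpha>s) \<longleftrightarrow>
    Sh T g \<cdot> last \<alpha>s = Zero T (Dom T (last \<alpha>s)) (ShOb T (Cod T g))" (is "?L \<longleftrightarrow> ?R")
proof
  note e = angle_ends[OF \<alpha>]
  show ?R if L: ?L
  proof -
    obtain h where h: "h \<in> Ar T" "Dom T h = Cod T (hd \<alpha>s)" "Cod T h = Cod T g" "g = h \<cdot> hd \<alpha>s"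
      using L unfolding Bex_def Hom_iff by blast
    have "Sh T g \<cdot> last \<alpha>s = Sh T h \<cdot> (Sh T (hd \<alpha>s) \<cdot> last \<alpha>s)"
      unfolding h(4) using h(1,2) e by simp
    then show ?thesis unfolding sh_hd_comp_last[OF \<alpha>] using h(1-3) e by simp
  qed
  assume z: ?R
  have Y: "Cod T g \<in> Ob T" using g by simp
  obtain \<tau>s Z where t: "\<tau>s \<in> Ang T" "hd \<tau>s = Id T (Cod T g)" "zero_object T Z"
      "\<And>k. 2 \<le> k \<Longrightarrow> k < n \<Longrightarrow> Dom T (\<tau>s ! k) = Z"
    by (rule trivial_angle[OF Y]) blast
  have Z: "Z \<in> Ob T" "Dom T (last \<tau>s) = Z"
    using t(3) t(4)[of "n - 1"] angle_last[OF t(1)] n_ge_3 by (auto simp: zero_object_def)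
  note te = angle_ends[OF t(1)]
  obtain \<phi>s where \<phi>: "seq_morphism T \<phi>s \<alpha>s \<tau>s" "hd \<phi>s = g" "last \<phi>s = Zero T (Dom T (last \<alpha>s)) Z"
  proof (rule F3_ends[OF \<alpha> t(1)])
    show "g \<in> Hom T (Dom T (hd \<alpha>s)) (Dom T (hd \<tau>s))" using g t(2) Y by (simp add: Hom_iff)
    show "Zero T (Dom T (last \<alpha>s)) Z \<in> Hom T (Dom T (last \<alpha>s)) (Dom T (last \<tau>s))"
      using e Z by (simp add: Hom_iff)
    show "Sh T g \<cdot> last \<alpha>s = last \<tau>s \<cdot> Zero T (Dom T (last \<alpha>s)) Z"
      using z e te Z t(2) Y by simp
  qed blast
  note p = seq_morphismD[OF \<phi>(1) \<alpha> t(1)]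
  have "\<phi>s ! 1 \<cdot> hd \<alpha>s = hd \<tau>s \<cdot> g"
    using p(5)[of 0] p(2) \<phi>(2) angle_hd[OF \<alpha>] angle_hd[OF t(1)] n_ge_3 by simp
  then have "g = \<phi>s ! 1 \<cdot> hd \<alpha>s" using t(2) g by simp
  moreover have "\<phi>s ! 1 \<in> Hom T (Cod T (hd \<alpha>s)) (Cod T g)"
  proof -
    have "Cod T (hd \<tau>s) = Cod T g" using t(2) Y by simp
    then show ?thesis
      using p(4)[of 1] angle_cod[OF \<alpha>, of 0] angle_cod[OF t(1), of 0] angle_hd[OF \<alpha>] angle_hd[OF t(1)] n_ge_3
      by simp
  qed
  ultimately show ?L by blast
qed

text \<open>\<open>angle_weak_kernel\<close> for the right rotation, applied to a desuspension of
  \<open>\<phi>\<close>.\<close>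

lemma last_factor:
  assumes \<alpha>: "\<alpha>s \<in> Ang T" and \<phi>: "\<phi> \<in> Ar T" "Cod T \<phi> = ShOb T (Dom T (hd \<alpha>s))"
    and z: "Sh T (hd \<alpha>s) \<cdot> \<phi> = Zero T (Dom T \<phi>) (ShOb T (Cod T (hd \<alpha>s)))"
  shows "\<exists>h\<in>Hom T (Dom T \<phi>) (Dom T (last \<alpha>s)). \<phi> = last \<alpha>s \<cdot> h"
proof -
  obtain c \<rho>s where c: "c \<in> Ar T" "Sh T c = parity_sign T n (last \<alpha>s)" "Cod T c = Dom T (hd \<alpha>s)"
    "ShOb T (Dom T c) = Dom T (last \<alpha>s)" "\<rho>s \<in> Ang T" "hd \<rho>s = c" "\<rho>s ! 0 = c" "\<rho>s ! 1 = hd \<alpha>s"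
    by (rule rotate_right_ends[OF \<alpha>])
  note e = angle_ends[OF \<alpha>]
  obtain f where f: "f \<in> Ar T" "Sh T f = \<phi>" using \<phi> ex_unshift by blast
  have d: "ShOb T (Dom T f) = Dom T \<phi>" "ShOb T (Cod T f) = ShOb T (Dom T (hd \<alpha>s))"
    using sh_simps[OF f(1)] f(2) \<phi> by auto
  then have cf: "Cod T f = Dom T (hd \<alpha>s)" using f e by simp
  have "Sh T (hd \<alpha>s \<cdot> f) = Sh T (Zero T (Dom T f) (Cod T (hd \<alpha>s)))"
    using z d cf f e by simp
  then have "hd \<alpha>s \<cdot> f = Zero T (Dom T f) (Cod T (hd \<alpha>s))"
    using cf f e by (simp del: sh_comp_ar sh_zero)
  then obtain h where h: "h \<in> Hom T (Dom T f) (Dom T c)" "f = c \<cdot> h"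
    using angle_weak_kernel[OF c(5) f(1)] c(7,8) cf by auto
  have "\<phi> = Sh T (c \<cdot> h)" using h(2) f by simp
  \<comment> \<open>The sign in \<open>Sh T c\<close> moves into the factor, which is why the
    witness carries \<open>parity_sign\<close>.\<close>
  also have "\<dots> = last \<alpha>s \<cdot> parity_sign T n (Sh T h)"
    using h(1) c e by (simp add: Hom_iff)
  finally show ?thesis using h(1) d c(4) by (intro bexI[of _ "parity_sign T n (Sh T h)"]) (auto simp: Hom_iff)
qed

text \<open>The counterpart of \<open>inflation_factor\<close> at the other end. Right rotation
  makes the deflation the last arrow, so the direction from right to left is
  \<open>last_factor\<close> there.\<close>

lemma deflation_factor:
  assumes \<alpha>: "\<alpha>s \<in> Ang T" and f: "f \<in> Ar T" "Cod T f = Dom T (last \<alpha>s)"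
  shows "(\<exists>h\<in>Hom T (Dom T f) (Dom T (\<alpha>s ! (n - 2))). f = \<alpha>s ! (n - 2) \<cdot> h) \<longleftrightarrow>
    last \<alpha>s \<cdot> f = Zero T (Dom T f) (ShOb T (Dom T (hd \<alpha>s)))" (is "?L \<longleftrightarrow> ?R")
proof
  note e = angle_ends[OF \<alpha>]
  show ?R if L: ?L
  proof -
    obtain h where h: "h \<in> Ar T" "Dom T h = Dom T f" "Cod T h = Dom T (\<alpha>s ! (n - 2))" "f = \<alpha>s ! (n - 2) \<cdot> h"
      using L unfolding Bex_def Hom_iff by blast
    have "last \<alpha>s \<cdot> f = (last \<alpha>s \<cdot> \<alpha>s ! (n - 2)) \<cdot> h"
      unfolding h(4) using h(1-3) e by simp
    then show ?thesis unfolding last_comp_penultimate[OF \<alpha>] using h(1-3) e by simp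
  qed
  assume z: ?R
  obtain c \<rho>s where c: "c \<in> Ar T" "Sh T c = parity_sign T n (last \<alpha>s)" "Cod T c = Dom T (hd \<alpha>s)"
    "ShOb T (Dom T c) = Dom T (last \<alpha>s)" "\<rho>s \<in> Ang T" "hd \<rho>s = c" "\<rho>s ! 0 = c" "\<rho>s ! 1 = hd \<alpha>s"
    "last \<rho>s = \<alpha>s ! (n - 2)"
    by (rule rotate_right_ends[OF \<alpha>])
  show ?L using last_factor[OF c(5) f(1)] f c z e by simp
qed

text \<open>Apply \<open>inflation_factor\<close> to the right rotation and a desuspension of
  \<open>\<phi>\<close>: the last arrow there is the old last but one arrow, which
  \<open>\<phi>\<close> kills, and the first arrow desuspends the old last arrow up to sign.\<close>

lemma last_factor_left:
  assumes \<alpha>: "\<alpha>s \<in> Ang T" and \<phi>: "\<phi> \<in> Ar T" "Dom T \<phi> = Dom T (last \<alpha>s)" "Cod T \<phi> = ShOb T X" "X \<in> Ob T"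
    and z: "\<phi> \<cdot> \<alpha>s ! (n - 2) = Zero T (Dom T (\<alpha>s ! (n - 2))) (ShOb T X)"
  shows "\<exists>k\<in>Hom T (Dom T (hd \<alpha>s)) X. \<phi> = Sh T k \<cdot> last \<alpha>s"
proof -
  obtain c \<rho>s where c: "c \<in> Ar T" "Sh T c = parity_sign T n (last \<alpha>s)" "Cod T c = Dom T (hd \<alpha>s)"
    "ShOb T (Dom T c) = Dom T (last \<alpha>s)" "\<rho>s \<in> Ang T" "hd \<rho>s = c" "\<rho>s ! 0 = c" "\<rho>s ! 1 = hd \<alpha>s"
    "last \<rho>s = \<alpha>s ! (n - 2)"
    by (rule rotate_right_ends[OF \<alpha>])
  note e = angle_ends[OF \<alpha>]
  obtain g where g: "g \<in> Ar T" "Sh T g = \<phi>" using \<phi> ex_unshift by blast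
  have "ShOb T (Dom T g) = ShOb T (Dom T c)" "ShOb T (Cod T g) = ShOb T X"
    using sh_simps[OF g(1)] g(2) \<phi> c by auto
  then have d: "Dom T g = Dom T c" "Cod T g = X" using g(1) c(1) \<phi>(4) by simp_all
  obtain k where k: "k \<in> Hom T (Dom T (hd \<alpha>s)) X" "g = k \<cdot> c"
    using inflation_factor[OF c(5) g(1)] d c(3,6,9) g(2) z by auto
  have "\<phi> = Sh T (k \<cdot> c)" using k(2) g by simp
  also have "\<dots> = Sh T (parity_sign T n k) \<cdot> last \<alpha>s"
    using k(1) c e by (simp add: Hom_iff)
  finally show ?thesis using k(1) by (intro bexI[of _ "parity_sign T n k"]) (auto simp: Hom_iff)
qed

text \<open>F1 completes a first arrow to an angle. Start from a desuspension of
  \<open>\<phi>\<close> with the sign of F2 included and rotate once to the left.\<close>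

lemma ex_angle_last:
  assumes "\<phi> \<in> Ar T" "Cod T \<phi> = ShOb T X" "X \<in> Ob T"
  obtains \<alpha>s where "\<alpha>s \<in> Ang T" "last \<alpha>s = \<phi>" "Dom T (hd \<alpha>s) = X"
proof -
  obtain c where c: "c \<in> Ar T" "Sh T c = parity_sign T n \<phi>"
    using assms(1) ex_unshift parity_sign_simps(1) by metis
  obtain \<gamma>s where g: "\<gamma>s \<in> Ang T" "hd \<gamma>s = c" using F1_complete c by blast
  have "ShOb T (Cod T c) = ShOb T X" using sh_simps[OF c(1)] c assms by simp
  then have "Cod T c = X" using c assms by simp
  moreover have "hd (tl \<gamma>s @ [\<phi>]) = \<gamma>s ! 1"
    using angle_length[OF g(1)] n_ge_3 by (cases \<gamma>s; cases "tl \<gamma>s") auto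
  moreover have "Cod T (hd \<gamma>s) = Dom T (\<gamma>s ! 1)"
    using angle_cod[OF g(1), of 0] angle_hd[OF g(1)] n_ge_3 by simp
  moreover have "tl \<gamma>s @ [\<phi>] \<in> Ang T"
    using rotate_left_angle[OF g(1)] g c assms by simp
  ultimately show ?thesis using that[of "tl \<gamma>s @ [\<phi>]"] g by simp
qed

end

section \<open>Direct sums of $n$-angles\<close>

context n_angulated_category
begin

text \<open>F1 only recognises a given direct sum as an angle, so one is assembled from chosen
  biproducts at the n positions.\<close>

lemma ex_direct_sum_angle:
  assumes \<alpha>: "\<alpha>s \<in> Ang T" and \<beta>: "\<beta>s \<in> Ang T"
  obtains \<gamma>s where "\<gamma>s \<in> Ang T" "seq_direct_sum T \<alpha>s \<beta>s \<gamma>s"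
proof -
  note a = angle_simps[OF \<alpha>] and b = angle_simps[OF \<beta>]
  define D where "D \<xi>s k = (if k < n then Dom T (\<xi>s ! k) else ShOb T (Dom T (\<xi>s ! 0)))" for \<xi>s k
  have "\<exists>W i\<^sub>1 i\<^sub>2 p\<^sub>1 p\<^sub>2. k < n \<longrightarrow> biproduct T (Dom T (\<alpha>s ! k)) (Dom T (\<beta>s ! k)) W i\<^sub>1 i\<^sub>2 p\<^sub>1 p\<^sub>2" for k
    using ex_biproduct a b by (cases "k < n") auto
  then obtain W i\<^sub>1 i\<^sub>2 p\<^sub>1 p\<^sub>2 where bp: "\<And>k. k < n \<Longrightarrow>
      biproduct T (Dom T (\<alpha>s ! k)) (Dom T (\<beta>s ! k)) (W k) (i\<^sub>1 k) (i\<^sub>2 k) (p\<^sub>1 k) (p\<^sub>2 k)"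
    by metis
  \<comment> \<open>Continues the chosen maps to position n by periodicity, as \<open>ext\<close>
    does for lists, so that the last square is handled together with the others.\<close>
  define S where "S F k = (if k < n then F k else Sh T (F 0))" for F :: "nat \<Rightarrow> 'm" and k
  define V where "V k = (if k < n then W k else ShOb T (W 0))" for k
  have bp': "biproduct T (D \<alpha>s k) (D \<beta>s k) (V k) (S i\<^sub>1 k) (S i\<^sub>2 k) (S p\<^sub>1 k) (S p\<^sub>2 k)" for k
    using bp[of k] sh_biproduct[OF bp[of 0]] n_ge_3 by (auto simp: D_def S_def V_def)
  note q = bp'[unfolded biproduct_def Hom_iff]
  have ar: "\<alpha>s ! k \<in> Ar T" "Dom T (\<alpha>s ! k) = D \<alpha>s k" "Cod T (\<alpha>s ! k) = D \<alpha>s (Suc k)"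
    "\<beta>s ! k \<in> Ar T" "Dom T (\<beta>s ! k) = D \<beta>s k" "Cod T (\<beta>s ! k) = D \<beta>s (Suc k)" if k: "k < n" for k
  proof -
    show "\<alpha>s ! k \<in> Ar T" "Dom T (\<alpha>s ! k) = D \<alpha>s k" "\<beta>s ! k \<in> Ar T" "Dom T (\<beta>s ! k) = D \<beta>s k"
      using k a b by (simp_all add: D_def)
    have "k = n - 1 \<or> Suc k < n" using k by auto
    then show "Cod T (\<alpha>s ! k) = D \<alpha>s (Suc k)" "Cod T (\<beta>s ! k) = D \<beta>s (Suc k)"
      using a(6,7) b(6,7) n_ge_3 by (auto simp: D_def)
  qed
  have DO: "D \<alpha>s k \<in> Ob T" "D \<beta>s k \<in> Ob T" for k
    using a b n_ge_3 by (auto simp: D_def)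
  \<comment> \<open>The diagonal map with entries \<open>\<alpha>s ! k\<close> and
    \<open>\<beta>s ! k\<close>.\<close>
  define \<gamma> where "\<gamma> k = S i\<^sub>1 (Suc k) \<cdot> (\<alpha>s ! k \<cdot> S p\<^sub>1 k) \<oplus> S i\<^sub>2 (Suc k) \<cdot> (\<beta>s ! k \<cdot> S p\<^sub>2 k)" for k
  have \<gamma>: "\<gamma> k \<in> Ar T" "Dom T (\<gamma> k) = V k" "Cod T (\<gamma> k) = V (Suc k)" if "k < n" for k
    unfolding \<gamma>_def using q[of k] q[of "Suc k"] ar[OF that] by simp_all
  have \<gamma>i: "\<gamma> k \<cdot> S i\<^sub>1 k = S i\<^sub>1 (Suc k) \<cdot> \<alpha>s ! k" "\<gamma> k \<cdot> S i\<^sub>2 k = S i\<^sub>2 (Suc k) \<cdot> \<beta>s ! k"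
    if "k < n" for k
    unfolding \<gamma>_def using q[of k] q[of "Suc k"] ar[OF that] DO by simp_all
  have p\<gamma>: "S p\<^sub>1 (Suc k) \<cdot> \<gamma> k = \<alpha>s ! k \<cdot> S p\<^sub>1 k" "S p\<^sub>2 (Suc k) \<cdot> \<gamma> k = \<beta>s ! k \<cdot> S p\<^sub>2 k"
    if k: "k < n" for k
  proof -
    have "S p\<^sub>1 (Suc k) \<cdot> \<gamma> k = (S p\<^sub>1 (Suc k) \<cdot> S i\<^sub>1 (Suc k)) \<cdot> (\<alpha>s ! k \<cdot> S p\<^sub>1 k)
        \<oplus> (S p\<^sub>1 (Suc k) \<cdot> S i\<^sub>2 (Suc k)) \<cdot> (\<beta>s ! k \<cdot> S p\<^sub>2 k)"
      unfolding \<gamma>_def using q[of k] q[of "Suc k"] ar[OF k] DO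
      by (subst comp_plus) (simp_all del: comp_assoc_ar add: comp_assoc_ar[symmetric])
    also have "\<dots> = \<alpha>s ! k \<cdot> S p\<^sub>1 k"
      using q[of k] q[of "Suc k"] ar[OF k] DO by (simp del: comp_assoc_ar)
    finally show "S p\<^sub>1 (Suc k) \<cdot> \<gamma> k = \<alpha>s ! k \<cdot> S p\<^sub>1 k" .
    have "S p\<^sub>2 (Suc k) \<cdot> \<gamma> k = (S p\<^sub>2 (Suc k) \<cdot> S i\<^sub>1 (Suc k)) \<cdot> (\<alpha>s ! k \<cdot> S p\<^sub>1 k)
        \<oplus> (S p\<^sub>2 (Suc k) \<cdot> S i\<^sub>2 (Suc k)) \<cdot> (\<beta>s ! k \<cdot> S p\<^sub>2 k)"
      unfolding \<gamma>_def using q[of k] q[of "Suc k"] ar[OF k] DO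
      by (subst comp_plus) (simp_all del: comp_assoc_ar add: comp_assoc_ar[symmetric])
    also have "\<dots> = \<beta>s ! k \<cdot> S p\<^sub>2 k"
      using q[of k] q[of "Suc k"] ar[OF k] DO by (simp del: comp_assoc_ar)
    finally show "S p\<^sub>2 (Suc k) \<cdot> \<gamma> k = \<beta>s ! k \<cdot> S p\<^sub>2 k" .
  qed
  define L where "L F = map F [0..<n]" for F :: "nat \<Rightarrow> 'm"
  have L: "length (L F) = n" "k < n \<Longrightarrow> L F ! k = F k" "k < n \<Longrightarrow> ext T (L F) ! Suc k = S F (Suc k)"
    for F k
  proof -
    show l: "length (L F) = n" by (simp add: L_def)
    show nth: "k < n \<Longrightarrow> L F ! k = F k" for k by (simp add: L_def)
    have "hd (L F) = F 0" using n_ge_3 by (simp add: L_def hd_map upt_conv_Cons)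
    then show "k < n \<Longrightarrow> ext T (L F) ! Suc k = S F (Suc k)"
      using l nth by (cases "Suc k < n") (auto simp: ext_def S_def nth_append)
  qed
  have SF: "S F k = F k" if "k < n" for F k using that by (simp add: S_def)
  have V: "V k = W k" if "k < n" for k using that by (simp add: V_def)
  have \<gamma>i': "\<gamma> k \<cdot> i\<^sub>1 k = S i\<^sub>1 (Suc k) \<cdot> \<alpha>s ! k" "\<gamma> k \<cdot> i\<^sub>2 k = S i\<^sub>2 (Suc k) \<cdot> \<beta>s ! k"
    if "k < n" for k using \<gamma>i[OF that] SF[OF that] by simp_all
  have p\<gamma>': "S p\<^sub>1 (Suc k) \<cdot> \<gamma> k = \<alpha>s ! k \<cdot> p\<^sub>1 k" "S p\<^sub>2 (Suc k) \<cdot> \<gamma> k = \<beta>s ! k \<cdot> p\<^sub>2 k"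
    if "k < n" for k using p\<gamma>[OF that] SF[OF that] by simp_all
  note bq = bp[unfolded biproduct_def Hom_iff]
  have ss: "sigma_seq n T (L \<gamma>)"
    unfolding sigma_seq_def
  proof (intro conjI allI impI)
    show "length (L \<gamma>) = n" by (rule L)
    show "set (L \<gamma>) \<subseteq> Ar T" using \<gamma> by (auto simp: L_def)
    fix k assume k: "k < n"
    have "Dom T (S \<gamma> (Suc k)) = V (Suc k)"
      using \<gamma>[of 0] \<gamma>[of "Suc k"] n_ge_3 k by (auto simp: S_def V_def)
    then show "Cod T (L \<gamma> ! k) = Dom T (ext T (L \<gamma>) ! Suc k)"
      using L(2)[OF k] L(3)[OF k] \<gamma>[of k] k by simp
  qed
  have "seq_direct_sum T \<alpha>s \<beta>s (L \<gamma>)"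
    unfolding seq_direct_sum_def
  proof (intro exI conjI allI impI)
    show "seq_morphism T (L i\<^sub>1) \<alpha>s (L \<gamma>)" "seq_morphism T (L i\<^sub>2) \<beta>s (L \<gamma>)"
      "seq_morphism T (L p\<^sub>1) (L \<gamma>) \<alpha>s" "seq_morphism T (L p\<^sub>2) (L \<gamma>) \<beta>s"
      unfolding seq_morphism_def using L a(1) b(1) bq V \<gamma>(2) \<gamma>i' p\<gamma>' by (simp_all add: Hom_iff)
    fix k assume "k < length (L \<gamma>)"
    then have k: "k < n" using L by simp
    show "biproduct T (Dom T (\<alpha>s ! k)) (Dom T (\<beta>s ! k)) (Dom T (L \<gamma> ! k))
        (L i\<^sub>1 ! k) (L i\<^sub>2 ! k) (L p\<^sub>1 ! k) (L p\<^sub>2 ! k)"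
      using bp[OF k] L(2)[OF k] \<gamma>(2)[OF k] k by (simp add: V_def)
  qed
  moreover from this have "L \<gamma> \<in> Ang T" using F1_sum[OF \<alpha> \<beta> ss] by blast
  ultimately show ?thesis using that by blast
qed

text \<open>The projections commute with the last arrows, so inserting the decomposition of the
  identity of the shifted first object shows that the last arrow is diagonal. This applies to any
  direct sum, whatever biproducts were chosen.\<close>

lemma direct_sum_last:
  assumes d: "seq_direct_sum T \<alpha>s \<beta>s \<gamma>s"
    and \<alpha>: "\<alpha>s \<in> Ang T" and \<beta>: "\<beta>s \<in> Ang T" and \<gamma>: "\<gamma>s \<in> Ang T"
  obtains i\<^sub>1 i\<^sub>2 p\<^sub>1 p\<^sub>2 j\<^sub>1 j\<^sub>2 q\<^sub>1 q\<^sub>2 where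
    "biproduct T (Dom T (hd \<alpha>s)) (Dom T (hd \<beta>s)) (Dom T (hd \<gamma>s)) i\<^sub>1 i\<^sub>2 p\<^sub>1 p\<^sub>2"
    "biproduct T (Dom T (last \<alpha>s)) (Dom T (last \<beta>s)) (Dom T (last \<gamma>s)) j\<^sub>1 j\<^sub>2 q\<^sub>1 q\<^sub>2"
    "last \<gamma>s = Sh T i\<^sub>1 \<cdot> (last \<alpha>s \<cdot> q\<^sub>1) \<oplus> Sh T i\<^sub>2 \<cdot> (last \<beta>s \<cdot> q\<^sub>2)"
proof -
  obtain i\<^sub>1 i\<^sub>2 p\<^sub>1 p\<^sub>2 where m:
    "seq_morphism T i\<^sub>1 \<alpha>s \<gamma>s" "seq_morphism T i\<^sub>2 \<beta>s \<gamma>s" "seq_morphism T p\<^sub>1 \<gamma>s \<alpha>s" "seq_morphism T p\<^sub>2 \<gamma>s \<beta>s"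
    and "\<And>k. k < length \<gamma>s \<Longrightarrow> biproduct T (Dom T (\<alpha>s ! k)) (Dom T (\<beta>s ! k)) (Dom T (\<gamma>s ! k))
           (i\<^sub>1 ! k) (i\<^sub>2 ! k) (p\<^sub>1 ! k) (p\<^sub>2 ! k)"
    using d unfolding seq_direct_sum_def by blast
  then have bp: "biproduct T (Dom T (\<alpha>s ! k)) (Dom T (\<beta>s ! k)) (Dom T (\<gamma>s ! k))
           (i\<^sub>1 ! k) (i\<^sub>2 ! k) (p\<^sub>1 ! k) (p\<^sub>2 ! k)" if "k < n" for k
    using that angle_length[OF \<gamma>] by simp
  note M = seq_morphismD[OF m(1) \<alpha> \<gamma>] seq_morphismD[OF m(2) \<beta> \<gamma>]
    seq_morphismD[OF m(3) \<gamma> \<alpha>] seq_morphismD[OF m(4) \<gamma> \<beta>]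
  note H = angle_hd[OF \<alpha>] angle_hd[OF \<beta>] angle_hd[OF \<gamma>] angle_last[OF \<alpha>] angle_last[OF \<beta>] angle_last[OF \<gamma>]
  have bh: "biproduct T (Dom T (hd \<alpha>s)) (Dom T (hd \<beta>s)) (Dom T (hd \<gamma>s)) (hd i\<^sub>1) (hd i\<^sub>2) (hd p\<^sub>1) (hd p\<^sub>2)"
    using bp[of 0] M H n_ge_3 by simp
  have bl: "biproduct T (Dom T (last \<alpha>s)) (Dom T (last \<beta>s)) (Dom T (last \<gamma>s))
      (last i\<^sub>1) (last i\<^sub>2) (last p\<^sub>1) (last p\<^sub>2)"
    using bp[of "n - 1"] M H n_ge_3 by simp
  note s = sh_biproduct[OF bh, unfolded biproduct_def Hom_iff] and h = bh[unfolded biproduct_def Hom_iff]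
  note e = angle_ends[OF \<alpha>] angle_ends[OF \<beta>] angle_ends[OF \<gamma>]
  have "last \<gamma>s = (Sh T (hd i\<^sub>1) \<cdot> Sh T (hd p\<^sub>1) \<oplus> Sh T (hd i\<^sub>2) \<cdot> Sh T (hd p\<^sub>2)) \<cdot> last \<gamma>s"
    using s e by simp
  also have "\<dots> = Sh T (hd i\<^sub>1) \<cdot> (Sh T (hd p\<^sub>1) \<cdot> last \<gamma>s) \<oplus> Sh T (hd i\<^sub>2) \<cdot> (Sh T (hd p\<^sub>2) \<cdot> last \<gamma>s)"
    by (subst plus_comp) (use s e in simp_all)
  also have "Sh T (hd p\<^sub>1) \<cdot> last \<gamma>s = last \<alpha>s \<cdot> last p\<^sub>1" by (rule M)
  also have "Sh T (hd p\<^sub>2) \<cdot> last \<gamma>s = last \<beta>s \<cdot> last p\<^sub>2" by (rule M)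
  finally show ?thesis using that[OF bh bl] by blast
qed

end

section \<open>Almost exact structures and their phantoms\<close>

lemma Mor_iff: "f \<in> Mor T A \<longleftrightarrow> f \<in> Ar T \<and> Dom T f \<in> A \<and> Cod T f \<in> A"
  by (simp add: Mor_def)

lemma phantomI: "\<alpha>s \<in> E \<Longrightarrow> last \<alpha>s = \<phi> \<Longrightarrow> \<phi> \<in> phantoms E"
  by (auto simp: phantoms_def)

lemma phantomE:
  assumes "\<phi> \<in> phantoms E" obtains \<alpha>s where "\<alpha>s \<in> E" "last \<alpha>s = \<phi>"
  using assms by (auto simp: phantoms_def)

text \<open>The structure is a locale parameter, so that all results can be interpreted again for
  substructures.\<close>

locale exact_structure = n_angulated_category n T
  for n :: nat and T :: "('o, 'm, 'z) ncat_scheme" (structure) +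
  fixes A :: "'o set" and E :: "'m list set"
  assumes ext_closed: "extension_closed_subcategory T A"
    and almost_exact: "almost_exact_structure T A E"
begin

lemma A_ob [simp]: "X \<in> A \<Longrightarrow> X \<in> Ob T"
  using ext_closed unfolding extension_closed_subcategory_def by blast

lemma E_subset: "E \<subseteq> angles_in T A"
  using almost_exact unfolding almost_exact_structure_def by (rule conjunct1)

lemma E_angle: "\<alpha>s \<in> E \<Longrightarrow> \<alpha>s \<in> Ang T"
  using E_subset by (auto simp: angles_in_def)

lemma E_in_A:
  assumes "\<alpha>s \<in> E"
  shows "Dom T (hd \<alpha>s) \<in> A" "Dom T (last \<alpha>s) \<in> A" "Dom T (\<alpha>s ! (n - 2)) \<in> A" "Cod T (hd \<alpha>s) \<in> A"
proof -
  note a = angle_simps[OF E_angle[OF assms]]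
  have "\<forall>a\<in>set \<alpha>s. Dom T a \<in> A"
    using E_subset assms by (auto simp: angles_in_def)
  then have "Dom T (\<alpha>s ! k) \<in> A" if "k < n" for k using that a(1) by simp
  from this[of 0] this[of 1] this[of "n - 1"] this[of "n - 2"]
  show "Dom T (hd \<alpha>s) \<in> A" "Dom T (last \<alpha>s) \<in> A" "Dom T (\<alpha>s ! (n - 2)) \<in> A" "Cod T (hd \<alpha>s) \<in> A"
    using a(3,4) a(6)[of 0] n_ge_3 by auto
qed

lemma angle_in_A: "\<alpha>s \<in> Ang T \<Longrightarrow> Dom T (hd \<alpha>s) \<in> A \<Longrightarrow> Dom T (last \<alpha>s) \<in> A \<Longrightarrow> \<alpha>s \<in> angles_in T A"
  using ext_closed unfolding extension_closed_subcategory_def angles_in_def by blast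

lemma phantom_ar:
  assumes "\<phi> \<in> phantoms E"
  shows "\<phi> \<in> Ar T" "Dom T \<phi> \<in> A" "\<exists>X\<in>A. Cod T \<phi> = ShOb T X"
  using assms E_in_A angle_ends E_angle unfolding phantoms_def by blast+

lemma almost_exact_clauses:
  shows E_direct_sum:
      "\<alpha>s \<in> E \<Longrightarrow> \<beta>s \<in> E \<Longrightarrow> \<gamma>s \<in> Ang T \<Longrightarrow> seq_direct_sum T \<alpha>s \<beta>s \<gamma>s \<Longrightarrow> \<gamma>s \<in> E"
    and E_split: "\<alpha>s \<in> angles_in T A \<Longrightarrow> split_angle T \<alpha>s \<Longrightarrow> \<alpha>s \<in> E"
    and E_N2: "\<alpha>s \<in> E \<Longrightarrow> f \<in> Mor T A \<Longrightarrow> \<beta>s \<in> Ang T \<Longrightarrow> Cod T f = Dom T (last \<alpha>s) \<Longrightarrow>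
      Dom T (hd \<beta>s) = Dom T (hd \<alpha>s) \<Longrightarrow> last \<beta>s = last \<alpha>s \<cdot> f \<Longrightarrow> seq_morphism T \<phi>s \<beta>s \<alpha>s \<Longrightarrow>
      hd \<phi>s = Id T (Dom T (hd \<alpha>s)) \<Longrightarrow> last \<phi>s = f \<Longrightarrow> \<beta>s \<in> E"
    and E_N3: "\<alpha>s \<in> E \<Longrightarrow> g \<in> Mor T A \<Longrightarrow> \<gamma>s \<in> Ang T \<Longrightarrow> Dom T g = Dom T (hd \<alpha>s) \<Longrightarrow>
      Dom T (last \<gamma>s) = Dom T (last \<alpha>s) \<Longrightarrow> last \<gamma>s = Sh T g \<cdot> last \<alpha>s \<Longrightarrow>
      seq_morphism T \<phi>s \<alpha>s \<gamma>s \<Longrightarrow> hd \<phi>s = g \<Longrightarrow> last \<phi>s = Id T (Dom T (last \<alpha>s)) \<Longrightarrow> \<gamma>s \<in> E"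
  using almost_exact unfolding almost_exact_structure_def by blast+

text \<open>N2 demands a morphism of angles with the identity and \<open>f\<close> at its ends.
  \<open>F3_ends\<close> always provides one, so the equation between last arrows suffices.\<close>

lemma E_pullback:
  assumes "\<alpha>s \<in> E" "f \<in> Mor T A" "Cod T f = Dom T (last \<alpha>s)" "\<beta>s \<in> Ang T" "last \<beta>s = last \<alpha>s \<cdot> f"
  shows "\<beta>s \<in> E"
proof -
  note e = angle_ends[OF E_angle[OF assms(1)]] and e' = angle_ends[OF assms(4)]
  have f: "f \<in> Ar T" using assms(2) by (simp add: Mor_iff)
  have "ShOb T (Dom T (hd \<beta>s)) = ShOb T (Dom T (hd \<alpha>s))"
    using e e' assms(3,5) f by simp
  then have hd: "Dom T (hd \<beta>s) = Dom T (hd \<alpha>s)" using e e' by simp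
  obtain \<phi>s where m: "seq_morphism T \<phi>s \<beta>s \<alpha>s" "hd \<phi>s = Id T (Dom T (hd \<alpha>s))" "last \<phi>s = f"
    by (rule F3_ends[OF assms(4) E_angle[OF assms(1)] _ _ _ that]) (use hd e e' assms(3,5) f in \<open>simp_all add: Hom_iff\<close>)
  show ?thesis by (rule E_N2[OF assms(1,2,4,3) hd assms(5) m])
qed

text \<open>The same for N3, with \<open>g\<close> and the identity as outer components.\<close>

lemma E_pushout:
  assumes "\<alpha>s \<in> E" "g \<in> Mor T A" "Dom T g = Dom T (hd \<alpha>s)" "\<beta>s \<in> Ang T" "last \<beta>s = Sh T g \<cdot> last \<alpha>s"
  shows "\<beta>s \<in> E"
proof -
  note e = angle_ends[OF E_angle[OF assms(1)]] and e' = angle_ends[OF assms(4)]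
  have g: "g \<in> Ar T" using assms(2) by (simp add: Mor_iff)
  have "ShOb T (Dom T (hd \<beta>s)) = ShOb T (Cod T g)" "Dom T (last \<beta>s) = Dom T (last \<alpha>s)"
    using e e' assms(3,5) g by simp_all
  then have d: "Dom T (hd \<beta>s) = Cod T g" "Dom T (last \<beta>s) = Dom T (last \<alpha>s)" using e e' g by simp_all
  obtain \<phi>s where m: "seq_morphism T \<phi>s \<alpha>s \<beta>s" "hd \<phi>s = g" "last \<phi>s = Id T (Dom T (last \<alpha>s))"
    by (rule F3_ends[OF E_angle[OF assms(1)] assms(4) _ _ _ that])
      (use d e e' assms(3,5) g in \<open>simp_all add: Hom_iff\<close>)
  show ?thesis by (rule E_N3[OF assms(1,2,4,3) d(2) assms(5) m])
qed

text \<open>Pullback along an identity. Among angles, membership in \<open>E\<close> thus depends on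
  the last arrow alone.\<close>

lemma E_memI:
  assumes "\<alpha>s \<in> Ang T" "last \<alpha>s \<in> phantoms E"
  shows "\<alpha>s \<in> E"
proof -
  obtain \<beta>s where b: "\<beta>s \<in> E" "last \<beta>s = last \<alpha>s" by (rule phantomE[OF assms(2)])
  note e = angle_ends[OF E_angle[OF b(1)]]
  show ?thesis
    by (rule E_pullback[OF b(1), of "Id T (Dom T (last \<beta>s))"])
      (use assms b E_in_A[OF b(1)] e in \<open>auto simp: Mor_iff\<close>)
qed

text \<open>An angle ending in the composite exists by \<open>ex_angle_last\<close>, and any such
  angle is a pullback.\<close>

lemma phantom_comp:
  assumes "\<phi> \<in> phantoms E" "f \<in> Mor T A" "Cod T f = Dom T \<phi>"
  shows "\<phi> \<cdot> f \<in> phantoms E"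
proof -
  obtain \<alpha>s where a: "\<alpha>s \<in> E" "last \<alpha>s = \<phi>" by (rule phantomE[OF assms(1)])
  obtain X where X: "X \<in> A" "Cod T \<phi> = ShOb T X" using phantom_ar[OF assms(1)] by blast
  obtain \<beta>s where "\<beta>s \<in> Ang T" "last \<beta>s = \<phi> \<cdot> f"
    by (rule ex_angle_last[of "\<phi> \<cdot> f" X, OF _ _ _ that]) (use X assms phantom_ar[OF assms(1)] in \<open>simp_all add: Mor_iff\<close>)
  then show ?thesis using E_pullback[OF a(1) assms(2)] a assms phantomI by metis
qed

lemma sh_comp_phantom:
  assumes "\<phi> \<in> phantoms E" "g \<in> Mor T A" "Cod T \<phi> = ShOb T (Dom T g)"
  shows "Sh T g \<cdot> \<phi> \<in> phantoms E"
proof -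
  obtain \<alpha>s where a: "\<alpha>s \<in> E" "last \<alpha>s = \<phi>" by (rule phantomE[OF assms(1)])
  note e = angle_ends[OF E_angle[OF a(1)]]
  have g: "Dom T g = Dom T (hd \<alpha>s)"
    using a assms(2,3) e by (simp add: Mor_iff)
  obtain \<beta>s where "\<beta>s \<in> Ang T" "last \<beta>s = Sh T g \<cdot> \<phi>"
    by (rule ex_angle_last[of "Sh T g \<cdot> \<phi>" "Cod T g", OF _ _ _ that]) (use assms phantom_ar[OF assms(1)] in \<open>simp_all add: Mor_iff\<close>)
  then show ?thesis using E_pushout[OF a(1) assms(2)] a g phantomI by metis
qed

text \<open>An angle ending in a zero arrow is split, and extension closure puts all its objects in
  \<open>A\<close>.\<close>

lemma zero_phantom:
  assumes "X \<in> A" "C \<in> A"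
  shows "Zero T C (ShOb T X) \<in> phantoms E"
proof -
  obtain \<alpha>s where a: "\<alpha>s \<in> Ang T" "last \<alpha>s = Zero T C (ShOb T X)" "Dom T (hd \<alpha>s) = X"
    by (rule ex_angle_last[of "Zero T C (ShOb T X)" X, OF _ _ _ that]) (use assms in simp_all)
  then have "\<alpha>s \<in> angles_in T A" "split_angle T \<alpha>s"
    using angle_in_A[OF a(1)] assms by (auto simp: split_angle_def)
  then have "\<alpha>s \<in> E" by (rule E_split)
  then show ?thesis using a phantomI by metis
qed

text \<open>Closure of \<open>A\<close> under biproducts comes from N1: add two split angles
  starting at \<open>X\<close> and \<open>Y\<close>; the sum is in \<open>E\<close> and begins with
  a biproduct.\<close>

lemma biproduct_in_A:
  assumes "X \<in> A" "Y \<in> A"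
  obtains W i\<^sub>1 i\<^sub>2 p\<^sub>1 p\<^sub>2 where "W \<in> A" "biproduct T X Y W i\<^sub>1 i\<^sub>2 p\<^sub>1 p\<^sub>2"
proof -
  obtain \<alpha>s where a: "\<alpha>s \<in> E" "last \<alpha>s = Zero T X (ShOb T X)"
    by (rule phantomE[OF zero_phantom[OF assms(1,1)]])
  obtain \<beta>s where b: "\<beta>s \<in> E" "last \<beta>s = Zero T Y (ShOb T Y)"
    by (rule phantomE[OF zero_phantom[OF assms(2,2)]])
  obtain \<gamma>s where g: "\<gamma>s \<in> Ang T" "seq_direct_sum T \<alpha>s \<beta>s \<gamma>s"
    by (rule ex_direct_sum_angle[OF E_angle[OF a(1)] E_angle[OF b(1)]])
  then have gE: "\<gamma>s \<in> E" using E_direct_sum a b by blast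
  have "ShOb T (Dom T (hd \<alpha>s)) = ShOb T X" "ShOb T (Dom T (hd \<beta>s)) = ShOb T Y"
    using angle_ends(4)[OF E_angle[OF a(1)]] angle_ends(4)[OF E_angle[OF b(1)]] a(2) b(2) assms by simp_all
  then have d: "Dom T (hd \<alpha>s) = X" "Dom T (hd \<beta>s) = Y"
    using E_in_A(1)[OF a(1)] E_in_A(1)[OF b(1)] assms by simp_all
  show ?thesis
    by (rule direct_sum_last[OF g(2) E_angle[OF a(1)] E_angle[OF b(1)] g(1)])
      (use that[OF E_in_A(1)[OF gE]] d in blast)
qed

text \<open>The Baer sum: the direct sum of the two angles, pulled back along the diagonal and
  pushed out along the codiagonal.\<close>

lemma phantom_plus:
  assumes \<phi>: "\<phi> \<in> phantoms E" and \<psi>: "\<psi> \<in> phantoms E"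
    and eq: "Dom T \<phi> = Dom T \<psi>" "Cod T \<phi> = Cod T \<psi>"
  shows "\<phi> \<oplus> \<psi> \<in> phantoms E"
proof -
  obtain \<alpha>s where a: "\<alpha>s \<in> E" "last \<alpha>s = \<phi>" by (rule phantomE[OF \<phi>])
  obtain \<beta>s where b: "\<beta>s \<in> E" "last \<beta>s = \<psi>" by (rule phantomE[OF \<psi>])
  obtain \<gamma>s where g: "\<gamma>s \<in> Ang T" "seq_direct_sum T \<alpha>s \<beta>s \<gamma>s"
    by (rule ex_direct_sum_angle[OF E_angle[OF a(1)] E_angle[OF b(1)]])
  have gE: "\<gamma>s \<in> E" using E_direct_sum a b g by blast
  note ea = angle_ends[OF E_angle[OF a(1)], unfolded a(2)] and eb = angle_ends[OF E_angle[OF b(1)], unfolded b(2)]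
  have "ShOb T (Dom T (hd \<beta>s)) = ShOb T (Dom T (hd \<alpha>s))" using ea eb eq by simp
  then have X: "Dom T (hd \<beta>s) = Dom T (hd \<alpha>s)" using ea eb by simp
  define X C where "X = Dom T (hd \<alpha>s)" and "C = Dom T \<phi>"
  have XC: "X \<in> A" "C \<in> A" using E_in_A[OF a(1)] a by (auto simp: X_def C_def)
  obtain i\<^sub>1 i\<^sub>2 p\<^sub>1 p\<^sub>2 j\<^sub>1 j\<^sub>2 q\<^sub>1 q\<^sub>2 where
    p: "biproduct T X X (Dom T (hd \<gamma>s)) i\<^sub>1 i\<^sub>2 p\<^sub>1 p\<^sub>2" and
    q: "biproduct T C C (Dom T (last \<gamma>s)) j\<^sub>1 j\<^sub>2 q\<^sub>1 q\<^sub>2" and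
    last: "last \<gamma>s = Sh T i\<^sub>1 \<cdot> (\<phi> \<cdot> q\<^sub>1) \<oplus> Sh T i\<^sub>2 \<cdot> (\<psi> \<cdot> q\<^sub>2)"
    using direct_sum_last[OF g(2) E_angle[OF a(1)] E_angle[OF b(1)] g(1)]
    unfolding X a(2) b(2) eq(1)[symmetric] X_def[symmetric] C_def[symmetric] by blast
  note p' = sh_biproduct[OF p, unfolded biproduct_def Hom_iff] and p = p[unfolded biproduct_def Hom_iff]
    and q = q[unfolded biproduct_def Hom_iff]
  have \<phi>a: "\<phi> \<in> Ar T" "Dom T \<phi> = C" "Cod T \<phi> = ShOb T X" using ea by (auto simp: X_def C_def)
  have \<psi>a: "\<psi> \<in> Ar T" "Dom T \<psi> = C" "Cod T \<psi> = ShOb T X" using eb ea X eq by (auto simp: X_def C_def)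
  \<comment> \<open>\<open>k\<close> is the codiagonal to \<open>X\<close> and \<open>f\<close> the
    diagonal from \<open>C\<close>.\<close>
  define k where "k = p\<^sub>1 \<oplus> p\<^sub>2"
  define f where "f = j\<^sub>1 \<oplus> j\<^sub>2"
  have k: "k \<in> Ar T" "Dom T k = Dom T (hd \<gamma>s)" "Cod T k = X" unfolding k_def using p by simp_all
  have f: "f \<in> Ar T" "Dom T f = C" "Cod T f = Dom T (last \<gamma>s)" unfolding f_def using q by simp_all
  have ki: "Sh T k \<cdot> Sh T i\<^sub>1 = Id T (ShOb T X)" "Sh T k \<cdot> Sh T i\<^sub>2 = Id T (ShOb T X)"
    unfolding k_def using p p' XC by simp_all
  have qf: "q\<^sub>1 \<cdot> f = Id T C" "q\<^sub>2 \<cdot> f = Id T C"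
    unfolding f_def using q XC by simp_all
  have "Sh T k \<cdot> last \<gamma>s = (Sh T k \<cdot> Sh T i\<^sub>1) \<cdot> (\<phi> \<cdot> q\<^sub>1) \<oplus> (Sh T k \<cdot> Sh T i\<^sub>2) \<cdot> (\<psi> \<cdot> q\<^sub>2)"
    unfolding last using k p p' q \<phi>a \<psi>a by (subst comp_plus) simp_all
  also have "\<dots> = \<phi> \<cdot> q\<^sub>1 \<oplus> \<psi> \<cdot> q\<^sub>2" unfolding ki using q \<phi>a \<psi>a by simp
  finally have kl: "Sh T k \<cdot> last \<gamma>s = \<phi> \<cdot> q\<^sub>1 \<oplus> \<psi> \<cdot> q\<^sub>2" .
  have "Sh T k \<cdot> last \<gamma>s \<cdot> f = \<phi> \<oplus> \<psi>"
    unfolding kl using q f qf \<phi>a \<psi>a by simp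
  moreover have "Sh T k \<cdot> last \<gamma>s \<in> phantoms E"
    by (rule sh_comp_phantom) (use gE k XC E_in_A[OF gE] angle_ends[OF g(1)] in \<open>auto simp: Mor_iff phantoms_def\<close>)
  moreover have "f \<in> Mor T A" using f XC E_in_A[OF gE] by (simp add: Mor_iff)
  moreover have "Cod T f = Dom T (Sh T k \<cdot> last \<gamma>s)" using k f angle_ends[OF g(1)] by simp
  ultimately show ?thesis using phantom_comp by metis
qed

lemma neg_phantom:
  assumes "\<phi> \<in> phantoms E"
  shows "Neg T \<phi> \<in> phantoms E"
proof -
  note a = phantom_ar[OF assms]
  have "\<phi> \<cdot> Neg T (Id T (Dom T \<phi>)) \<in> phantoms E"
    by (rule phantom_comp[OF assms]) (use a in \<open>auto simp: Mor_iff\<close>)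
  then show ?thesis using a by simp
qed

text \<open>The passage back from phantoms to structures. N2 and N3 correspond to the two kinds of
  composition, and closure under direct sums follows from the diagonal form in
  \<open>direct_sum_last\<close>.\<close>

lemma substructure:
  assumes sub: "P \<subseteq> phantoms E"
    and comp: "\<And>\<phi> f. \<phi> \<in> P \<Longrightarrow> f \<in> Mor T A \<Longrightarrow> Cod T f = Dom T \<phi> \<Longrightarrow> \<phi> \<cdot> f \<in> P"
    and shcomp: "\<And>\<phi> g. \<phi> \<in> P \<Longrightarrow> g \<in> Mor T A \<Longrightarrow> Cod T \<phi> = ShOb T (Dom T g) \<Longrightarrow> Sh T g \<cdot> \<phi> \<in> P"
    and zero: "\<And>X C. X \<in> A \<Longrightarrow> C \<in> A \<Longrightarrow> Zero T C (ShOb T X) \<in> P"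
    and plus: "\<And>\<phi> \<psi>. \<phi> \<in> P \<Longrightarrow> \<psi> \<in> P \<Longrightarrow> Dom T \<phi> = Dom T \<psi> \<Longrightarrow> Cod T \<phi> = Cod T \<psi> \<Longrightarrow> \<phi> \<oplus> \<psi> \<in> P"
  defines "H \<equiv> {\<alpha>s \<in> E. last \<alpha>s \<in> P}"
  shows "almost_exact_structure T A H" "phantoms H = P"
proof -
  show "phantoms H = P"
    using sub by (auto simp: H_def phantoms_def)
  show "almost_exact_structure T A H"
    unfolding almost_exact_structure_def
  proof (intro conjI ballI allI impI)
    show "H \<subseteq> angles_in T A" using E_subset by (auto simp: H_def)
  next
    fix \<alpha>s \<beta>s \<gamma>s assume h: "\<alpha>s \<in> H" "\<beta>s \<in> H" and g: "\<gamma>s \<in> Ang T" "seq_direct_sum T \<alpha>s \<beta>s \<gamma>s"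
    then have a: "\<alpha>s \<in> E" "last \<alpha>s \<in> P" and b: "\<beta>s \<in> E" "last \<beta>s \<in> P" by (auto simp: H_def)
    have gE: "\<gamma>s \<in> E" using E_direct_sum a b g by blast
    obtain i\<^sub>1 i\<^sub>2 p\<^sub>1 p\<^sub>2 j\<^sub>1 j\<^sub>2 q\<^sub>1 q\<^sub>2 where
      p: "biproduct T (Dom T (hd \<alpha>s)) (Dom T (hd \<beta>s)) (Dom T (hd \<gamma>s)) i\<^sub>1 i\<^sub>2 p\<^sub>1 p\<^sub>2" and
      q: "biproduct T (Dom T (last \<alpha>s)) (Dom T (last \<beta>s)) (Dom T (last \<gamma>s)) j\<^sub>1 j\<^sub>2 q\<^sub>1 q\<^sub>2" and
      last: "last \<gamma>s = Sh T i\<^sub>1 \<cdot> (last \<alpha>s \<cdot> q\<^sub>1) \<oplus> Sh T i\<^sub>2 \<cdot> (last \<beta>s \<cdot> q\<^sub>2)"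
      by (rule direct_sum_last[OF g(2) E_angle[OF a(1)] E_angle[OF b(1)] g(1)])
    note p = p[unfolded biproduct_def Hom_iff] and q = q[unfolded biproduct_def Hom_iff]
    note e = angle_ends[OF E_angle[OF a(1)]] angle_ends[OF E_angle[OF b(1)]]
      and i = E_in_A[OF a(1)] E_in_A[OF b(1)] E_in_A[OF gE]
    have "last \<alpha>s \<cdot> q\<^sub>1 \<in> P" "last \<beta>s \<cdot> q\<^sub>2 \<in> P"
      by (rule comp; use a b p q i in \<open>simp add: Mor_iff\<close>)+
    then have "Sh T i\<^sub>1 \<cdot> (last \<alpha>s \<cdot> q\<^sub>1) \<in> P" "Sh T i\<^sub>2 \<cdot> (last \<beta>s \<cdot> q\<^sub>2) \<in> P"
      by - (rule shcomp; use a b p q i e in \<open>simp add: Mor_iff\<close>)+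
    then have "last \<gamma>s \<in> P"
      unfolding last by (rule plus) (use p q e in simp_all)
    then show "\<gamma>s \<in> H" using gE by (simp add: H_def)
  next
    fix \<alpha>s assume a: "\<alpha>s \<in> angles_in T A" "split_angle T \<alpha>s"
    then have E: "\<alpha>s \<in> E" by (rule E_split)
    have "last \<alpha>s = Zero T (Dom T (last \<alpha>s)) (Cod T (last \<alpha>s))" using a(2) by (simp add: split_angle_def)
    also have "\<dots> \<in> P" using zero E_in_A[OF E] angle_ends[OF E_angle[OF E]] by simp
    finally show "\<alpha>s \<in> H" using E by (simp add: H_def)
  next
    fix \<alpha>s f \<beta>s \<phi>s
    assume "\<alpha>s \<in> H" "f \<in> Mor T A" "\<beta>s \<in> Ang T"
      and c: "Cod T f = Dom T (last \<alpha>s) \<and> Dom T (hd \<beta>s) = Dom T (hd \<alpha>s) \<and>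
        last \<beta>s = last \<alpha>s \<cdot> f \<and> seq_morphism T \<phi>s \<beta>s \<alpha>s \<and>
        hd \<phi>s = Id T (Dom T (hd \<alpha>s)) \<and> last \<phi>s = f"
    then have "\<beta>s \<in> E" "last \<beta>s \<in> P" using E_pullback comp by (auto simp: H_def)
    then show "\<beta>s \<in> H" by (simp add: H_def)
  next
    fix \<alpha>s g \<beta>s \<phi>s
    assume h: "\<alpha>s \<in> H" "g \<in> Mor T A" "\<beta>s \<in> Ang T"
      and c: "Dom T g = Dom T (hd \<alpha>s) \<and> Dom T (last \<beta>s) = Dom T (last \<alpha>s) \<and>
        last \<beta>s = Sh T g \<cdot> last \<alpha>s \<and> seq_morphism T \<phi>s \<alpha>s \<beta>s \<and>
        hd \<phi>s = g \<and> last \<phi>s = Id T (Dom T (last \<alpha>s))"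
    have "Cod T (last \<alpha>s) = ShOb T (Dom T g)"
      using h c angle_ends[OF E_angle, of \<alpha>s] by (auto simp: H_def)
    then have "\<beta>s \<in> E" "last \<beta>s \<in> P" using h c E_pushout shcomp by (auto simp: H_def)
    then show "\<beta>s \<in> H" by (simp add: H_def)
  qed
qed

section \<open>Injectives, projectives and universal phantoms\<close>

lemma injectives_iff:
  "g \<in> injectives T A E \<longleftrightarrow> g \<in> Mor T A \<and>
    (\<forall>\<phi>\<in>phantoms E. Cod T \<phi> = ShOb T (Dom T g) \<longrightarrow> Sh T g \<cdot> \<phi> = Zero T (Dom T \<phi>) (ShOb T (Cod T g)))"
proof -
  have "(\<exists>h\<in>Hom T (Cod T (hd \<alpha>s)) (Cod T g). g = h \<cdot> hd \<alpha>s) \<longleftrightarrow>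
      Sh T g \<cdot> last \<alpha>s = Zero T (Dom T (last \<alpha>s)) (ShOb T (Cod T g))"
    if "\<alpha>s \<in> E" "g \<in> Mor T A" "Dom T (hd \<alpha>s) = Dom T g" for \<alpha>s
    using inflation_factor[OF E_angle[OF that(1)], of g] that by (simp add: Mor_iff)
  moreover have "Dom T (hd \<alpha>s) = Dom T g \<longleftrightarrow> Cod T (last \<alpha>s) = ShOb T (Dom T g)"
    if "\<alpha>s \<in> E" "g \<in> Mor T A" for \<alpha>s
    using angle_ends[OF E_angle[OF that(1)]] that by (simp add: Mor_iff)
  ultimately show ?thesis
    by (auto simp: injectives_def inflations_def phantoms_def)
qed

lemma deflations_eq: "deflations E = (\<lambda>\<alpha>s. \<alpha>s ! (n - 2)) ` E"
  using angle_length E_angle by (auto simp: deflations_def)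

lemma projectives_iff:
  "f \<in> projectives T A E \<longleftrightarrow> f \<in> Mor T A \<and>
    (\<forall>\<phi>\<in>phantoms E. Dom T \<phi> = Cod T f \<longrightarrow> \<phi> \<cdot> f = Zero T (Dom T f) (Cod T \<phi>))"
proof -
  have "(\<exists>h\<in>Hom T (Dom T f) (Dom T (\<alpha>s ! (n - 2))). f = \<alpha>s ! (n - 2) \<cdot> h) \<longleftrightarrow>
      last \<alpha>s \<cdot> f = Zero T (Dom T f) (Cod T (last \<alpha>s))"
    if "\<alpha>s \<in> E" "f \<in> Mor T A" "Dom T (last \<alpha>s) = Cod T f" for \<alpha>s
    using deflation_factor[OF E_angle[OF that(1)], of f] that angle_ends[OF E_angle[OF that(1)]]
    by (simp add: Mor_iff)
  moreover have "Cod T (\<alpha>s ! (n - 2)) = Dom T (last \<alpha>s)"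
    if "\<alpha>s \<in> E" for \<alpha>s
    using angle_ends[OF E_angle[OF that]] by simp
  ultimately show ?thesis
    by (auto simp: projectives_def deflations_eq phantoms_def)
qed

text \<open>Take the last arrow of an angle in \<open>E\<close> that starts with an injective
  inflation from \<open>X\<close>. The shift of this inflation kills every phantom ending at the
  shift of \<open>X\<close>, so \<open>last_factor\<close> provides the factorisation.\<close>

lemma ex_universal_phantom_to:
  assumes "enough_injectives T A E" "X \<in> A"
  obtains \<phi> where "\<phi> \<in> phantoms E" "Cod T \<phi> = ShOb T X"
    "\<And>\<psi>. \<psi> \<in> phantoms E \<Longrightarrow> Cod T \<psi> = ShOb T X \<Longrightarrow> \<exists>h\<in>Hom T (Dom T \<psi>) (Dom T \<phi>). \<psi> = \<phi> \<cdot> h"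
proof -
  obtain \<alpha>s where a: "\<alpha>s \<in> E" "Dom T (hd \<alpha>s) = X" "hd \<alpha>s \<in> injectives T A E"
  proof -
    obtain e where e: "e \<in> inflations E" "Dom T e = X" "e \<in> injectives T A E"
      using assms unfolding enough_injectives_def by blast
    obtain \<alpha>s where "\<alpha>s \<in> E" "e = hd \<alpha>s" using e(1) unfolding inflations_def by (rule imageE)
    then show ?thesis using e that by simp
  qed
  note e = angle_ends[OF E_angle[OF a(1)]]
  show ?thesis
  proof (rule that[of "last \<alpha>s"])
    show "last \<alpha>s \<in> phantoms E" by (rule phantomI[OF a(1) refl])
    show "Cod T (last \<alpha>s) = ShOb T X" using e a by simp
    fix \<psi> assume p: "\<psi> \<in> phantoms E" "Cod T \<psi> = ShOb T X"
    then show "\<exists>h\<in>Hom T (Dom T \<psi>) (Dom T (last \<alpha>s)). \<psi> = last \<alpha>s \<cdot> h"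
      using injectives_iff[THEN iffD1, OF a(3)] a(2) phantom_ar(1)[OF p(1)]
      by (intro last_factor[OF E_angle[OF a(1)]]) simp_all
  qed
qed

text \<open>Dually, take the last arrow of an angle with a projective deflation to \<open>C\<close>.
  Phantoms leaving \<open>C\<close> kill the deflation and hence factor by
  \<open>last_factor_left\<close>.\<close>

lemma ex_universal_phantom_from:
  assumes "enough_projectives T A E" "C \<in> A"
  obtains \<phi> where "\<phi> \<in> phantoms E" "Dom T \<phi> = C"
    "\<And>\<psi>. \<psi> \<in> phantoms E \<Longrightarrow> Dom T \<psi> = C \<Longrightarrow>
      \<exists>k\<in>Mor T A. Cod T \<phi> = ShOb T (Dom T k) \<and> \<psi> = Sh T k \<cdot> \<phi>"
proof -
  obtain \<alpha>s where a: "\<alpha>s \<in> E" "Cod T (\<alpha>s ! (n - 2)) = C" "\<alpha>s ! (n - 2) \<in> projectives T A E"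
  proof -
    obtain e where e: "e \<in> deflations E" "Cod T e = C" "e \<in> projectives T A E"
      using assms unfolding enough_projectives_def by blast
    obtain \<alpha>s where "\<alpha>s \<in> E" "e = \<alpha>s ! (n - 2)" using e(1) unfolding deflations_eq by (rule imageE)
    then show ?thesis using e that by simp
  qed
  note e = angle_ends[OF E_angle[OF a(1)]]
  show ?thesis
  proof (rule that[of "last \<alpha>s"])
    show "last \<alpha>s \<in> phantoms E" by (rule phantomI[OF a(1) refl])
    show "Dom T (last \<alpha>s) = C" using e a by simp
    fix \<psi> assume p: "\<psi> \<in> phantoms E" "Dom T \<psi> = C"
    note pa = phantom_ar[OF p(1)]
    obtain X where X: "X \<in> A" "Cod T \<psi> = ShOb T X" using pa by blast
    have "\<psi> \<cdot> \<alpha>s ! (n - 2) = Zero T (Dom T (\<alpha>s ! (n - 2))) (ShOb T X)"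
      using projectives_iff[THEN iffD1, OF a(3)] a(2) p X by simp
    then obtain k where "k \<in> Hom T (Dom T (hd \<alpha>s)) X" "\<psi> = Sh T k \<cdot> last \<alpha>s"
      using last_factor_left[OF E_angle[OF a(1)] pa(1) _ X(2)] X p a e by auto
    then show "\<exists>k\<in>Mor T A. Cod T (last \<alpha>s) = ShOb T (Dom T k) \<and> \<psi> = Sh T k \<cdot> last \<alpha>s"
      using X E_in_A[OF a(1)] e by (intro bexI[of _ k]) (auto simp: Hom_iff Mor_iff)
  qed
qed

text \<open>Shifting the defining condition once removes \<open>unshift\<close>; every phantom is
  the shift of some arrow, so nothing is lost.\<close>

lemma Phi_upper_iff:
  "g \<in> Phi_upper T A E F \<longleftrightarrow> g \<in> Mor T A \<and>
    (\<forall>\<phi>\<in>phantoms E. Cod T \<phi> = ShOb T (Dom T g) \<longrightarrow> Sh T g \<cdot> \<phi> \<in> phantoms F)"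
proof (cases "g \<in> Mor T A")
  case True
  then have g: "g \<in> Ar T" by (simp add: Mor_iff)
  have "(\<forall>h\<in>unshift T (phantoms E). Cod T h = Dom T g \<longrightarrow> g \<cdot> h \<in> unshift T (phantoms F)) \<longleftrightarrow>
    (\<forall>\<phi>\<in>phantoms E. Cod T \<phi> = ShOb T (Dom T g) \<longrightarrow> Sh T g \<cdot> \<phi> \<in> phantoms F)" (is "?L \<longleftrightarrow> ?R")
  proof
    assume L: ?L
    show ?R
    proof (intro ballI impI)
      fix \<phi> assume p: "\<phi> \<in> phantoms E" "Cod T \<phi> = ShOb T (Dom T g)"
      obtain h where h: "h \<in> Ar T" "Sh T h = \<phi>" using phantom_ar[OF p(1)] ex_unshift by blast
      have "ShOb T (Cod T h) = ShOb T (Dom T g)" using sh_simps[OF h(1)] h(2) p(2) by simp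
      then have c: "Cod T h = Dom T g" using h(1) g by simp
      have "Sh T (g \<cdot> h) \<in> phantoms F" using L h p c by (simp add: unshift_def del: sh_comp_ar)
      then show "Sh T g \<cdot> \<phi> \<in> phantoms F" using h c g by simp
    qed
  next
    assume ?R
    then show ?L using g by (auto simp: unshift_def)
  qed
  then show ?thesis using True by (simp add: Phi_upper_def)
qed (simp add: Phi_upper_def)

lemma Phi_lower_iff:
  "f \<in> Phi_lower T A E F \<longleftrightarrow> f \<in> Mor T A \<and>
    (\<forall>\<phi>\<in>phantoms E. Dom T \<phi> = Cod T f \<longrightarrow> \<phi> \<cdot> f \<in> phantoms F)"
  by (simp add: Phi_lower_def)

end

section \<open>Special precovers and preenvelopes\<close>

locale cotorsion_pair = exact_structure n T A E
  for n :: nat and T :: "('o, 'm, 'z) ncat_scheme" (structure)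
    and A :: "'o set" and E :: "'m list set" +
  fixes I J :: "'m set"
  assumes cotorsion: "ideal_cotorsion_pair T A E I J"
begin

lemma left_eq: "I = left_perp T A E J" and right_eq: "J = right_perp T A E I"
  and ideal_I: "ideal_in T A I" and ideal_J: "ideal_in T A J"
  using cotorsion unfolding ideal_cotorsion_pair_def by blast+

lemma orthogonal_iff:
  assumes "f \<in> Mor T A" "g \<in> Mor T A"
  shows "orthogonal T E f g \<longleftrightarrow>
    (\<forall>\<phi>\<in>phantoms E. Dom T \<phi> = Cod T f \<longrightarrow> Cod T \<phi> = ShOb T (Dom T g) \<longrightarrow>
      Sh T g \<cdot> (\<phi> \<cdot> f) = Zero T (Dom T f) (ShOb T (Cod T g)))"
proof -
  have "(Sh T g \<cdot> \<phi>) \<cdot> f = Sh T g \<cdot> (\<phi> \<cdot> f)"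
    if "\<phi> \<in> phantoms E" "Dom T \<phi> = Cod T f" "Cod T \<phi> = ShOb T (Dom T g)" for \<phi>
    using that assms phantom_ar(1)[OF that(1)] by (simp add: Mor_iff)
  then show ?thesis
    unfolding orthogonal_def using phantom_ar(1) by (auto simp: Hom_iff)
qed

lemma I_mor: "f \<in> I \<Longrightarrow> f \<in> Mor T A" and J_mor: "g \<in> J \<Longrightarrow> g \<in> Mor T A"
  using ideal_I ideal_J unfolding ideal_in_def by blast+

lemma I_comp: "f \<in> I \<Longrightarrow> g \<in> Mor T A \<Longrightarrow> Dom T g = Cod T f \<Longrightarrow> g \<cdot> f \<in> I"
  and J_comp: "f \<in> J \<Longrightarrow> g \<in> Mor T A \<Longrightarrow> Cod T g = Dom T f \<Longrightarrow> f \<cdot> g \<in> J"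
  using ideal_I ideal_J unfolding ideal_in_def by blast+

lemma I_iff:
  "f \<in> I \<longleftrightarrow> f \<in> Mor T A \<and> (\<forall>g\<in>J. \<forall>\<phi>\<in>phantoms E. Dom T \<phi> = Cod T f \<longrightarrow> Cod T \<phi> = ShOb T (Dom T g) \<longrightarrow>
      Sh T g \<cdot> (\<phi> \<cdot> f) = Zero T (Dom T f) (ShOb T (Cod T g)))"
proof -
  have "f \<in> I \<longleftrightarrow> f \<in> Mor T A \<and> (\<forall>g\<in>J. orthogonal T E f g)"
    by (subst left_eq) (simp add: left_perp_def)
  then show ?thesis using orthogonal_iff J_mor by blast
qed

lemma J_iff:
  "g \<in> J \<longleftrightarrow> g \<in> Mor T A \<and> (\<forall>f\<in>I. \<forall>\<phi>\<in>phantoms E. Dom T \<phi> = Cod T f \<longrightarrow> Cod T \<phi> = ShOb T (Dom T g) \<longrightarrow>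
      Sh T g \<cdot> (\<phi> \<cdot> f) = Zero T (Dom T f) (ShOb T (Cod T g)))"
proof -
  have "g \<in> J \<longleftrightarrow> g \<in> Mor T A \<and> (\<forall>f\<in>I. orthogonal T E f g)"
    by (subst right_eq) (simp add: right_perp_def)
  then show ?thesis using orthogonal_iff I_mor by blast
qed

lemma orthogonalD:
  assumes "f \<in> I" "g \<in> J" "\<phi> \<in> phantoms E" "Dom T \<phi> = Cod T f" "Cod T \<phi> = ShOb T (Dom T g)"
  shows "Sh T g \<cdot> (\<phi> \<cdot> f) = Zero T (Dom T f) (ShOb T (Cod T g))"
  using assms I_iff by blast

text \<open>For \<open>m\<close> in \<open>I\<close>, the composite of \<open>m\<close> with any
  phantom to the shift of \<open>X\<close> factors through \<open>\<phi> \<cdot> i\<close>: first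
  the phantom factors through \<open>\<phi>\<close>, then the resulting arrow of \<open>I\<close>
  through the precover \<open>i\<close>. So the shift of the first arrow \<open>j\<close> kills it,
  and \<open>j\<close> lies in \<open>J\<close>.\<close>

lemma special_preenveloping_if_precovering:
  assumes inj: "enough_injectives T A E" and pre: "precovering T A I"
  shows "special_preenveloping T A E J"
  unfolding special_preenveloping_def
proof
  fix X assume X: "X \<in> A"
  obtain \<phi> where \<phi>: "\<phi> \<in> phantoms E" "Cod T \<phi> = ShOb T X" and
    univ: "\<And>\<psi>. \<psi> \<in> phantoms E \<Longrightarrow> Cod T \<psi> = ShOb T X \<Longrightarrow> \<exists>h\<in>Hom T (Dom T \<psi>) (Dom T \<phi>). \<psi> = \<phi> \<cdot> h"
    using ex_universal_phantom_to[OF inj X] by metis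
  note \<phi>a = phantom_ar[OF \<phi>(1)]
  obtain i where "precover T I (Dom T \<phi>) i"
    using pre \<phi>a(2) unfolding precovering_def by blast
  then have i: "i \<in> I" "Cod T i = Dom T \<phi>"
    and cover: "\<And>f. f \<in> I \<Longrightarrow> Cod T f = Dom T \<phi> \<Longrightarrow> \<exists>h\<in>Hom T (Dom T f) (Dom T i). f = i \<cdot> h"
    unfolding precover_def by simp_all
  note ia = I_mor[OF i(1), unfolded Mor_iff]
  have \<phi>i: "\<phi> \<cdot> i \<in> phantoms E" using phantom_comp[OF \<phi>(1) I_mor[OF i(1)] i(2)] .
  obtain \<alpha>s where a: "\<alpha>s \<in> Ang T" "last \<alpha>s = \<phi> \<cdot> i" "Dom T (hd \<alpha>s) = X"
    by (rule ex_angle_last[of "\<phi> \<cdot> i" X, OF _ _ _ that]) (use \<phi> \<phi>a i ia X in simp_all)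
  have aE: "\<alpha>s \<in> E" using E_memI[OF a(1)] a(2) \<phi>i by simp
  note e = angle_ends[OF a(1)]
  define j where "j = hd \<alpha>s"
  have j: "j \<in> Mor T A" "Dom T j = X" using e E_in_A[OF aE] a by (simp_all add: Mor_iff j_def)
  have jz: "Sh T j \<cdot> (\<phi> \<cdot> i) = Zero T (Dom T i) (ShOb T (Cod T j))"
    using sh_hd_comp_last[OF a(1)] a(2) \<phi>a i ia by (simp add: j_def)
  have "j \<in> J"
    unfolding J_iff
  proof (intro conjI ballI impI j(1))
    fix m \<psi> assume m: "m \<in> I" and \<psi>: "\<psi> \<in> phantoms E" "Dom T \<psi> = Cod T m" "Cod T \<psi> = ShOb T (Dom T j)"
    note ma = I_mor[OF m, unfolded Mor_iff]
    obtain h where h: "h \<in> Hom T (Dom T \<psi>) (Dom T \<phi>)" "\<psi> = \<phi> \<cdot> h" using univ \<psi> j(2) by metis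
    then have ha: "h \<in> Ar T" "Dom T h = Cod T m" "Cod T h = Dom T \<phi>" using \<psi> by (auto simp: Hom_iff)
    have "h \<cdot> m \<in> I" by (rule I_comp[OF m]) (use ha \<phi>a ma in \<open>auto simp: Mor_iff\<close>)
    then obtain k where k: "k \<in> Hom T (Dom T m) (Dom T i)" "h \<cdot> m = i \<cdot> k"
      using cover[of "h \<cdot> m"] ha ma by auto
    have ka: "k \<in> Ar T" "Dom T k = Dom T m" "Cod T k = Dom T i" using k by (auto simp: Hom_iff)
    have "\<psi> \<cdot> m = \<phi> \<cdot> (h \<cdot> m)" unfolding h(2) using ha ma \<phi>a by simp
    also have "\<dots> = (\<phi> \<cdot> i) \<cdot> k" unfolding k(2) using ka ia i \<phi>a by simp
    finally have "Sh T j \<cdot> (\<psi> \<cdot> m) = (Sh T j \<cdot> (\<phi> \<cdot> i)) \<cdot> k"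
      using ka ia i \<phi>a \<phi> j by (simp add: Mor_iff)
    then show "Sh T j \<cdot> (\<psi> \<cdot> m) = Zero T (Dom T m) (ShOb T (Cod T j))"
      unfolding jz using ka j by (simp add: Mor_iff)
  qed
  \<comment> \<open>The angle was chosen to end in \<open>\<phi> \<cdot> i\<close>, with
    \<open>i\<close> in \<open>I\<close>, the left orthogonal of \<open>J\<close>; this is exactly
    the special factorisation.\<close>
  then have "special_preenvelope T A E J X j"
    unfolding special_preenvelope_def
    using j(2) a(1,2) i \<phi> \<phi>a ia e left_eq
    by (intro conjI bexI[of _ \<alpha>s] bexI[of _ i] bexI[of _ \<phi>]) (simp_all add: j_def Hom_iff)
  then show "\<exists>j. special_preenvelope T A E J X j" by blast
qed

text \<open>The dual construction. The universal phantom now leaves \<open>C\<close>, and it is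
  followed by the shift of a preenvelope of the object whose shift is its codomain. The deflation of
  an angle ending in that composite is the special precover.\<close>

lemma special_precovering_if_preenveloping:
  assumes proj: "enough_projectives T A E" and pre: "preenveloping T A J"
  shows "special_precovering T A E I"
  unfolding special_precovering_def
proof
  fix C assume C: "C \<in> A"
  obtain \<phi> where \<phi>: "\<phi> \<in> phantoms E" "Dom T \<phi> = C" and
    univ: "\<And>\<psi>. \<psi> \<in> phantoms E \<Longrightarrow> Dom T \<psi> = C \<Longrightarrow>
      \<exists>k\<in>Mor T A. Cod T \<phi> = ShOb T (Dom T k) \<and> \<psi> = Sh T k \<cdot> \<phi>"
    using ex_universal_phantom_from[OF proj C] by metis
  note \<phi>a = phantom_ar[OF \<phi>(1)]
  obtain K where K: "K \<in> A" "Cod T \<phi> = ShOb T K" using \<phi>a by blast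
  obtain j where "preenvelope T J K j"
    using pre K unfolding preenveloping_def by blast
  then have j: "j \<in> J" "Dom T j = K"
    and env: "\<And>g. g \<in> J \<Longrightarrow> Dom T g = K \<Longrightarrow> \<exists>h\<in>Hom T (Cod T j) (Cod T g). g = h \<cdot> j"
    unfolding preenvelope_def by simp_all
  note ja = J_mor[OF j(1), unfolded Mor_iff]
  have j\<phi>: "Sh T j \<cdot> \<phi> \<in> phantoms E" using sh_comp_phantom[OF \<phi>(1) J_mor[OF j(1)]] j K by simp
  obtain \<alpha>s where a: "\<alpha>s \<in> Ang T" "last \<alpha>s = Sh T j \<cdot> \<phi>" "Dom T (hd \<alpha>s) = Cod T j"
    by (rule ex_angle_last[of "Sh T j \<cdot> \<phi>" "Cod T j", OF _ _ _ that]) (use \<phi> \<phi>a j ja K in simp_all)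
  have aE: "\<alpha>s \<in> E" using E_memI[OF a(1)] a(2) j\<phi> by simp
  note e = angle_ends[OF a(1)]
  have dl: "Dom T (last \<alpha>s) = C" using a(2) \<phi> \<phi>a j ja K by simp
  define i where "i = \<alpha>s ! (n - 2)"
  have i: "i \<in> Mor T A" "Cod T i = C" using e E_in_A[OF aE] dl C by (simp_all add: Mor_iff i_def)
  have iz: "Sh T j \<cdot> (\<phi> \<cdot> i) = Zero T (Dom T i) (ShOb T (Cod T j))"
    using last_comp_penultimate[OF a(1)] a(2,3) \<phi> \<phi>a j ja K i by (simp add: i_def Mor_iff)
  have "i \<in> I"
    unfolding I_iff
  proof (intro conjI ballI impI i(1))
    fix g \<psi> assume g: "g \<in> J" and \<psi>: "\<psi> \<in> phantoms E" "Dom T \<psi> = Cod T i" "Cod T \<psi> = ShOb T (Dom T g)"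
    note ga = J_mor[OF g, unfolded Mor_iff]
    obtain k where k: "k \<in> Mor T A" "Cod T \<phi> = ShOb T (Dom T k)" "\<psi> = Sh T k \<cdot> \<phi>" using univ \<psi> i(2) by metis
    have "ShOb T (Cod T k) = ShOb T (Dom T g)" using \<psi>(3) k \<phi>a by (simp add: Mor_iff)
    then have ka: "k \<in> Ar T" "Dom T k = K" "Cod T k = Dom T g" using k K ga by (auto simp: Mor_iff)
    have "g \<cdot> k \<in> J" by (rule J_comp[OF g k(1) ka(3)])
    then obtain h where h: "h \<in> Hom T (Cod T j) (Cod T g)" "g \<cdot> k = h \<cdot> j"
      using env[of "g \<cdot> k"] ka ga by auto
    have ha: "h \<in> Ar T" "Dom T h = Cod T j" "Cod T h = Cod T g" using h by (auto simp: Hom_iff)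
    \<comment> \<open>\<open>\<psi>\<close> is written through \<open>\<phi>\<close>, and then
      \<open>g \<cdot> k\<close> through the preenvelope \<open>j\<close>; what remains contains the
      composite that vanishes by \<open>iz\<close>.\<close>
    have "Sh T g \<cdot> (\<psi> \<cdot> i) = Sh T (g \<cdot> k) \<cdot> (\<phi> \<cdot> i)"
      unfolding k(3) using ka ga \<phi> \<phi>a i K by (simp add: Mor_iff)
    also have "\<dots> = Sh T h \<cdot> (Sh T j \<cdot> (\<phi> \<cdot> i))"
      unfolding h(2) using ha ja j \<phi> \<phi>a i K by (simp add: Mor_iff)
    finally show "Sh T g \<cdot> (\<psi> \<cdot> i) = Zero T (Dom T i) (ShOb T (Cod T g))"
      unfolding iz using ha i by (simp add: Mor_iff)
  qed
  then have "special_precover T A E I C i"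
    unfolding special_precover_def angle_length[OF a(1)]
    using i(2) a j \<phi> \<phi>a ja e K right_eq angle_length[OF a(1)]
    by (intro conjI bexI[of _ \<alpha>s] bexI[of _ j] bexI[of _ \<phi>]) (simp_all add: i_def Hom_iff)
  then show "\<exists>i. special_precover T A E I C i" by blast
qed

text \<open>The last arrow is a phantom precomposed with an arrow of \<open>I\<close>, so the shift
  of any \<open>g\<close> in \<open>J\<close> kills it, and \<open>inflation_factor\<close> yields
  the factorisation.\<close>

lemma preenveloping_if_special:
  assumes "special_preenveloping T A E J"
  shows "preenveloping T A J"
  unfolding preenveloping_def
proof
  fix X assume "X \<in> A"
  then obtain j where "special_preenvelope T A E J X j" using assms unfolding special_preenveloping_def by blast
  then obtain \<alpha>s i \<phi> where j: "j \<in> J" "Dom T j = X" and a: "\<alpha>s \<in> Ang T" "hd \<alpha>s = j"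
    and i: "i \<in> I" "\<phi> \<in> phantoms E" "Dom T i = Dom T (last \<alpha>s)"
    "\<phi> \<in> Hom T (Cod T i) (ShOb T X)" "last \<alpha>s = \<phi> \<cdot> i"
    unfolding special_preenvelope_def left_eq[symmetric] by blast
  have "\<exists>h\<in>Hom T (Cod T j) (Cod T g). g = h \<cdot> j" if g: "g \<in> J" "Dom T g = X" for g
  proof -
    have "Sh T g \<cdot> last \<alpha>s = Zero T (Dom T i) (ShOb T (Cod T g))"
      unfolding i(5) by (rule orthogonalD[OF i(1) g(1) i(2)]) (use i(4) g(2) in \<open>auto simp: Hom_iff\<close>)
    then show ?thesis
      using inflation_factor[OF a(1), of g] J_mor[OF g(1)] i(3) a(2) g(2) j(2) by (simp add: Mor_iff)
  qed
  then show "\<exists>j. preenvelope T J X j" using j unfolding preenvelope_def by blast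
qed

text \<open>The same argument at the other end: the last arrow kills every arrow of \<open>I\<close>
  into \<open>X\<close>, and \<open>deflation_factor\<close> applies.\<close>

lemma precovering_if_special:
  assumes "special_precovering T A E I"
  shows "precovering T A I"
  unfolding precovering_def
proof
  fix X assume "X \<in> A"
  then obtain i where "special_precover T A E I X i" using assms unfolding special_precovering_def by blast
  then obtain \<alpha>s j \<phi> where i: "i \<in> I" "Cod T i = X" and a: "\<alpha>s \<in> Ang T" "\<alpha>s ! (length \<alpha>s - 2) = i"
    and j: "j \<in> J" "\<phi> \<in> phantoms E" "Cod T j = Dom T (hd \<alpha>s)"
    "\<phi> \<in> Hom T X (ShOb T (Dom T j))" "last \<alpha>s = Sh T j \<cdot> \<phi>"
    unfolding special_precover_def right_eq[symmetric] by blast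
  have a2: "\<alpha>s ! (n - 2) = i" using a angle_length[OF a(1)] by simp
  note ja = J_mor[OF j(1), unfolded Mor_iff] and pa = j(4)[unfolded Hom_iff]
  have "\<exists>h\<in>Hom T (Dom T f) (Dom T i). f = i \<cdot> h" if f: "f \<in> I" "Cod T f = X" for f
  proof -
    note fa = I_mor[OF f(1), unfolded Mor_iff]
    have "Sh T j \<cdot> (\<phi> \<cdot> f) = Zero T (Dom T f) (ShOb T (Cod T j))"
      by (rule orthogonalD[OF f(1) j(1,2)]) (use pa f(2) in auto)
    then have "last \<alpha>s \<cdot> f = Zero T (Dom T f) (ShOb T (Dom T (hd \<alpha>s)))"
      unfolding j(5) using ja pa fa f(2) j(3) by simp
    moreover have "Cod T f = Dom T (last \<alpha>s)" using angle_ends(5)[OF a(1)] a2 i f by simp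
    ultimately show ?thesis
      using deflation_factor[OF a(1), of f] fa a2 by simp
  qed
  then show "\<exists>i. precover T I X i" using i unfolding precover_def by blast
qed

end

section \<open>Structures attached to an ideal cotorsion pair\<close>

context cotorsion_pair
begin

text \<open>The largest class of phantoms of \<open>E\<close> relative to which all of
  \<open>J\<close> is injective.\<close>

definition phantoms_killed_by_J :: "'m set" where
  "phantoms_killed_by_J = {\<phi> \<in> phantoms E. \<forall>g\<in>J. Cod T \<phi> = ShOb T (Dom T g) \<longrightarrow>
     Sh T g \<cdot> \<phi> = Zero T (Dom T \<phi>) (ShOb T (Cod T g))}"

text \<open>The largest class of phantoms of \<open>E\<close> relative to which all of
  \<open>I\<close> is projective.\<close>

definition phantoms_killed_by_I :: "'m set" where
  "phantoms_killed_by_I = {\<phi> \<in> phantoms E. \<forall>f\<in>I. Dom T \<phi> = Cod T f \<longrightarrow>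
     \<phi> \<cdot> f = Zero T (Dom T f) (Cod T \<phi>)}"

definition structure_of_J :: "'m list set" where
  "structure_of_J = {\<alpha>s \<in> E. last \<alpha>s \<in> phantoms_killed_by_J}"

definition structure_of_I :: "'m list set" where
  "structure_of_I = {\<alpha>s \<in> E. last \<alpha>s \<in> phantoms_killed_by_I}"

text \<open>Stability under composition with \<Sigma>\<open>k\<close> comes from the ideal property:
  killing by \<open>g\<close> after \<open>k\<close> is killing by \<open>g \<cdot> k\<close>, which
  is again in \<open>J\<close>.\<close>

lemma structure_of_J:
  "almost_exact_structure T A structure_of_J" "phantoms structure_of_J = phantoms_killed_by_J"
proof -
  note K = phantoms_killed_by_J_def
  have sub: "phantoms_killed_by_J \<subseteq> phantoms E" by (auto simp: K)
  have comp: "\<phi> \<cdot> f \<in> phantoms_killed_by_J"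
    if "\<phi> \<in> phantoms_killed_by_J" "f \<in> Mor T A" "Cod T f = Dom T \<phi>" for \<phi> f
  proof -
    have \<phi>: "\<phi> \<in> phantoms E" using that sub by blast
    note a = phantom_ar(1)[OF \<phi>]
    have "Sh T g \<cdot> (\<phi> \<cdot> f) = Zero T (Dom T f) (ShOb T (Cod T g))"
      if g: "g \<in> J" "Cod T \<phi> = ShOb T (Dom T g)" for g
    proof -
      have "Sh T g \<cdot> (\<phi> \<cdot> f) = (Sh T g \<cdot> \<phi>) \<cdot> f"
        using a J_mor[OF g(1)] g(2) \<open>f \<in> Mor T A\<close> \<open>Cod T f = Dom T \<phi>\<close> by (simp add: Mor_iff)
      also have "Sh T g \<cdot> \<phi> = Zero T (Dom T \<phi>) (ShOb T (Cod T g))"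
        using \<open>\<phi> \<in> phantoms_killed_by_J\<close> g by (simp add: K)
      finally show ?thesis
        using J_mor[OF g(1)] \<open>f \<in> Mor T A\<close> \<open>Cod T f = Dom T \<phi>\<close> by (simp add: Mor_iff)
    qed
    then show ?thesis using phantom_comp[OF \<phi> that(2,3)] a that by (simp add: K Mor_iff)
  qed
  have shcomp: "Sh T k \<cdot> \<phi> \<in> phantoms_killed_by_J"
    if "\<phi> \<in> phantoms_killed_by_J" "k \<in> Mor T A" "Cod T \<phi> = ShOb T (Dom T k)" for \<phi> k
  proof -
    have \<phi>: "\<phi> \<in> phantoms E" using that sub by blast
    note a = phantom_ar(1)[OF \<phi>]
    have k: "k \<in> Ar T" using that by (simp add: Mor_iff)
    have "Sh T g \<cdot> (Sh T k \<cdot> \<phi>) = Zero T (Dom T \<phi>) (ShOb T (Cod T g))"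
      if g: "g \<in> J" "ShOb T (Cod T k) = ShOb T (Dom T g)" for g
    proof -
      have ga: "g \<in> Ar T" using J_mor[OF g(1)] by (simp add: Mor_iff)
      then have c: "Cod T k = Dom T g" using g(2) k by simp
      have "g \<cdot> k \<in> J" using J_comp[OF g(1) \<open>k \<in> Mor T A\<close> c] .
      then have "Sh T (g \<cdot> k) \<cdot> \<phi> = Zero T (Dom T \<phi>) (ShOb T (Cod T (g \<cdot> k)))"
        using \<open>\<phi> \<in> phantoms_killed_by_J\<close> \<open>Cod T \<phi> = ShOb T (Dom T k)\<close> ga k c
        by (simp add: K del: sh_comp_ar)
      then show ?thesis using ga k c a \<open>Cod T \<phi> = ShOb T (Dom T k)\<close> by simp
    qed
    then show ?thesis using sh_comp_phantom[OF \<phi> that(2,3)] a k that(3) by (simp add: K)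
  qed
  have zero: "Zero T C (ShOb T X) \<in> phantoms_killed_by_J" if "X \<in> A" "C \<in> A" for X C
    using zero_phantom[OF that] that J_mor by (auto simp: K Mor_iff)
  have plus: "\<phi> \<oplus> \<psi> \<in> phantoms_killed_by_J"
    if "\<phi> \<in> phantoms_killed_by_J" "\<psi> \<in> phantoms_killed_by_J" "Dom T \<phi> = Dom T \<psi>" "Cod T \<phi> = Cod T \<psi>" for \<phi> \<psi>
  proof -
    have P: "\<phi> \<in> phantoms E" "\<psi> \<in> phantoms E" using that sub by blast+
    note a = phantom_ar(1)[OF P(1)] phantom_ar(1)[OF P(2)]
    have "Sh T g \<cdot> (\<phi> \<oplus> \<psi>) = Zero T (Dom T \<psi>) (ShOb T (Cod T g))"
      if "g \<in> J" "Cod T \<psi> = ShOb T (Dom T g)" for g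
      using that J_mor[OF that(1)] a \<open>\<psi> \<in> phantoms_killed_by_J\<close> \<open>\<phi> \<in> phantoms_killed_by_J\<close>
        \<open>Dom T \<phi> = Dom T \<psi>\<close> \<open>Cod T \<phi> = Cod T \<psi>\<close> by (simp add: K Mor_iff)
    then show ?thesis using phantom_plus[OF P that(3,4)] a that(3,4) by (simp add: K)
  qed
  show "almost_exact_structure T A structure_of_J" "phantoms structure_of_J = phantoms_killed_by_J"
    unfolding structure_of_J_def using substructure[OF sub comp shcomp zero plus] by blast+
qed

text \<open>Here the ideal property enters on the other side, in precomposition with
  \<open>k\<close>, through \<open>k \<cdot> f\<close> in \<open>I\<close>.\<close>

lemma structure_of_I:
  "almost_exact_structure T A structure_of_I" "phantoms structure_of_I = phantoms_killed_by_I"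
proof -
  note K = phantoms_killed_by_I_def
  have sub: "phantoms_killed_by_I \<subseteq> phantoms E" by (auto simp: K)
  have comp: "\<phi> \<cdot> k \<in> phantoms_killed_by_I"
    if "\<phi> \<in> phantoms_killed_by_I" "k \<in> Mor T A" "Cod T k = Dom T \<phi>" for \<phi> k
  proof -
    have \<phi>: "\<phi> \<in> phantoms E" using that sub by blast
    note a = phantom_ar(1)[OF \<phi>]
    have k: "k \<in> Ar T" using that by (simp add: Mor_iff)
    have "(\<phi> \<cdot> k) \<cdot> f = Zero T (Dom T f) (Cod T \<phi>)"
      if f: "f \<in> I" "Dom T k = Cod T f" for f
    proof -
      have fa: "f \<in> Ar T" using I_mor[OF f(1)] by (simp add: Mor_iff)
      have "k \<cdot> f \<in> I" using I_comp[OF f(1) \<open>k \<in> Mor T A\<close> f(2)] .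
      then have "\<phi> \<cdot> (k \<cdot> f) = Zero T (Dom T (k \<cdot> f)) (Cod T \<phi>)"
        using \<open>\<phi> \<in> phantoms_killed_by_I\<close> \<open>Cod T k = Dom T \<phi>\<close> fa k f(2) by (simp add: K)
      then show ?thesis using fa k f(2) a \<open>Cod T k = Dom T \<phi>\<close> by simp
    qed
    then show ?thesis using phantom_comp[OF \<phi> that(2,3)] a k that(3) by (simp add: K)
  qed
  have shcomp: "Sh T g \<cdot> \<phi> \<in> phantoms_killed_by_I"
    if "\<phi> \<in> phantoms_killed_by_I" "g \<in> Mor T A" "Cod T \<phi> = ShOb T (Dom T g)" for \<phi> g
  proof -
    have \<phi>: "\<phi> \<in> phantoms E" using that sub by blast
    note a = phantom_ar(1)[OF \<phi>]
    have g: "g \<in> Ar T" using that by (simp add: Mor_iff)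
    have "(Sh T g \<cdot> \<phi>) \<cdot> f = Zero T (Dom T f) (ShOb T (Cod T g))"
      if f: "f \<in> I" "Dom T \<phi> = Cod T f" for f
    proof -
      have "(Sh T g \<cdot> \<phi>) \<cdot> f = Sh T g \<cdot> (\<phi> \<cdot> f)"
        using a I_mor[OF f(1)] f(2) g \<open>Cod T \<phi> = ShOb T (Dom T g)\<close> by (simp add: Mor_iff)
      also have "\<phi> \<cdot> f = Zero T (Dom T f) (Cod T \<phi>)"
        using \<open>\<phi> \<in> phantoms_killed_by_I\<close> f by (simp add: K)
      finally show ?thesis
        using I_mor[OF f(1)] g \<open>Cod T \<phi> = ShOb T (Dom T g)\<close> by (simp add: Mor_iff)
    qed
    then show ?thesis using sh_comp_phantom[OF \<phi> that(2,3)] a g that(3) by (simp add: K)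
  qed
  have zero: "Zero T C (ShOb T X) \<in> phantoms_killed_by_I" if "X \<in> A" "C \<in> A" for X C
    using zero_phantom[OF that] that I_mor by (auto simp: K Mor_iff)
  have plus: "\<phi> \<oplus> \<psi> \<in> phantoms_killed_by_I"
    if "\<phi> \<in> phantoms_killed_by_I" "\<psi> \<in> phantoms_killed_by_I" "Dom T \<phi> = Dom T \<psi>" "Cod T \<phi> = Cod T \<psi>" for \<phi> \<psi>
  proof -
    have P: "\<phi> \<in> phantoms E" "\<psi> \<in> phantoms E" using that sub by blast+
    note a = phantom_ar(1)[OF P(1)] phantom_ar(1)[OF P(2)]
    have "(\<phi> \<oplus> \<psi>) \<cdot> f = Zero T (Dom T f) (Cod T \<psi>)"
      if "f \<in> I" "Dom T \<psi> = Cod T f" for f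
      using that I_mor[OF that(1)] a \<open>\<psi> \<in> phantoms_killed_by_I\<close> \<open>\<phi> \<in> phantoms_killed_by_I\<close>
        \<open>Dom T \<phi> = Dom T \<psi>\<close> \<open>Cod T \<phi> = Cod T \<psi>\<close> by (simp add: K Mor_iff)
    then show ?thesis using phantom_plus[OF P that(3,4)] a that(3,4) by (simp add: K)
  qed
  show "almost_exact_structure T A structure_of_I" "phantoms structure_of_I = phantoms_killed_by_I"
    unfolding structure_of_I_def using substructure[OF sub comp shcomp zero plus] by blast+
qed

text \<open>That all composites \<open>\<phi> \<cdot> f\<close> are killed by \<open>J\<close> is
  orthogonality of \<open>f\<close> to \<open>J\<close> written out, and \<open>I\<close> is the
  left orthogonal of \<open>J\<close>.\<close>

lemma Phi_lower_structure_of_J: "Phi_lower T A E structure_of_J = I"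
proof -
  have "f \<in> Phi_lower T A E structure_of_J \<longleftrightarrow> f \<in> I" for f
  proof (cases "f \<in> Mor T A")
    case True
    have "\<phi> \<cdot> f \<in> phantoms_killed_by_J \<longleftrightarrow> (\<forall>g\<in>J. Cod T \<phi> = ShOb T (Dom T g) \<longrightarrow>
        Sh T g \<cdot> (\<phi> \<cdot> f) = Zero T (Dom T f) (ShOb T (Cod T g)))"
      if "\<phi> \<in> phantoms E" "Dom T \<phi> = Cod T f" for \<phi>
      using phantom_comp[OF that(1) True that(2)[symmetric]] phantom_ar(1)[OF that(1)] that True
      by (simp add: phantoms_killed_by_J_def Mor_iff)
    then show ?thesis
      unfolding Phi_lower_iff I_iff structure_of_J(2) using True by blast
  qed (simp add: Phi_lower_iff I_iff)
  then show ?thesis by blast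
qed

lemma Phi_upper_structure_of_I: "Phi_upper T A E structure_of_I = J"
proof -
  have "g \<in> Phi_upper T A E structure_of_I \<longleftrightarrow> g \<in> J" for g
  proof (cases "g \<in> Mor T A")
    case True
    have "Sh T g \<cdot> \<phi> \<in> phantoms_killed_by_I \<longleftrightarrow> (\<forall>f\<in>I. Dom T \<phi> = Cod T f \<longrightarrow>
        Sh T g \<cdot> (\<phi> \<cdot> f) = Zero T (Dom T f) (ShOb T (Cod T g)))"
      if p: "\<phi> \<in> phantoms E" "Cod T \<phi> = ShOb T (Dom T g)" for \<phi>
    proof -
      have "(Sh T g \<cdot> \<phi>) \<cdot> f = Sh T g \<cdot> (\<phi> \<cdot> f)" if "f \<in> I" "Dom T \<phi> = Cod T f" for f
        using that I_mor[OF that(1)] phantom_ar(1)[OF p(1)] p(2) True by (simp add: Mor_iff)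
      then show ?thesis
        using sh_comp_phantom[OF p(1) True p(2)] phantom_ar(1)[OF p(1)] p True
        by (simp add: phantoms_killed_by_I_def Mor_iff)
    qed
    then show ?thesis
      unfolding Phi_upper_iff J_iff structure_of_I(2) using True by blast
  qed (simp add: Phi_upper_iff J_iff)
  then show ?thesis by blast
qed

text \<open>One inclusion is the choice of the structure. For the other, the phantoms
  \<open>\<phi> \<cdot> f\<close> with \<open>f\<close> in \<open>I\<close> belong to it, so
  \<open>I\<close> is orthogonal to every injective.\<close>

lemma injectives_structure_of_J: "injectives T A structure_of_J = J"
proof -
  interpret H: exact_structure n T A structure_of_J
    by unfold_locales (rule ext_closed, rule structure_of_J)
  show ?thesis
  proof (intro equalityI subsetI)
    fix g assume g: "g \<in> injectives T A structure_of_J"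
    show "g \<in> J"
      unfolding J_iff
    proof (intro conjI ballI impI)
      show gM: "g \<in> Mor T A" using g H.injectives_iff by blast
      fix f \<phi> assume f: "f \<in> I" and p: "\<phi> \<in> phantoms E" "Dom T \<phi> = Cod T f" "Cod T \<phi> = ShOb T (Dom T g)"
      note fa = I_mor[OF f, unfolded Mor_iff]
      have "\<phi> \<cdot> f \<in> phantoms structure_of_J"
        using f p Phi_lower_structure_of_J Phi_lower_iff by blast
      then show "Sh T g \<cdot> (\<phi> \<cdot> f) = Zero T (Dom T f) (ShOb T (Cod T g))"
        using g[unfolded H.injectives_iff] phantom_ar(1)[OF p(1)] p fa by auto
    qed
  next
    fix g assume "g \<in> J"
    then show "g \<in> injectives T A structure_of_J"
      using J_mor unfolding H.injectives_iff structure_of_J(2) phantoms_killed_by_J_def by blast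
  qed
qed

lemma projectives_structure_of_I: "projectives T A structure_of_I = I"
proof -
  interpret G: exact_structure n T A structure_of_I
    by unfold_locales (rule ext_closed, rule structure_of_I)
  show ?thesis
  proof (intro equalityI subsetI)
    fix f assume f: "f \<in> projectives T A structure_of_I"
    show "f \<in> I"
      unfolding I_iff
    proof (intro conjI ballI impI)
      show fM: "f \<in> Mor T A" using f G.projectives_iff by blast
      fix g \<phi> assume g: "g \<in> J" and p: "\<phi> \<in> phantoms E" "Dom T \<phi> = Cod T f" "Cod T \<phi> = ShOb T (Dom T g)"
      note ga = J_mor[OF g, unfolded Mor_iff]
      note pa = phantom_ar(1)[OF p(1)]
      have "Sh T g \<cdot> \<phi> \<in> phantoms structure_of_I"
        using g p Phi_upper_structure_of_I Phi_upper_iff by blast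
      then have "(Sh T g \<cdot> \<phi>) \<cdot> f = Zero T (Dom T f) (ShOb T (Cod T g))"
        using f[unfolded G.projectives_iff] pa p ga by auto
      then show "Sh T g \<cdot> (\<phi> \<cdot> f) = Zero T (Dom T f) (ShOb T (Cod T g))"
        using pa p ga fM by (simp add: Mor_iff)
    qed
  next
    fix f assume "f \<in> I"
    then show "f \<in> projectives T A structure_of_I"
      using I_mor unfolding G.projectives_iff structure_of_I(2) phantoms_killed_by_I_def by blast
  qed
qed

text \<open>A special preenvelope ends its angle in \<open>\<phi> \<cdot> i\<close>, a phantom of
  the structure as \<open>i\<close> lies in \<open>Phi_lower\<close>. By \<open>F3_ends\<close> the
  identity and \<open>i\<close> extend to a morphism to an angle of \<open>E\<close> on
  \<open>\<phi>\<close>, as special injectivity asks.\<close>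

lemma enough_special_injectives_structure_of_J:
  assumes "special_preenveloping T A E J"
  shows "enough_special_injectives T A E structure_of_J"
  unfolding enough_special_injectives_def
proof
  fix X assume X: "X \<in> A"
  then obtain j where "special_preenvelope T A E J X j" using assms unfolding special_preenveloping_def by blast
  then obtain \<alpha>s i \<phi> where j: "j \<in> J" "Dom T j = X" and a: "\<alpha>s \<in> Ang T" "hd \<alpha>s = j"
    and i: "i \<in> I" "\<phi> \<in> phantoms E" "Dom T i = Dom T (last \<alpha>s)"
    "\<phi> \<in> Hom T (Cod T i) (ShOb T X)" "last \<alpha>s = \<phi> \<cdot> i"
    unfolding special_preenvelope_def left_eq[symmetric] by blast
  note ia = I_mor[OF i(1), unfolded Mor_iff] and pa = i(4)[unfolded Hom_iff]
  have "\<phi> \<cdot> i \<in> phantoms structure_of_J"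
    using i(1,2) pa Phi_lower_structure_of_J Phi_lower_iff by blast
  then have "last \<alpha>s \<in> phantoms_killed_by_J" using i(5) structure_of_J by simp
  moreover from this have "\<alpha>s \<in> E"
    using E_memI[OF a(1)] by (simp add: phantoms_killed_by_J_def)
  ultimately have inf: "j \<in> inflations structure_of_J"
    using a(2) by (auto simp: inflations_def structure_of_J_def)
  obtain \<beta>s where b: "\<beta>s \<in> E" "last \<beta>s = \<phi>" by (rule phantomE[OF i(2)])
  note eb = angle_ends[OF E_angle[OF b(1)]]
  have "ShOb T (Dom T (hd \<beta>s)) = ShOb T X" using eb(4) b(2) pa by simp
  then have bX: "Dom T (hd \<beta>s) = X" using eb(1) X by simp
  obtain \<phi>s where "seq_morphism T \<phi>s \<alpha>s \<beta>s" "hd \<phi>s = Id T X" "last \<phi>s = i"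
    by (rule F3_ends[OF a(1) E_angle[OF b(1)] _ _ _ that])
      (use X a(2) j(2) bX ia pa i(3,5) b(2) in \<open>simp_all add: Hom_iff\<close>)
  then have "j \<in> special_injectives T A E structure_of_J"
    unfolding special_injectives_def injectives_structure_of_J Phi_lower_structure_of_J
    using j a b(1) bX i(1) by blast
  then show "\<exists>e\<in>inflations structure_of_J. Dom T e = X \<and> e \<in> special_injectives T A E structure_of_J"
    using inf j(2) by blast
qed

text \<open>Dually, \<open>j\<close> lies in \<open>Phi_upper\<close>, and \<open>j\<close> with the
  identity extends to a morphism from an angle of \<open>E\<close> on \<open>\<phi>\<close> to the
  angle of the special precover.\<close>

lemma enough_special_projectives_structure_of_I:
  assumes "special_precovering T A E I"
  shows "enough_special_projectives T A E structure_of_I"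
  unfolding enough_special_projectives_def
proof
  fix X assume X: "X \<in> A"
  then obtain i where "special_precover T A E I X i" using assms unfolding special_precovering_def by blast
  then obtain \<alpha>s j \<phi> where i: "i \<in> I" "Cod T i = X" and a: "\<alpha>s \<in> Ang T" "\<alpha>s ! (length \<alpha>s - 2) = i"
    and j: "j \<in> J" "\<phi> \<in> phantoms E" "Cod T j = Dom T (hd \<alpha>s)"
    "\<phi> \<in> Hom T X (ShOb T (Dom T j))" "last \<alpha>s = Sh T j \<cdot> \<phi>"
    unfolding special_precover_def right_eq[symmetric] by blast
  note ja = J_mor[OF j(1), unfolded Mor_iff] and pa = j(4)[unfolded Hom_iff]
  have "Sh T j \<cdot> \<phi> \<in> phantoms structure_of_I"
    using j(1,2) pa Phi_upper_structure_of_I Phi_upper_iff by blast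
  then have "last \<alpha>s \<in> phantoms_killed_by_I" using j(5) structure_of_I by simp
  moreover from this have "\<alpha>s \<in> E"
    using E_memI[OF a(1)] by (simp add: phantoms_killed_by_I_def)
  ultimately have "\<alpha>s \<in> structure_of_I" by (simp add: structure_of_I_def)
  then have "\<alpha>s ! (length \<alpha>s - 2) \<in> deflations structure_of_I"
    unfolding deflations_def by (rule imageI)
  then have def: "i \<in> deflations structure_of_I" using a(2) by simp
  obtain \<beta>s where b: "\<beta>s \<in> E" "last \<beta>s = \<phi>" by (rule phantomE[OF j(2)])
  note eb = angle_ends[OF E_angle[OF b(1)]]
  have "ShOb T (Dom T (hd \<beta>s)) = ShOb T (Dom T j)" using eb(4) b(2) pa by simp
  then have bX: "Dom T (hd \<beta>s) = Dom T j" using eb(1) ja by simp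
  obtain \<phi>s where m: "seq_morphism T \<phi>s \<beta>s \<alpha>s" "hd \<phi>s = j" "last \<phi>s = Id T X"
    by (rule F3_ends[OF E_angle[OF b(1)] a(1) _ _ _ that])
      (use X bX ja pa j(3,5) b(2) in \<open>simp_all add: Hom_iff\<close>)
  have "Dom T (last \<beta>s) = Cod T i" using b(2) pa i(2) by simp
  then have "i \<in> special_projectives T A E structure_of_I"
    unfolding special_projectives_def projectives_structure_of_I Phi_upper_structure_of_I
    using i a b(1) j(1) m by blast
  then show "\<exists>p\<in>deflations structure_of_I. Cod T p = X \<and> p \<in> special_projectives T A E structure_of_I"
    using def i(2) by blast
qed

section \<open>Approximations recovered from substructures\<close>

lemma precovering_if_Phi_lower:
  assumes proj: "enough_projectives T A E"
    and F: "F \<subseteq> E" "almost_exact_structure T A F" "enough_injectives T A F" "I = Phi_lower T A E F"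
  shows "precovering T A I"
  unfolding precovering_def
proof
  interpret F: exact_structure n T A F
    by unfold_locales (rule ext_closed, rule F)
  have sub: "phantoms F \<subseteq> phantoms E" using F(1) by (auto simp: phantoms_def)
  fix C assume C: "C \<in> A"
  obtain \<phi> where \<phi>: "\<phi> \<in> phantoms E" "Dom T \<phi> = C" and
    \<phi>_univ: "\<And>\<psi>. \<psi> \<in> phantoms E \<Longrightarrow> Dom T \<psi> = C \<Longrightarrow>
      \<exists>k\<in>Mor T A. Cod T \<phi> = ShOb T (Dom T k) \<and> \<psi> = Sh T k \<cdot> \<phi>"
    using ex_universal_phantom_from[OF proj C] by metis
  note \<phi>a = phantom_ar[OF \<phi>(1)]
  obtain K where K: "K \<in> A" "Cod T \<phi> = ShOb T K" using \<phi>a by blast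
  obtain \<psi> where \<psi>: "\<psi> \<in> phantoms F" "Cod T \<psi> = ShOb T K" and
    \<psi>_univ: "\<And>\<chi>. \<chi> \<in> phantoms F \<Longrightarrow> Cod T \<chi> = ShOb T K \<Longrightarrow> \<exists>h\<in>Hom T (Dom T \<chi>) (Dom T \<psi>). \<chi> = \<psi> \<cdot> h"
    using F.ex_universal_phantom_to[OF F(3) K(1)] by metis
  note \<psi>a = F.phantom_ar[OF \<psi>(1)]
  define D where "D = Dom T \<psi>"
  obtain W i\<^sub>1 i\<^sub>2 p\<^sub>1 p\<^sub>2 where W: "W \<in> A" "biproduct T C D W i\<^sub>1 i\<^sub>2 p\<^sub>1 p\<^sub>2"
    using biproduct_in_A[of C D] C \<psi>a(2) unfolding D_def by metis
  note b = W(2)[unfolded biproduct_def Hom_iff]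
  have CD: "C \<in> A" "D \<in> A" using C \<psi>a(2) by (simp_all add: D_def)
  \<comment> \<open>The row with entries \<open>\<phi>\<close> and \<open>\<psi>\<close>. It is a
    phantom of \<open>E\<close>, so it ends an angle of \<open>E\<close>, and the domain of its weak
    kernel \<open>p\<close> below lies in \<open>A\<close>.\<close>
  define \<theta> where "\<theta> = \<phi> \<cdot> p\<^sub>1 \<oplus> \<psi> \<cdot> p\<^sub>2"
  have \<theta>: "\<theta> \<in> phantoms E"
    unfolding \<theta>_def
  proof (rule phantom_plus)
    show "\<phi> \<cdot> p\<^sub>1 \<in> phantoms E" by (rule phantom_comp[OF \<phi>(1)]) (use b W CD \<phi>(2) in \<open>simp_all add: Mor_iff\<close>)
    have "\<psi> \<in> phantoms E" using \<psi>(1) sub by blast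
    then show "\<psi> \<cdot> p\<^sub>2 \<in> phantoms E"
      by (rule phantom_comp) (use b W CD in \<open>simp_all add: Mor_iff D_def[symmetric]\<close>)
  qed (use b \<phi> \<phi>a \<psi> \<psi>a K in \<open>simp_all add: D_def[symmetric]\<close>)
  have \<theta>a: "\<theta> \<in> Ar T" "Dom T \<theta> = W" "Cod T \<theta> = ShOb T K"
    unfolding \<theta>_def using b \<phi> \<phi>a \<psi> \<psi>a K by (simp_all add: D_def[symmetric])
  obtain \<alpha>s where a: "\<alpha>s \<in> E" "last \<alpha>s = \<theta>" by (rule phantomE[OF \<theta>])
  note e = angle_ends[OF E_angle[OF a(1)]] and aA = E_in_A[OF a(1)]
  define p where "p = \<alpha>s ! (n - 2)"
  have p: "p \<in> Ar T" "Dom T p \<in> A" "Cod T p = W" using e aA a(2) \<theta>a by (simp_all add: p_def)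
  have hdK: "ShOb T (Dom T (hd \<alpha>s)) = ShOb T K" using e(4) a(2) \<theta>a by simp
  have \<theta>p: "\<theta> \<cdot> p = Zero T (Dom T p) (ShOb T K)"
    using last_comp_penultimate[OF E_angle[OF a(1)]] a(2) hdK by (simp add: p_def)
  define i where "i = p\<^sub>1 \<cdot> p"
  have i: "i \<in> Ar T" "Dom T i = Dom T p" "Cod T i = C" unfolding i_def using p b by simp_all
  have iM: "i \<in> Mor T A" using i p C by (simp add: Mor_iff)
  have "\<phi> \<cdot> i \<oplus> \<psi> \<cdot> (p\<^sub>2 \<cdot> p) = \<theta> \<cdot> p"
    unfolding \<theta>_def i_def using p b \<phi> \<phi>a \<psi> \<psi>a K by (subst plus_comp) (simp_all add: D_def[symmetric])
  \<comment> \<open>Up to sign \<open>\<phi> \<cdot> i\<close> factors through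
    \<open>\<psi>\<close>, so it is a phantom of \<open>F\<close>. Universality of
    \<open>\<phi>\<close> then passes this on to all phantoms of \<open>E\<close> leaving
    \<open>C\<close>.\<close>
  then have \<phi>i: "\<phi> \<cdot> i = Neg T (\<psi> \<cdot> (p\<^sub>2 \<cdot> p))"
    unfolding \<theta>p by (intro neg_unique) (use p b i \<phi> \<phi>a \<psi> \<psi>a K in \<open>simp_all add: D_def[symmetric]\<close>)
  have "\<psi> \<cdot> (p\<^sub>2 \<cdot> p) \<in> phantoms F"
    by (rule F.phantom_comp[OF \<psi>(1)]) (use p b CD in \<open>simp_all add: Mor_iff D_def[symmetric]\<close>)
  then have \<phi>iF: "\<phi> \<cdot> i \<in> phantoms F" unfolding \<phi>i by (rule F.neg_phantom)
  have "i \<in> I"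
    unfolding F(4) Phi_lower_iff
  proof (intro conjI ballI impI iM)
    fix h assume h: "h \<in> phantoms E" "Dom T h = Cod T i"
    then obtain k where k: "k \<in> Mor T A" "Cod T \<phi> = ShOb T (Dom T k)" "h = Sh T k \<cdot> \<phi>"
      using \<phi>_univ i(3) by metis
    have "h \<cdot> i = Sh T k \<cdot> (\<phi> \<cdot> i)" unfolding k(3) using k(1,2) \<phi> \<phi>a i by (simp add: Mor_iff)
    then show "h \<cdot> i \<in> phantoms F"
      using F.sh_comp_phantom[OF \<phi>iF k(1)] k(2) \<phi> \<phi>a i by simp
  qed
  moreover have "\<exists>h\<in>Hom T (Dom T f) (Dom T i). f = i \<cdot> h" if f: "f \<in> I" "Cod T f = C" for f
  proof -
    note fa = I_mor[OF f(1), unfolded Mor_iff]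
    have "\<phi> \<cdot> f \<in> phantoms F" using f \<phi> unfolding F(4) Phi_lower_iff by simp
    then obtain g where g: "g \<in> Hom T (Dom T f) D" "\<phi> \<cdot> f = \<psi> \<cdot> g"
      using \<psi>_univ[of "\<phi> \<cdot> f"] \<phi> \<phi>a fa f(2) K unfolding D_def by auto
    then have ga: "g \<in> Ar T" "Dom T g = Dom T f" "Cod T g = D" by (auto simp: Hom_iff)
    \<comment> \<open>The column with entries \<open>f\<close> and \<open>Neg T g\<close>. As
      \<open>\<phi> \<cdot> f\<close> equals \<open>\<psi> \<cdot> g\<close>, it is killed by
      \<open>\<theta>\<close> and lifts along \<open>p\<close>.\<close>
    define u where "u = i\<^sub>1 \<cdot> f \<oplus> i\<^sub>2 \<cdot> Neg T g"
    have u: "u \<in> Ar T" "Dom T u = Dom T f" "Cod T u = W"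
      unfolding u_def using b fa f(2) ga by simp_all
    have "p\<^sub>1 \<cdot> u = (p\<^sub>1 \<cdot> i\<^sub>1) \<cdot> f \<oplus> (p\<^sub>1 \<cdot> i\<^sub>2) \<cdot> Neg T g" "p\<^sub>2 \<cdot> u = (p\<^sub>2 \<cdot> i\<^sub>1) \<cdot> f \<oplus> (p\<^sub>2 \<cdot> i\<^sub>2) \<cdot> Neg T g"
      unfolding u_def using b fa f(2) ga
      by (subst comp_plus; simp del: comp_assoc_ar add: comp_assoc_ar[symmetric])+
    then have pu: "p\<^sub>1 \<cdot> u = f" "p\<^sub>2 \<cdot> u = Neg T g"
      using b fa f(2) ga CD by simp_all
    have "\<theta> \<cdot> u = \<phi> \<cdot> (p\<^sub>1 \<cdot> u) \<oplus> \<psi> \<cdot> (p\<^sub>2 \<cdot> u)"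
      unfolding \<theta>_def using u b \<phi> \<phi>a \<psi> \<psi>a K by (subst plus_comp) (simp_all add: D_def[symmetric])
    also have "\<dots> = \<phi> \<cdot> f \<oplus> Neg T (\<phi> \<cdot> f)"
      unfolding pu g(2) using ga \<psi>a by (simp add: D_def)
    also have "\<dots> = Zero T (Dom T f) (ShOb T K)" using \<phi> \<phi>a fa f(2) K by simp
    finally have "\<exists>h\<in>Hom T (Dom T u) (Dom T p). u = p \<cdot> h"
      using deflation_factor[OF E_angle[OF a(1)] u(1)] u a(2) \<theta>a hdK unfolding p_def by simp
    then obtain h where h: "h \<in> Hom T (Dom T u) (Dom T p)" "u = p \<cdot> h" by blast
    have "f = p\<^sub>1 \<cdot> u" using pu by simp
    also have "\<dots> = i \<cdot> h" unfolding h(2) i_def using h(1) p b by (simp add: Hom_iff)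
    finally show ?thesis using h(1) u i by auto
  qed
  ultimately show "\<exists>i. precover T I C i" using i unfolding precover_def by blast
qed

text \<open>Dual to the weak kernel argument. Now \<open>\<phi>\<close> is universal among phantoms
  of \<open>E\<close> to \<Sigma>\<open>K\<close>, and \<open>\<psi>\<close> among those of
  \<open>F\<close> leaving the domain of \<open>\<phi>\<close>. An angle on the column
  \<open>\<theta>\<close> with these entries starts with a weak cokernel \<open>d\<close> of a
  desuspension of \<open>\<theta>\<close>, and the restriction of \<open>d\<close> to
  \<open>K\<close> is the preenvelope.\<close>

lemma preenveloping_if_Phi_upper:
  assumes inj: "enough_injectives T A E"
    and F: "F \<subseteq> E" "almost_exact_structure T A F" "enough_projectives T A F" "J = Phi_upper T A E F"
  shows "preenveloping T A J"
  unfolding preenveloping_def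
proof
  interpret F: exact_structure n T A F
    by unfold_locales (rule ext_closed, rule F)
  have sub: "phantoms F \<subseteq> phantoms E" using F(1) by (auto simp: phantoms_def)
  fix K assume K: "K \<in> A"
  obtain \<phi> where \<phi>: "\<phi> \<in> phantoms E" "Cod T \<phi> = ShOb T K" and
    \<phi>_univ: "\<And>\<psi>. \<psi> \<in> phantoms E \<Longrightarrow> Cod T \<psi> = ShOb T K \<Longrightarrow> \<exists>h\<in>Hom T (Dom T \<psi>) (Dom T \<phi>). \<psi> = \<phi> \<cdot> h"
    using ex_universal_phantom_to[OF inj K] by metis
  note \<phi>a = phantom_ar[OF \<phi>(1)]
  define C where "C = Dom T \<phi>"
  have C: "C \<in> A" using \<phi>a by (simp add: C_def)
  obtain \<psi> where \<psi>: "\<psi> \<in> phantoms F" "Dom T \<psi> = C" and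
    \<psi>_univ: "\<And>\<chi>. \<chi> \<in> phantoms F \<Longrightarrow> Dom T \<chi> = C \<Longrightarrow>
      \<exists>k\<in>Mor T A. Cod T \<psi> = ShOb T (Dom T k) \<and> \<chi> = Sh T k \<cdot> \<psi>"
    using F.ex_universal_phantom_from[OF F(3) C] by metis
  note \<psi>a = F.phantom_ar[OF \<psi>(1)]
  obtain D where D: "D \<in> A" "Cod T \<psi> = ShOb T D" using \<psi>a by blast
  obtain W i\<^sub>1 i\<^sub>2 p\<^sub>1 p\<^sub>2 where W: "W \<in> A" "biproduct T K D W i\<^sub>1 i\<^sub>2 p\<^sub>1 p\<^sub>2"
    using biproduct_in_A[OF K D(1)] by metis
  note b = W(2)[unfolded biproduct_def Hom_iff]
  define \<theta> where "\<theta> = Sh T i\<^sub>1 \<cdot> \<phi> \<oplus> Sh T i\<^sub>2 \<cdot> \<psi>"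
  note \<phi>' = \<phi>(2) \<phi>a(1) C_def[symmetric] and \<psi>' = \<psi>(2) \<psi>a(1) D(2)
  have \<theta>: "\<theta> \<in> phantoms E"
    unfolding \<theta>_def
  proof (rule phantom_plus)
    show "Sh T i\<^sub>1 \<cdot> \<phi> \<in> phantoms E"
      by (rule sh_comp_phantom[OF \<phi>(1)]) (use b W K \<phi>' in \<open>simp_all add: Mor_iff\<close>)
    have "\<psi> \<in> phantoms E" using \<psi>(1) sub by blast
    then show "Sh T i\<^sub>2 \<cdot> \<psi> \<in> phantoms E"
      by (rule sh_comp_phantom) (use b W D \<psi>' in \<open>simp_all add: Mor_iff\<close>)
  qed (use b \<phi>' \<psi>' in simp_all)
  have \<theta>a: "\<theta> \<in> Ar T" "Dom T \<theta> = C" "Cod T \<theta> = ShOb T W"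
    unfolding \<theta>_def using b \<phi>' \<psi>' by simp_all
  obtain \<alpha>s where a: "\<alpha>s \<in> E" "last \<alpha>s = \<theta>" by (rule phantomE[OF \<theta>])
  note e = angle_ends[OF E_angle[OF a(1)]] and aA = E_in_A[OF a(1)]
  define d where "d = hd \<alpha>s"
  have "ShOb T (Dom T (hd \<alpha>s)) = ShOb T W" using e(4) a(2) \<theta>a by simp
  then have d: "d \<in> Ar T" "Dom T d = W" "Cod T d \<in> A"
    using e(1) aA W(1) by (simp_all add: d_def)
  have d\<theta>: "Sh T d \<cdot> \<theta> = Zero T C (ShOb T (Cod T d))"
    using sh_hd_comp_last[OF E_angle[OF a(1)]] a(2) \<theta>a by (simp add: d_def)
  define j where "j = d \<cdot> i\<^sub>1"
  have j: "j \<in> Ar T" "Dom T j = K" "Cod T j = Cod T d" unfolding j_def using d b by simp_all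
  have jM: "j \<in> Mor T A" using j d K by (simp add: Mor_iff)
  have "Sh T j \<cdot> \<phi> \<oplus> Sh T (d \<cdot> i\<^sub>2) \<cdot> \<psi> = Sh T d \<cdot> \<theta>"
    unfolding \<theta>_def j_def using d b \<phi>' \<psi>' by (subst comp_plus) simp_all
  then have j\<phi>: "Sh T j \<cdot> \<phi> = Neg T (Sh T (d \<cdot> i\<^sub>2) \<cdot> \<psi>)"
    unfolding d\<theta> by (intro neg_unique) (use d b j \<phi>' \<psi>' in simp_all)
  have "Sh T (d \<cdot> i\<^sub>2) \<cdot> \<psi> \<in> phantoms F"
    by (rule F.sh_comp_phantom[OF \<psi>(1)]) (use d b D in \<open>simp_all add: Mor_iff\<close>)
  then have j\<phi>F: "Sh T j \<cdot> \<phi> \<in> phantoms F" unfolding j\<phi> by (rule F.neg_phantom)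
  have "j \<in> J"
    unfolding F(4) Phi_upper_iff
  proof (intro conjI ballI impI jM)
    fix h assume h: "h \<in> phantoms E" "Cod T h = ShOb T (Dom T j)"
    then obtain r where r: "r \<in> Hom T (Dom T h) C" "h = \<phi> \<cdot> r"
      using \<phi>_univ j(2) unfolding C_def by metis
    have rM: "r \<in> Mor T A" "Cod T r = C" using r(1) C phantom_ar(2)[OF h(1)] by (simp_all add: Hom_iff Mor_iff)
    have "Sh T j \<cdot> h = (Sh T j \<cdot> \<phi>) \<cdot> r" unfolding r(2) using rM \<phi>' j by (simp add: Mor_iff)
    then show "Sh T j \<cdot> h \<in> phantoms F"
      using F.phantom_comp[OF j\<phi>F rM(1)] rM(2) j \<phi>' by simp
  qed
  moreover have "\<exists>h\<in>Hom T (Cod T j) (Cod T g). g = h \<cdot> j" if g: "g \<in> J" "Dom T g = K" for g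
  proof -
    note ga = J_mor[OF g(1), unfolded Mor_iff]
    have "Sh T g \<cdot> \<phi> \<in> phantoms F" using g \<phi> unfolding F(4) Phi_upper_iff by simp
    moreover have "Dom T (Sh T g \<cdot> \<phi>) = C" using ga g(2) \<phi>' by simp
    ultimately obtain k where k: "k \<in> Mor T A" "Cod T \<psi> = ShOb T (Dom T k)" "Sh T g \<cdot> \<phi> = Sh T k \<cdot> \<psi>"
      using \<psi>_univ by blast
    have "ShOb T (Cod T k) = Cod T (Sh T k \<cdot> \<psi>)" using k(1,2) \<psi>' by (simp add: Mor_iff)
    also have "\<dots> = ShOb T (Cod T g)" unfolding k(3)[symmetric] using ga g(2) \<phi>' by simp
    finally have ka: "k \<in> Ar T" "Dom T k = D" "Cod T k = Cod T g"
      using k(1,2) D ga by (simp_all add: Mor_iff)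
    \<comment> \<open>The row with entries \<open>g\<close> and \<open>Neg T k\<close>. Its shift
      kills \<open>\<theta>\<close>, because \<open>g\<close> after \<open>\<phi>\<close> and
      \<open>k\<close> after \<open>\<psi>\<close> agree once shifted; hence it factors through
      \<open>d\<close>.\<close>
    define u where "u = g \<cdot> p\<^sub>1 \<oplus> Neg T k \<cdot> p\<^sub>2"
    have u: "u \<in> Ar T" "Dom T u = W" "Cod T u = Cod T g"
      unfolding u_def using b ga g(2) ka by simp_all
    have "u \<cdot> i\<^sub>1 = g \<cdot> (p\<^sub>1 \<cdot> i\<^sub>1) \<oplus> Neg T k \<cdot> (p\<^sub>2 \<cdot> i\<^sub>1)" "u \<cdot> i\<^sub>2 = g \<cdot> (p\<^sub>1 \<cdot> i\<^sub>2) \<oplus> Neg T k \<cdot> (p\<^sub>2 \<cdot> i\<^sub>2)"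
      unfolding u_def using b ga g(2) ka by (subst plus_comp; simp)+
    then have ui: "u \<cdot> i\<^sub>1 = g" "u \<cdot> i\<^sub>2 = Neg T k"
      using b ga g(2) ka K D by simp_all
    have "Sh T u \<cdot> \<theta> = Sh T (u \<cdot> i\<^sub>1) \<cdot> \<phi> \<oplus> Sh T (u \<cdot> i\<^sub>2) \<cdot> \<psi>"
      unfolding \<theta>_def using u b \<phi>' \<psi>' by (subst comp_plus) simp_all
    also have "\<dots> = Sh T g \<cdot> \<phi> \<oplus> Neg T (Sh T g \<cdot> \<phi>)"
      unfolding ui k(3) using ka \<psi>' by simp
    also have "\<dots> = Zero T C (ShOb T (Cod T g))" using \<phi>' ga g(2) by simp
    finally have "\<exists>h\<in>Hom T (Cod T d) (Cod T u). u = h \<cdot> d"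
      using inflation_factor[OF E_angle[OF a(1)] u(1)] u d(2) a(2) \<theta>a unfolding d_def by simp
    then obtain h where h: "h \<in> Hom T (Cod T d) (Cod T u)" "u = h \<cdot> d" by blast
    have "g = u \<cdot> i\<^sub>1" using ui by simp
    also have "\<dots> = h \<cdot> j" unfolding h(2) j_def using h(1) d b by (simp add: Hom_iff)
    finally show ?thesis using h(1) u j by auto
  qed
  ultimately show "\<exists>j. preenvelope T J K j" using j unfolding preenvelope_def by blast
qed

text \<open>An inflation that is itself injective is a preenvelope for the injectives, since these
  factor through every inflation from the same object.\<close>

lemma preenveloping_if_injectives:
  assumes "enough_injectives T A H" "J = injectives T A H"
  shows "preenveloping T A J"
  unfolding preenveloping_def
proof
  fix X assume "X \<in> A"
  then obtain e where "e \<in> inflations H" "Dom T e = X" "e \<in> J"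
    using assms unfolding enough_injectives_def by blast
  then have "preenvelope T J X e"
    unfolding preenvelope_def assms(2) injectives_def by blast
  then show "\<exists>j. preenvelope T J X j" by blast
qed

lemma precovering_if_projectives:
  assumes "enough_projectives T A H" "I = projectives T A H"
  shows "precovering T A I"
  unfolding precovering_def
proof
  fix X assume "X \<in> A"
  then obtain p where "p \<in> deflations H" "Cod T p = X" "p \<in> I"
    using assms unfolding enough_projectives_def by blast
  then have "precover T I X p"
    unfolding precover_def assms(2) projectives_def by blast
  then show "\<exists>i. precover T I X i" by blast
qed

end

section \<open>Equivalence of the ten statements\<close>

lemma enough_injectives_if_special: "enough_special_injectives T A E H \<Longrightarrow> enough_injectives T A H"
  unfolding enough_special_injectives_def enough_injectives_def special_injectives_def by blast

lemma enough_projectives_if_special: "enough_special_projectives T A E H \<Longrightarrow> enough_projectives T A H"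
  unfolding enough_special_projectives_def enough_projectives_def special_projectives_def by blast

theorem theorem4p16:
  fixes n :: nat and T :: "('o, 'm) ncat" and A :: "'o set"
    and E :: "'m list set" and I J :: "'m set"
  assumes "n_angulated_category n T"
    and "extension_closed_subcategory T A"
    and "almost_exact_structure T A E"
    and "enough_injectives T A E"
    and "enough_projectives T A E"
    and "ideal_cotorsion_pair T A E I J"
  shows "all_equivalent
    [precovering T A I,
     special_precovering T A E I,
     preenveloping T A J,
     special_preenveloping T A E J,
     \<exists>H\<subseteq>E. almost_exact_structure T A H \<and> enough_special_injectives T A E H
       \<and> I = Phi_lower T A E H,
     \<exists>F\<subseteq>E. almost_exact_structure T A F \<and> enough_injectives T A F
       \<and> I = Phi_lower T A E F,
     \<exists>H\<subseteq>E. almost_exact_structure T A H \<and> enough_special_injectives T A E H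
       \<and> J = injectives T A H,
     \<exists>G\<subseteq>E. almost_exact_structure T A G \<and> enough_special_projectives T A E G
       \<and> J = Phi_upper T A E G,
     \<exists>F\<subseteq>E. almost_exact_structure T A F \<and> enough_projectives T A F
       \<and> J = Phi_upper T A E F,
     \<exists>G\<subseteq>E. almost_exact_structure T A G \<and> enough_special_projectives T A E G
       \<and> I = projectives T A G]" (is "all_equivalent [?a, ?b, ?c, ?d, ?e, ?f, ?g, ?h, ?i, ?j]")
proof -
  interpret n_angulated_category n T by (rule assms)
  interpret cotorsion_pair n T A E I J
    by unfold_locales (rule assms)+
  have sub: "structure_of_J \<subseteq> E" "structure_of_I \<subseteq> E"
    by (auto simp: structure_of_J_def structure_of_I_def)
  have ad: "?a \<Longrightarrow> ?d" by (rule special_preenveloping_if_precovering[OF assms(4)])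
  have dc: "?d \<Longrightarrow> ?c" by (rule preenveloping_if_special)
  have cb: "?c \<Longrightarrow> ?b" by (rule special_precovering_if_preenveloping[OF assms(5)])
  have ba: "?b \<Longrightarrow> ?a" by (rule precovering_if_special)
  have de: "?d \<Longrightarrow> ?e"
    using sub structure_of_J(1) enough_special_injectives_structure_of_J Phi_lower_structure_of_J by metis
  have dg: "?d \<Longrightarrow> ?g"
    using sub structure_of_J(1) enough_special_injectives_structure_of_J injectives_structure_of_J by metis
  have bh: "?b \<Longrightarrow> ?h"
    using sub structure_of_I(1) enough_special_projectives_structure_of_I Phi_upper_structure_of_I by metis
  have bj: "?b \<Longrightarrow> ?j"
    using sub structure_of_I(1) enough_special_projectives_structure_of_I projectives_structure_of_I by metis
  have ef: "?e \<Longrightarrow> ?f" using enough_injectives_if_special by blast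
  have hi: "?h \<Longrightarrow> ?i" using enough_projectives_if_special by blast
  have fa: "?f \<Longrightarrow> ?a" using precovering_if_Phi_lower[OF assms(5)] by blast
  have ic: "?i \<Longrightarrow> ?c" using preenveloping_if_Phi_upper[OF assms(4)] by blast
  have gc: "?g \<Longrightarrow> ?c" using preenveloping_if_injectives enough_injectives_if_special by blast
  have ja: "?j \<Longrightarrow> ?a" using precovering_if_projectives enough_projectives_if_special by blast
  \<comment> \<open>The implications form the cycle a, d, c, b, a with the detours d, e, f, a and d,
    g, c and b, h, i, c and b, j, a.\<close>
  have "?b = ?a" "?c = ?a" "?d = ?a" "?e = ?a" "?f = ?a" "?g = ?a" "?h = ?a" "?i = ?a" "?j = ?a"
    using ad dc cb ba de dg bh bj ef hi fa ic gc ja by argo+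
  then show ?thesis
    unfolding all_equivalent_def by simp
qed

end
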